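(* Let $X$ be any one of the six subsets $\emptyset,\ \{\epsilon\},\ \{\sigma\},\ \{\sigma,\delta\},\ \{\sigma,\epsilon\},\ \{\sigma,\delta,\epsilon\}$ of $\{\sigma,\delta,\epsilon\}$ (i.e. any subset other than $\{\delta\}$ and $\{\delta,\epsilon\}$), and let $!={!_X}$ be the associated monad on categories. Then the transformation $\lambda:\ !\circ \mathrm{Psh}\to \mathrm{Psh}\circ{!}$, whose component at a small category $\mathbf{C}$ is the functor $\lambda_{\mathbf C}:{!}(\mathrm{Psh}(\mathbf C))\to \mathrm{Psh}({!}\mathbf C)$ given on objects by $$\lambda_{\mathbf C}(F_1,\ldots,F_n)(C_1,\ldots,C_m)=\int^{D_1,\ldots,D_n\in\mathbf C}F_1D_1\times\cdots\times F_nD_n\times {!}\mathbf{C}[(C_1,\ldots,C_m),(D_1,\ldots,D_n)],$$ is a (pseudo-)distributive law of the monad $!$ over the presheaf Kleisli structure $\mathrm{Psh}$.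
   Context: **The monads $!_X$.** For a category $\mathbf C$ and $X\subseteq\{\sigma,\delta,\epsilon\}$, the category ${!_X}\mathbf C$ has as objects the finite (possibly empty) sequences $(C_1,\ldots,C_n)$ of objects of $\mathbf C$. Its morphisms are string diagrams built by vertical composition and horizontal juxtaposition from the morphisms $f:(C)\to(D)$ of $\mathbf C$ and from those of the combinators $\sigma:(C_1,C_2)\to(C_2,C_1)$, $\delta:(C)\to(C,C)$, $\epsilon:(C)\to()$ that lie in $X$. They are taken modulo: functoriality of the inclusion of $\mathbf C$; naturality of the combinators of $X$ with respect to morphisms of $\mathbf C$ and to each other; and those of the following equations that only involve combinators of $X$: $\sigma$ is a symmetry ($\sigma\circ\sigma=\mathrm{id}$ and the Yang–Baxter equation); $(\delta,\epsilon)$ satisfy the comonoid laws; $\sigma\circ\delta=\delta$; compatibility of $\sigma$ with $\delta$ and $\epsilon$. Concretely, for the six $X$ considered, a morphism $(C_1,\ldots,C_n)\to(D_1,\ldots,D_m)$ is a function $f:\{1,\ldots,m\}\to\{1,\ldots,n\}$ together with morphisms $g_j:C_{f(j)}\to D_j$ of $\mathbf C$ for $1\le j\le m$, where $f$ ranges over: identities if $X=\emptyset$; monotone injections if $X=\{\epsilon\}$; bijections if $X=\{\sigma\}$; surjections if $X=\{\sigma,\delta\}$; injections if $X=\{\sigma,\epsilon\}$; all functions if $X=\{\sigma,\delta,\epsilon\}$. The unit $\eta_!:\mathbf C\to{!}\mathbf C$ sends $C$ to $(C)$ and the multiplication $\mu_!:{!!}\mathbf C\to{!}\mathbf C$ is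 flattening (concatenation) of sequences of sequences, with the corresponding action on morphisms. **The presheaf Kleisli structure.** For a small category $\mathbf C$, $\mathrm{Psh}(\mathbf C)=\mathbf{Set}^{\mathbf C^{op}}$. The unit $\eta_{\mathrm{Psh}}:\mathbf C\to\mathrm{Psh}(\mathbf C)$ is the Yoneda embedding. For small $\mathbf C,\mathbf D$ and a functor $F:\mathbf C\to\mathrm{Psh}(\mathbf D)$, the functor $F^{\#}:\mathrm{Psh}(\mathbf C)\to\mathrm{Psh}(\mathbf D)$ is the left Kan extension of $F$ along the Yoneda embedding, $F^{\#}(Z)(D)=\int^{C}Z(C)\times F(C)(D)$. On a functor $F:\mathbf C\to\mathbf D$ of small categories, $\mathrm{Psh}(F)=(\eta_{\mathrm{Psh}}\circ F)^{\#}$, i.e. $\mathrm{Psh}(F)(Z)(D)=\int^C Z(C)\times\mathbf D[D,FC]$. **Action of $\lambda_{\mathbf C}$ on morphisms.** It is determined by its action on generators: a natural transformation $\alpha:F\to G$ acts by applying $\alpha$ to the corresponding factor $FD$; a combinator acts by the corresponding map on the factors together with post-composition in ${!}\mathbf C$, e.g. $\delta:(F)\to(F,F)$ is induced by the maps $FD\times{!}\mathbf C[\vec C,(D)]\to FD\times FD\times{!}\mathbf C[\vec C,(D,D)]$ given by duplication and post-composition with $\delta:(D)\to(D,D)$. In terms of the concrete description, a morphism $(F_1,\ldots,F_n)\to(G_1,\ldots,G_m)$ given by $f$ and $\alpha_j:F_{f(j)}\to G_j$ sends the class of $(x_1,\ldots,x_n,u)$, with $x_i\in F_iD_i$ and $u:\vec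 C\to(D_1,\ldots,D_n)$, to the class of $(\alpha_1(x_{f(1)}),\ldots,\alpha_m(x_{f(m)}),\ \bar f\circ u)$, where $\bar f:(D_1,\ldots,D_n)\to(D_{f(1)},\ldots,D_{f(m)})$ has underlying function $f$ and identity components. **Distributive law.** A (pseudo-)distributive law of the monad $!$ over the Kleisli structure $\mathrm{Psh}$ means: small categories are stable under $!$, and $\lambda$ is a transformation natural in the small category $\mathbf C$ such that the following equations hold, for all small $\mathbf A,\mathbf B,\mathbf C$ and all functors $g:\mathbf A\to\mathrm{Psh}(\mathbf B)$: 1. $\lambda_{\mathbf C}\circ(\eta_!)_{\mathrm{Psh}(\mathbf C)}=\mathrm{Psh}((\eta_!)_{\mathbf C})$; 2. $\lambda_{\mathbf C}\circ(\mu_!)_{\mathrm{Psh}(\mathbf C)}=\mathrm{Psh}((\mu_!)_{\mathbf C})\circ\lambda_{!\mathbf C}\circ{!}(\lambda_{\mathbf C})$; 3. $\lambda_{\mathbf C}\circ{!}(\eta_{\mathrm{Psh}})_{\mathbf C}=(\eta_{\mathrm{Psh}})_{!\mathbf C}$; 4. $\lambda_{\mathbf B}\circ{!}(g^{\#})=(\lambda_{\mathbf B}\circ{!}g)^{\#}\circ\lambda_{\mathbf A}$. Since coends are only defined up to isomorphism, all these equalities (and naturality) are understood up to canonical natural isomorphism, and coherence conditions between these isomorphisms are ignored, as is the paper's explicit convention. *)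

theory Defs
  imports "HOL-Library.FuncSet"
begin

section \<open>Categories and functors\<close>

record ('o, 'a) cat =
  Obj :: "'o set"
  Arr :: "'a set"
  Dom :: "'a \<Rightarrow> 'o"
  Cod :: "'a \<Rightarrow> 'o"
  Ide :: "'o \<Rightarrow> 'a"
  Cmp :: "'a \<Rightarrow> 'a \<Rightarrow> 'a"  (infixl "\<cdot>\<index>" 70)

definition Hom :: "('o, 'a) cat \<Rightarrow> 'o \<Rightarrow> 'o \<Rightarrow> 'a set" where
  "Hom C x y = {f \<in> Arr C. Dom C f = x \<and> Cod C f = y}"

locale category =
  fixes C :: "('o, 'a) cat" (structure)
  assumes Dom_in: "f \<in> Arr C \<Longrightarrow> Dom C f \<in> Obj C"
    and Cod_in: "f \<in> Arr C \<Longrightarrow> Cod C f \<in> Obj C"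
    and Ide_in: "x \<in> Obj C \<Longrightarrow> Ide C x \<in> Hom C x x"
    and Cmp_in: "\<lbrakk>f \<in> Hom C x y; g \<in> Hom C y z\<rbrakk> \<Longrightarrow> g \<cdot> f \<in> Hom C x z"
    and Cmp_Ide: "f \<in> Hom C x y \<Longrightarrow> f \<cdot> Ide C x = f"
    and Ide_Cmp: "f \<in> Hom C x y \<Longrightarrow> Ide C y \<cdot> f = f"
    and Cmp_assoc: "\<lbrakk>f \<in> Hom C w x; g \<in> Hom C x y; h \<in> Hom C y z\<rbrakk>
      \<Longrightarrow> (h \<cdot> g) \<cdot> f = h \<cdot> (g \<cdot> f)"

record ('o, 'a, 'p, 'b) fctr =
  FO :: "'o \<Rightarrow> 'p"
  FA :: "'a \<Rightarrow> 'b"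

locale is_functor = dom: category C + cod: category D
  for C :: "('o, 'a) cat" and D :: "('p, 'b) cat" and F :: "('o, 'a, 'p, 'b) fctr" +
  assumes FO_in: "x \<in> Obj C \<Longrightarrow> FO F x \<in> Obj D"
    and FA_in: "f \<in> Hom C x y \<Longrightarrow> FA F f \<in> Hom D (FO F x) (FO F y)"
    and FA_Ide: "x \<in> Obj C \<Longrightarrow> FA F (Ide C x) = Ide D (FO F x)"
    and FA_Cmp: "\<lbrakk>f \<in> Hom C x y; g \<in> Hom C y z\<rbrakk>
      \<Longrightarrow> FA F (g \<cdot>\<^bsub>C\<^esub> f) = FA F g \<cdot>\<^bsub>D\<^esub> FA F f"

definition fcomp ::
  "('p, 'b, 'q, 'c) fctr \<Rightarrow> ('o, 'a, 'p, 'b) fctr \<Rightarrow> ('o, 'a, 'q, 'c) fctr"  (infixl "\<odot>" 55) where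
  "G \<odot> F = \<lparr>FO = FO G \<circ> FO F, FA = FA G \<circ> FA F\<rparr>"

text \<open>The \<open>n\<close>-fold power \<open>C \<times> \<dots> \<times> C\<close>, with tuples represented by lists of length \<open>n\<close>.\<close>

definition pow :: "('o, 'a) cat \<Rightarrow> nat \<Rightarrow> ('o list, 'a list) cat" where
  "pow C n =
    \<lparr>Obj = {xs. length xs = n \<and> set xs \<subseteq> Obj C},
     Arr = {fs. length fs = n \<and> set fs \<subseteq> Arr C},
     Dom = map (Dom C),
     Cod = map (Cod C),
     Ide = map (Ide C),
     Cmp = map2 (Cmp C)\<rparr>"

section \<open>The monads \<open>!\<^sub>X\<close>\<close>

datatype combinator = Sigma_c | Delta_c | Epsilon_c

text \<open>A list \<open>f\<close> stands for the function \<open>j \<mapsto> f ! j\<close> from \<open>{0..<length f}\<close> to \<open>{0..<n}\<close>: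
  all indices count from \<open>0\<close>.  For sets \<open>X\<close> other than these six
  there is no wiring.\<close>

definition wiring :: "combinator set \<Rightarrow> nat \<Rightarrow> nat list \<Rightarrow> bool" where
  "wiring X n f \<longleftrightarrow>
    set f \<subseteq> {..<n} \<and>
    (X = {} \<and> f = [0..<n] \<or>
     X = {Epsilon_c} \<and> mono_on {..<length f} ((!) f) \<and> inj_on ((!) f) {..<length f} \<or>
     X = {Sigma_c} \<and> bij_betw ((!) f) {..<length f} {..<n} \<or>
     X = {Sigma_c, Delta_c} \<and> (!) f ` {..<length f} = {..<n} \<or>
     X = {Sigma_c, Epsilon_c} \<and> inj_on ((!) f) {..<length f} \<or>
     X = {Sigma_c, Delta_c, Epsilon_c})"

text \<open>A morphism of \<open>!C\<close> from \<open>Src h\<close> to \<open>Tgt h\<close>: an underlying function \<open>Wir h\<close> from the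
  positions of \<open>Tgt h\<close> to the positions of \<open>Src h\<close>, and a label in \<open>C\<close> for each position of
  \<open>Tgt h\<close>.\<close>

record ('o, 'a) barr =
  Src :: "'o list"
  Tgt :: "'o list"
  Wir :: "nat list"
  Lab :: "'a list"

definition bang :: "combinator set \<Rightarrow> ('o, 'a) cat \<Rightarrow> ('o list, ('o, 'a) barr) cat" where
  "bang X C =
    \<lparr>Obj = lists (Obj C),
     Arr = {h. Src h \<in> lists (Obj C) \<and> Tgt h \<in> lists (Obj C) \<and>
               length (Wir h) = length (Tgt h) \<and> length (Lab h) = length (Tgt h) \<and>
               wiring X (length (Src h)) (Wir h) \<and>
               (\<forall>j < length (Tgt h). Lab h ! j \<in> Hom C (Src h ! (Wir h ! j)) (Tgt h ! j))},
     Dom = Src,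
     Cod = Tgt,
     Ide = (\<lambda>xs. \<lparr>Src = xs, Tgt = xs, Wir = [0..<length xs], Lab = map (Ide C) xs\<rparr>),
     Cmp = (\<lambda>k h. \<lparr>Src = Src h, Tgt = Tgt k,
                   Wir = map (\<lambda>j. Wir h ! (Wir k ! j)) [0..<length (Tgt k)],
                   Lab = map (\<lambda>j. Lab k ! j \<cdot>\<^bsub>C\<^esub> Lab h ! (Wir k ! j)) [0..<length (Tgt k)]\<rparr>)\<rparr>"

definition bang_map :: "('o, 'a, 'p, 'b) fctr \<Rightarrow> ('o list, ('o, 'a) barr, 'p list, ('p, 'b) barr) fctr" where
  "bang_map F =
    \<lparr>FO = map (FO F),
     FA = (\<lambda>h. \<lparr>Src = map (FO F) (Src h), Tgt = map (FO F) (Tgt h),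
                Wir = Wir h, Lab = map (FA F) (Lab h)\<rparr>)\<rparr>"

definition eta_bang :: "('o, 'a) cat \<Rightarrow> ('o, 'a, 'o list, ('o, 'a) barr) fctr" where
  "eta_bang C =
    \<lparr>FO = (\<lambda>x. [x]),
     FA = (\<lambda>f. \<lparr>Src = [Dom C f], Tgt = [Cod C f], Wir = [0], Lab = [f]\<rparr>)\<rparr>"

text \<open>On morphisms: position \<open>i\<close> of block \<open>j\<close> of the target is sent to the position
  \<open>Wir (Lab h ! j) ! i\<close> of block \<open>Wir h ! j\<close> of the source.\<close>

definition mu_bang ::
  "('o list list, ('o list, ('o, 'a) barr) barr, 'o list, ('o, 'a) barr) fctr" where
  "mu_bang =
    \<lparr>FO = concat,
     FA = (\<lambda>h. \<lparr>Src = concat (Src h), Tgt = concat (Tgt h),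
                Wir = concat (map (\<lambda>j. map (\<lambda>p. length (concat (take (Wir h ! j) (Src h))) + p)
                                            (Wir (Lab h ! j)))
                                  [0..<length (Tgt h)]),
                Lab = concat (map Lab (Lab h))\<rparr>)\<rparr>"

text \<open>The morphism of \<open>!C\<close> with underlying function the identity and labels \<open>gs\<close>, and the
  morphism \<open>(D\<^sub>0, \<dots>) \<rightarrow> (D\<^sub>f\<^sub>(\<^sub>0\<^sub>), \<dots>)\<close> with underlying function \<open>f\<close> and identity
  labels.\<close>

definition par :: "('o, 'a) cat \<Rightarrow> 'a list \<Rightarrow> ('o, 'a) barr" where
  "par C gs = \<lparr>Src = map (Dom C) gs, Tgt = map (Cod C) gs, Wir = [0..<length gs], Lab = gs\<rparr>"

definition rewire :: "('o, 'a) cat \<Rightarrow> nat list \<Rightarrow> 'o list \<Rightarrow> ('o, 'a) barr" where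
  "rewire C f Ds =
    \<lparr>Src = Ds, Tgt = map ((!) Ds) f, Wir = f, Lab = map (\<lambda>j. Ide C (Ds ! j)) f\<rparr>"

section \<open>Presheaves\<close>

text \<open>A presheaf on \<open>C\<close> takes values in subsets of a type \<open>'x\<close>.  Coends of such presheaves are sets
  of equivalence classes and so live in a different type; this is why \<open>'x\<close> is kept arbitrary
  everywhere, and why isomorphisms between presheaves with different value types are needed below.
  Outside of their domains, presheaves and their morphisms have fixed values, so that equality is
  the expected one.\<close>

record ('o, 'a, 'x) presheaf =
  At :: "'o \<Rightarrow> 'x set"
  Act :: "'a \<Rightarrow> 'x \<Rightarrow> 'x"

locale is_presheaf =
  fixes C :: "('o, 'a) cat" and P :: "('o, 'a, 'x) presheaf"
  assumes Act_in: "f \<in> Hom C c d \<Longrightarrow> Act P f \<in> At P d \<rightarrow>\<^sub>E At P c"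
    and Act_Ide: "\<lbrakk>c \<in> Obj C; x \<in> At P c\<rbrakk> \<Longrightarrow> Act P (Ide C c) x = x"
    and Act_Cmp: "\<lbrakk>f \<in> Hom C b c; g \<in> Hom C c d; x \<in> At P d\<rbrakk>
      \<Longrightarrow> Act P (g \<cdot>\<^bsub>C\<^esub> f) x = Act P f (Act P g x)"
    and At_outside: "c \<notin> Obj C \<Longrightarrow> At P c = {}"
    and Act_outside: "f \<notin> Arr C \<Longrightarrow> Act P f = (\<lambda>_. undefined)"

record ('o, 'a, 'x) ptrans =
  NDom :: "('o, 'a, 'x) presheaf"
  NCod :: "('o, 'a, 'x) presheaf"
  NAt :: "'o \<Rightarrow> 'x \<Rightarrow> 'x"

locale is_ptrans =
  dom: is_presheaf C "NDom \<alpha>" + cod: is_presheaf C "NCod \<alpha>"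
  for C :: "('o, 'a) cat" and \<alpha> :: "('o, 'a, 'x) ptrans" +
  assumes NAt_in: "c \<in> Obj C \<Longrightarrow> NAt \<alpha> c \<in> At (NDom \<alpha>) c \<rightarrow>\<^sub>E At (NCod \<alpha>) c"
    and natural: "\<lbrakk>f \<in> Hom C c d; x \<in> At (NDom \<alpha>) d\<rbrakk>
      \<Longrightarrow> NAt \<alpha> c (Act (NDom \<alpha>) f x) = Act (NCod \<alpha>) f (NAt \<alpha> d x)"
    and NAt_outside: "c \<notin> Obj C \<Longrightarrow> NAt \<alpha> c = (\<lambda>_. undefined)"

definition psh :: "('o, 'a) cat \<Rightarrow> (('o, 'a, 'x) presheaf, ('o, 'a, 'x) ptrans) cat" where
  "psh C =
    \<lparr>Obj = {P. is_presheaf C P},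
     Arr = {\<alpha>. is_ptrans C \<alpha>},
     Dom = NDom,
     Cod = NCod,
     Ide = (\<lambda>P. \<lparr>NDom = P, NCod = P,
                 NAt = (\<lambda>c. if c \<in> Obj C then restrict (\<lambda>x. x) (At P c) else (\<lambda>_. undefined))\<rparr>),
     Cmp = (\<lambda>\<beta> \<alpha>. \<lparr>NDom = NDom \<alpha>, NCod = NCod \<beta>,
                   NAt = (\<lambda>c. if c \<in> Obj C
                              then restrict (\<lambda>x. NAt \<beta> c (NAt \<alpha> c x)) (At (NDom \<alpha>) c)
                              else (\<lambda>_. undefined))\<rparr>)\<rparr>"

definition yoneda :: "('o, 'a) cat \<Rightarrow> ('o, 'a, ('o, 'a, 'a) presheaf, ('o, 'a, 'a) ptrans) fctr" where
  "yoneda C =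
    (let y = (\<lambda>c. \<lparr>At = (\<lambda>d. Hom C d c),
                  Act = (\<lambda>g. if g \<in> Arr C then restrict (\<lambda>h. h \<cdot>\<^bsub>C\<^esub> g) (Hom C (Cod C g) c)
                             else (\<lambda>_. undefined))\<rparr>)
     in \<lparr>FO = y,
         FA = (\<lambda>f. \<lparr>NDom = y (Dom C f), NCod = y (Cod C f),
                    NAt = (\<lambda>d. if d \<in> Obj C then restrict (\<lambda>h. f \<cdot>\<^bsub>C\<^esub> h) (Hom C d (Dom C f))
                               else (\<lambda>_. undefined))\<rparr>)\<rparr>)"

section \<open>Coends\<close>

text \<open>The data of a functor \<open>T : C\<^sup>o\<^sup>p \<times> C \<rightarrow> Set\<close>: \<open>BO T c d\<close> is its value, and for
  \<open>f : c' \<rightarrow> c\<close> and \<open>g : d \<rightarrow> d'\<close>, \<open>BA T f g\<close> maps \<open>BO T c d\<close> to \<open>BO T c' d'\<close>.\<close>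

record ('o, 'a, 't) bif =
  BO :: "'o \<Rightarrow> 'o \<Rightarrow> 't set"
  BA :: "'a \<Rightarrow> 'a \<Rightarrow> 't \<Rightarrow> 't"

definition coend_step :: "('o, 'a) cat \<Rightarrow> ('o, 'a, 't) bif \<Rightarrow> ('o \<times> 't) rel" where
  "coend_step C T =
    {((c, BA T f (Ide C c) t), (c', BA T (Ide C c') f t)) | f c c' t.
      f \<in> Hom C c c' \<and> t \<in> BO T c' c}"

definition coend_eq :: "('o, 'a) cat \<Rightarrow> ('o, 'a, 't) bif \<Rightarrow> ('o \<times> 't) rel" where
  "coend_eq C T = (coend_step C T \<union> (coend_step C T)\<inverse>)\<^sup>*"

definition coend :: "('o, 'a) cat \<Rightarrow> ('o, 'a, 't) bif \<Rightarrow> ('o \<times> 't) set set" where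
  "coend C T = (SIGMA c : Obj C. BO T c c) // coend_eq C T"

definition cls :: "('o, 'a) cat \<Rightarrow> ('o, 'a, 't) bif \<Rightarrow> 'o \<times> 't \<Rightarrow> ('o \<times> 't) set" where
  "cls C T p = coend_eq C T `` {p}"

text \<open>The map from the coend of \<open>T\<close> over \<open>C\<close> to the coend of \<open>T'\<close> over \<open>C'\<close> which is induced by a
  function \<open>m\<close> on representatives.\<close>

definition coend_map :: "('o, 'a) cat \<Rightarrow> ('o, 'a, 't) bif \<Rightarrow> ('p, 'b) cat \<Rightarrow> ('p, 'b, 's) bif
    \<Rightarrow> ('o \<times> 't \<Rightarrow> 'p \<times> 's) \<Rightarrow> ('o \<times> 't) set \<Rightarrow> ('p \<times> 's) set" where
  "coend_map C T C' T' m = restrict (\<lambda>K. coend_eq C' T' `` (m ` K)) (coend C T)"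

section \<open>The Kleisli extension of presheaves\<close>

definition kan_bif :: "('o, 'a, ('p, 'b, 'y) presheaf, ('p, 'b, 'y) ptrans) fctr
    \<Rightarrow> ('o, 'a, 'x) presheaf \<Rightarrow> 'p \<Rightarrow> ('o, 'a, 'x \<times> 'y) bif" where
  "kan_bif F Z d =
    \<lparr>BO = (\<lambda>c' c. At Z c' \<times> At (FO F c) d),
     BA = (\<lambda>f g (z, y). (Act Z f z, NAt (FA F g) d y))\<rparr>"

definition kan_ob :: "('o, 'a) cat \<Rightarrow> ('p, 'b) cat
    \<Rightarrow> ('o, 'a, ('p, 'b, 'y) presheaf, ('p, 'b, 'y) ptrans) fctr
    \<Rightarrow> ('o, 'a, 'x) presheaf \<Rightarrow> ('p, 'b, ('o \<times> 'x \<times> 'y) set) presheaf" where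
  "kan_ob C D F Z =
    \<lparr>At = (\<lambda>d. if d \<in> Obj D then coend C (kan_bif F Z d) else {}),
     Act = (\<lambda>g. if g \<in> Arr D
                then coend_map C (kan_bif F Z (Cod D g)) C (kan_bif F Z (Dom D g))
                       (\<lambda>(c, z, y). (c, z, Act (FO F c) g y))
                else (\<lambda>_. undefined))\<rparr>"

definition kan :: "('o, 'a) cat \<Rightarrow> ('p, 'b) cat
    \<Rightarrow> ('o, 'a, ('p, 'b, 'y) presheaf, ('p, 'b, 'y) ptrans) fctr
    \<Rightarrow> (('o, 'a, 'x) presheaf, ('o, 'a, 'x) ptrans,
        ('p, 'b, ('o \<times> 'x \<times> 'y) set) presheaf, ('p, 'b, ('o \<times> 'x \<times> 'y) set) ptrans) fctr" where
  "kan C D F =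
    \<lparr>FO = kan_ob C D F,
     FA = (\<lambda>\<alpha>. \<lparr>NDom = kan_ob C D F (NDom \<alpha>), NCod = kan_ob C D F (NCod \<alpha>),
                NAt = (\<lambda>d. if d \<in> Obj D
                           then coend_map C (kan_bif F (NDom \<alpha>) d) C (kan_bif F (NCod \<alpha>) d)
                                  (\<lambda>(c, z, y). (c, NAt \<alpha> c z, y))
                           else (\<lambda>_. undefined))\<rparr>)\<rparr>"

definition psh_map :: "('o, 'a) cat \<Rightarrow> ('p, 'b) cat \<Rightarrow> ('o, 'a, 'p, 'b) fctr
    \<Rightarrow> (('o, 'a, 'x) presheaf, ('o, 'a, 'x) ptrans,
        ('p, 'b, ('o \<times> 'x \<times> 'b) set) presheaf, ('p, 'b, ('o \<times> 'x \<times> 'b) set) ptrans) fctr" where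
  "psh_map C D F = kan C D (yoneda D \<odot> F)"

section \<open>The transformation \<open>\<lambda>\<close>\<close>

definition lam_bif :: "combinator set \<Rightarrow> ('o, 'a) cat \<Rightarrow> ('o, 'a, 'x) presheaf list \<Rightarrow> 'o list
    \<Rightarrow> ('o list, 'a list, 'x list \<times> ('o, 'a) barr) bif" where
  "lam_bif X C Fs Cs =
    \<lparr>BO = (\<lambda>Ds' Ds. {xs. length xs = length Fs \<and> (\<forall>i < length Fs. xs ! i \<in> At (Fs ! i) (Ds' ! i))}
                   \<times> Hom (bang X C) Cs Ds),
     BA = (\<lambda>fs gs (xs, u). (map (\<lambda>i. Act (Fs ! i) (fs ! i) (xs ! i)) [0..<length Fs],
                            par C gs \<cdot>\<^bsub>bang X C\<^esub> u))\<rparr>"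

definition lam_ob :: "combinator set \<Rightarrow> ('o, 'a) cat \<Rightarrow> ('o, 'a, 'x) presheaf list
    \<Rightarrow> ('o list, ('o, 'a) barr, ('o list \<times> 'x list \<times> ('o, 'a) barr) set) presheaf" where
  "lam_ob X C Fs =
    \<lparr>At = (\<lambda>Cs. if Cs \<in> Obj (bang X C) then coend (pow C (length Fs)) (lam_bif X C Fs Cs) else {}),
     Act = (\<lambda>h. if h \<in> Arr (bang X C)
                then coend_map (pow C (length Fs)) (lam_bif X C Fs (Tgt h))
                               (pow C (length Fs)) (lam_bif X C Fs (Src h))
                       (\<lambda>(Ds, xs, u). (Ds, xs, u \<cdot>\<^bsub>bang X C\<^esub> h))
                else (\<lambda>_. undefined))\<rparr>"

definition lam :: "combinator set \<Rightarrow> ('o, 'a) cat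
    \<Rightarrow> (('o, 'a, 'x) presheaf list, (('o, 'a, 'x) presheaf, ('o, 'a, 'x) ptrans) barr,
        ('o list, ('o, 'a) barr, ('o list \<times> 'x list \<times> ('o, 'a) barr) set) presheaf,
        ('o list, ('o, 'a) barr, ('o list \<times> 'x list \<times> ('o, 'a) barr) set) ptrans) fctr" where
  "lam X C =
    \<lparr>FO = lam_ob X C,
     FA = (\<lambda>h. \<lparr>NDom = lam_ob X C (Src h), NCod = lam_ob X C (Tgt h),
                NAt = (\<lambda>Cs. if Cs \<in> Obj (bang X C)
                            then coend_map (pow C (length (Src h))) (lam_bif X C (Src h) Cs)
                                           (pow C (length (Tgt h))) (lam_bif X C (Tgt h) Cs)
                                   (\<lambda>(Ds, xs, u).
                                     (map ((!) Ds) (Wir h),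
                                      map (\<lambda>j. NAt (Lab h ! j) (Ds ! (Wir h ! j)) (xs ! (Wir h ! j)))
                                          [0..<length (Wir h)],
                                      rewire C (Wir h) Ds \<cdot>\<^bsub>bang X C\<^esub> u))
                            else (\<lambda>_. undefined))\<rparr>)\<rparr>"

section \<open>Canonical isomorphisms\<close>

text \<open>A natural isomorphism between two functors \<open>K \<rightarrow> Psh(C)\<close>, where the value types of the
  presheaves may differ: bijections \<open>\<phi> k c\<close>, natural both in \<open>c\<close> and in \<open>k\<close>.\<close>

locale psh_iso = P: is_functor K "psh C" P + Q: is_functor K "psh C" Q
  for K :: "('k, 'l) cat" and C :: "('o, 'a) cat"
    and P :: "('k, 'l, ('o, 'a, 'x) presheaf, ('o, 'a, 'x) ptrans) fctr"
    and Q :: "('k, 'l, ('o, 'a, 'y) presheaf, ('o, 'a, 'y) ptrans) fctr"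
    and \<phi> :: "'k \<Rightarrow> 'o \<Rightarrow> 'x \<Rightarrow> 'y" +
  assumes bij: "\<lbrakk>k \<in> Obj K; c \<in> Obj C\<rbrakk> \<Longrightarrow> bij_betw (\<phi> k c) (At (FO P k) c) (At (FO Q k) c)"
    and natural_Act: "\<lbrakk>k \<in> Obj K; f \<in> Hom C c d; x \<in> At (FO P k) d\<rbrakk>
      \<Longrightarrow> \<phi> k c (Act (FO P k) f x) = Act (FO Q k) f (\<phi> k d x)"
    and natural_NAt: "\<lbrakk>h \<in> Hom K k k'; c \<in> Obj C; x \<in> At (FO P k) c\<rbrakk>
      \<Longrightarrow> \<phi> k' c (NAt (FA P h) c x) = NAt (FA Q h) c (\<phi> k c x)"

text \<open>The following predicates say that \<open>\<phi>\<close> is the comparison map obtained from the universal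
  property of coends (Fubini and the co-Yoneda lemma), by giving its value on the class of each
  representative; identities of \<open>C\<close> and \<open>!C\<close> are inserted where the co-Yoneda lemma
  introduces a new coend.\<close>

text \<open>\<open>\<lambda>\<^sub>D \<circ> !(Psh H) \<cong> Psh(!H) \<circ> \<lambda>\<^sub>C\<close>, for a functor \<open>H : C \<rightarrow> D\<close>:
  \<open>[Es, [C\<^sub>i, z\<^sub>i, f\<^sub>i]\<^sub>i, u] \<mapsto> [Cs, [Cs, zs, id], (f\<^sub>0, \<dots>) \<circ> u]\<close>.\<close>

definition canonical_naturality where
  "canonical_naturality X C D H \<phi> \<longleftrightarrow>
    (\<forall>Zs Ds Es Cs zs fs u.
      Zs \<in> lists (Obj (psh C)) \<and> Ds \<in> lists (Obj D) \<and> Es \<in> lists (Obj D) \<and> Cs \<in> lists (Obj C) \<and>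
      length Es = length Zs \<and> length Cs = length Zs \<and> length zs = length Zs \<and> length fs = length Zs \<and>
      (\<forall>i < length Zs. zs ! i \<in> At (Zs ! i) (Cs ! i) \<and> fs ! i \<in> Hom D (Es ! i) (FO H (Cs ! i))) \<and>
      u \<in> Hom (bang X D) Ds Es
      \<longrightarrow> \<phi> Zs Ds
            (cls (pow D (length Zs)) (lam_bif X D (map (FO (psh_map C D H)) Zs) Ds)
              (Es, map (\<lambda>i. cls C (kan_bif (yoneda D \<odot> H) (Zs ! i) (Es ! i)) (Cs ! i, zs ! i, fs ! i))
                       [0..<length Zs], u)) =
          cls (bang X C) (kan_bif (yoneda (bang X D) \<odot> bang_map H) (lam_ob X C Zs) Ds)
            (Cs,
             cls (pow C (length Zs)) (lam_bif X C Zs Cs) (Cs, zs, Ide (bang X C) Cs),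
             par D fs \<cdot>\<^bsub>bang X D\<^esub> u))"

text \<open>\<open>\<lambda>\<^sub>C \<circ> \<eta>\<^sub>! \<cong> Psh(\<eta>\<^sub>!)\<close>: \<open>[(D), (x), u] \<mapsto> [D, x, u]\<close>.\<close>

definition canonical_unit_bang where
  "canonical_unit_bang X C \<phi> \<longleftrightarrow>
    (\<forall>F Cs D x u.
      F \<in> Obj (psh C) \<and> Cs \<in> lists (Obj C) \<and> D \<in> Obj C \<and> x \<in> At F D \<and> u \<in> Hom (bang X C) Cs [D]
      \<longrightarrow> \<phi> F Cs (cls (pow C 1) (lam_bif X C [F] Cs) ([D], [x], u)) =
          cls C (kan_bif (yoneda (bang X C) \<odot> eta_bang C) F Cs) (D, x, u))"

text \<open>\<open>\<lambda>\<^sub>C \<circ> \<mu>\<^sub>! \<cong> Psh(\<mu>\<^sub>!) \<circ> \<lambda>\<^sub>!\<^sub>C \<circ> !(\<lambda>\<^sub>C)\<close>: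
  \<open>[concat Dss, concat xss, u] \<mapsto> [Dss, [Dss, [Ds\<^sub>i, xs\<^sub>i, id]\<^sub>i, id], u]\<close>.\<close>

definition canonical_mult_bang where
  "canonical_mult_bang X C \<phi> \<longleftrightarrow>
    (\<forall>Fss Cs Dss xss u.
      Fss \<in> lists (lists (Obj (psh C))) \<and> Cs \<in> lists (Obj C) \<and> Dss \<in> lists (lists (Obj C)) \<and>
      length Dss = length Fss \<and> length xss = length Fss \<and>
      (\<forall>i < length Fss. length (Dss ! i) = length (Fss ! i) \<and> length (xss ! i) = length (Fss ! i) \<and>
         (\<forall>j < length (Fss ! i). xss ! i ! j \<in> At (Fss ! i ! j) (Dss ! i ! j))) \<and>
      u \<in> Hom (bang X C) Cs (concat Dss)
      \<longrightarrow> \<phi> Fss Cs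
            (cls (pow C (length (concat Fss))) (lam_bif X C (concat Fss) Cs)
              (concat Dss, concat xss, u)) =
          cls (bang X (bang X C))
            (kan_bif (yoneda (bang X C) \<odot> mu_bang) (lam_ob X (bang X C) (map (lam_ob X C) Fss)) Cs)
            (Dss,
             cls (pow (bang X C) (length Fss))
               (lam_bif X (bang X C) (map (lam_ob X C) Fss) Dss)
               (Dss,
                map (\<lambda>i. cls (pow C (length (Fss ! i))) (lam_bif X C (Fss ! i) (Dss ! i))
                           (Dss ! i, xss ! i, Ide (bang X C) (Dss ! i)))
                    [0..<length Fss],
                Ide (bang X (bang X C)) Dss),
             u))"

text \<open>\<open>\<lambda>\<^sub>C \<circ> !(\<eta>\<^sub>P\<^sub>s\<^sub>h) \<cong> \<eta>\<^sub>P\<^sub>s\<^sub>h\<close>: \<open>[Ds, fs, u] \<mapsto> (f\<^sub>0, \<dots>) \<circ> u\<close>.\<close>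

definition canonical_unit_psh where
  "canonical_unit_psh X C \<phi> \<longleftrightarrow>
    (\<forall>Es Cs Ds fs u.
      Es \<in> lists (Obj C) \<and> Cs \<in> lists (Obj C) \<and> Ds \<in> lists (Obj C) \<and>
      length Ds = length Es \<and> length fs = length Es \<and>
      (\<forall>i < length Es. fs ! i \<in> Hom C (Ds ! i) (Es ! i)) \<and> u \<in> Hom (bang X C) Cs Ds
      \<longrightarrow> \<phi> Es Cs
            (cls (pow C (length Es)) (lam_bif X C (map (FO (yoneda C)) Es) Cs) (Ds, fs, u)) =
          par C fs \<cdot>\<^bsub>bang X C\<^esub> u)"

text \<open>\<open>\<lambda>\<^sub>B \<circ> !(g\<^sup>#) \<cong> (\<lambda>\<^sub>B \<circ> !g)\<^sup># \<circ> \<lambda>\<^sub>A\<close>, for a functor \<open>g : A \<rightarrow> Psh(B)\<close>: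
  \<open>[Ds, [A\<^sub>i, z\<^sub>i, y\<^sub>i]\<^sub>i, u] \<mapsto> [As, [As, zs, id], [Ds, ys, u]]\<close>.\<close>

definition canonical_ext_psh where
  "canonical_ext_psh X A B g \<phi> \<longleftrightarrow>
    (\<forall>Zs Bs Ds As zs ys u.
      Zs \<in> lists (Obj (psh A)) \<and> Bs \<in> lists (Obj B) \<and> Ds \<in> lists (Obj B) \<and> As \<in> lists (Obj A) \<and>
      length Ds = length Zs \<and> length As = length Zs \<and> length zs = length Zs \<and> length ys = length Zs \<and>
      (\<forall>i < length Zs. zs ! i \<in> At (Zs ! i) (As ! i) \<and> ys ! i \<in> At (FO g (As ! i)) (Ds ! i)) \<and>
      u \<in> Hom (bang X B) Bs Ds
      \<longrightarrow> \<phi> Zs Bs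
            (cls (pow B (length Zs)) (lam_bif X B (map (FO (kan A B g)) Zs) Bs)
              (Ds, map (\<lambda>i. cls A (kan_bif g (Zs ! i) (Ds ! i)) (As ! i, zs ! i, ys ! i))
                       [0..<length Zs], u)) =
          cls (bang X A) (kan_bif (lam X B \<odot> bang_map g) (lam_ob X A Zs) Bs)
            (As,
             cls (pow A (length Zs)) (lam_bif X A Zs As) (As, zs, Ide (bang X A) As),
             cls (pow B (length Zs)) (lam_bif X B (map (FO g) As) Bs) (Ds, ys, u)))"

end

theory Submission
  imports Defs
begin

text \<open>Every clause of the theorem except the first two compares two functors, at least one of which takes
(iterated) coends of sets as values, and prescribes the comparison map on representatives.  Write \<open>[D, x, u]\<close> for the
class of a representative.  The mathematical content is the following.

Coends are quotients by the relation generated by sliding a morphism from one side to the other, so a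
function on representatives descends to the coend as soon as it is constant along one such slide
(\<open>cowedge_eq\<close>); for a tuple of coends it suffices to slide in all coordinates at once
(\<open>tlift_cls\<close>).  For each isomorphism there is a set of generators from which both sides are
quotients, and the isomorphism exists as soon as two generators are identified on one side if and only
if they are identified on the other (\<open>psh_isoI_generators\<close>); the value on generators is then the
canonical one.

Two general constructions carry the proof.  Both \<open>kan\<close> and \<open>lam\<close> are pointwise coends whose
structure maps act on representatives, so one argument makes them functors (\<open>coend_functor\<close>).  The
co-Yoneda lemma simplifies a Kleisli extension precomposed with \<open>lam\<close>: for a functor \<open>F\<close> from
\<open>!A\<close> to presheaves, the coend over \<open>!A\<close> of \<open>\<lambda>(Zs)(As) \<times> F(As)\<close> is the coend over
\<open>A\<^sup>n\<close> of \<open>Z\<^sub>1A\<^sub>1 \<times> \<dots> \<times> Z\<^sub>nA\<^sub>n \<times> F(A\<^sub>1, \<dots>, A\<^sub>n)\<close>, because a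
morphism \<open>As' \<rightarrow> As\<close> of \<open>!A\<close> in a representative can be slid onto \<open>F\<close>
(\<open>kan_lam_cls_iff\<close>).

With these, the clauses are short on paper.  For the unit of \<open>Psh\<close>, sliding all labels of
\<open>[Ds, fs, u]\<close> onto \<open>u\<close> gives \<open>[Es, id, (f\<^sub>1, \<dots>, f\<^sub>n) \<circ> u]\<close>, a normal form (\<open>unit_psh\<close>).  The unit of
\<open>!\<close> is the identification of \<open>C\<^sup>1\<close> with \<open>C\<close> (\<open>unit_bang\<close>).  The clause for the Kleisli
extension becomes, after the co-Yoneda reduction, the interchange of the coends over \<open>A\<^sup>n\<close> and \<open>B\<^sup>n\<close>
(\<open>ext_psh\<close>).  The clause for the multiplication becomes a second co-Yoneda reduction, which slides
the morphisms of \<open>!C\<close> hidden in the classes of the inner \<open>\<lambda>\<close> through the functor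
\<open>(!C)\<^sup>n \<rightarrow> !C\<close> given by concatenation (\<open>mult_bang\<close>).  Naturality follows from the clause for the
Kleisli extension applied to the composite of \<open>H\<close> with the Yoneda embedding, followed by the unit
clause for \<open>Psh\<close> inside the extension (\<open>naturality\<close>).

The choice of \<open>X\<close> matters only through three closure properties of the allowed wirings: identities,
composites, and blockwise substitution (\<open>wiring_upt\<close>, \<open>wiring_comp\<close>, \<open>wiring_blocks\<close>).\<close>

section \<open>Coends of sets\<close>

text \<open>A map out of the coend of \<open>T\<close>, described on representatives.  Only the slides that generate
the coend constrain it; elsewhere \<open>h\<close> is arbitrary.\<close>

definition cowedge :: "('o, 'a) cat \<Rightarrow> ('o, 'a, 't) bif \<Rightarrow> ('o \<times> 't \<Rightarrow> 'r) \<Rightarrow> bool" where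
  "cowedge C T h \<longleftrightarrow>
    (\<forall>f c c' t. f \<in> Hom C c c' \<and> t \<in> BO T c' c \<longrightarrow>
       h (c, BA T f (Ide C c) t) = h (c', BA T (Ide C c') f t))"

definition gens :: "('o, 'a) cat \<Rightarrow> ('o, 'a, 't) bif \<Rightarrow> ('o \<times> 't) set" where
  "gens C T = (SIGMA c : Obj C. BO T c c)"

definition clift :: "('o, 'a) cat \<Rightarrow> ('o, 'a, 't) bif \<Rightarrow> ('o \<times> 't \<Rightarrow> 'r) \<Rightarrow> ('o \<times> 't) set \<Rightarrow> 'r" where
  "clift C T h K = h (SOME p. p \<in> gens C T \<and> K = cls C T p)"

lemma equiv_coend_eq: "equiv UNIV (coend_eq C T)"
proof -
  have "sym (coend_step C T \<union> (coend_step C T)\<inverse>)"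
    by (auto simp: sym_def)
  then show ?thesis
    unfolding coend_eq_def by (intro equivI) (auto intro: sym_rtrancl trans_rtrancl refl_rtrancl)
qed

lemma cls_eq_iff: "cls C T p = cls C T q \<longleftrightarrow> (p, q) \<in> coend_eq C T"
  unfolding cls_def using eq_equiv_class_iff[OF equiv_coend_eq] by blast

lemma coend_eq_cls: "coend C T = cls C T ` gens C T"
  by (auto simp: coend_def gens_def quotient_def cls_def)

lemma cls_in_coend: "p \<in> gens C T \<Longrightarrow> cls C T p \<in> coend C T"
  by (simp add: coend_eq_cls)

lemma coendE:
  assumes "K \<in> coend C T" obtains p where "p \<in> gens C T" "K = cls C T p"
  using assms by (auto simp: coend_eq_cls)

lemma cowedge_cls: "cowedge C T (cls C T)"
  unfolding cowedge_def cls_eq_iff coend_eq_def coend_step_def by blast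

text \<open>Every use of an equality between classes goes through this lemma: \<open>h\<close> is an invariant along a
path of slides that joins the two representatives.\<close>

lemma cowedge_eq:
  assumes "cowedge C T h" and "cls C T p = cls C T q"
  shows "h p = h q"
proof -
  have "(p, q) \<in> (coend_step C T \<union> (coend_step C T)\<inverse>)\<^sup>*"
    using assms(2) by (simp add: cls_eq_iff coend_eq_def)
  then show ?thesis
  proof (induction rule: rtrancl_induct)
    case (step y z)
    then have "h y = h z"
      using assms(1) by (auto simp: cowedge_def coend_step_def)
    with step show ?case by simp
  qed simp
qed

lemma clift_cls:
  assumes "cowedge C T h" and "p \<in> gens C T"
  shows "clift C T h (cls C T p) = h p"
proof -
  have "\<exists>q. q \<in> gens C T \<and> cls C T p = cls C T q" using assms(2) by blast
  then have "cls C T p = cls C T (SOME q. q \<in> gens C T \<and> cls C T p = cls C T q)"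
    by (rule someI2_ex) blast
  then show ?thesis
    unfolding clift_def using cowedge_eq[OF assms(1)] by metis
qed

text \<open>The image of a class under \<open>m\<close> is in general only part of a class; saturating it gives the
class of \<open>m p\<close> because \<open>m\<close> cannot leave that class along a slide.\<close>

lemma coend_map_cls:
  assumes "cowedge C T (\<lambda>p. cls C' T' (m p))" and "p \<in> gens C T"
  shows "coend_map C T C' T' m (cls C T p) = cls C' T' (m p)"
proof -
  have "coend_eq C' T' `` (m ` cls C T p) = cls C' T' (m p)" (is "?L = ?R")
  proof
    show "?L \<subseteq> ?R"
    proof
      fix z assume "z \<in> ?L"
      then obtain q where "(p, q) \<in> coend_eq C T" "(m q, z) \<in> coend_eq C' T'"
        by (auto simp: cls_def)
      then show "z \<in> ?R"
        using cowedge_eq[OF assms(1)] by (metis cls_eq_iff cls_def Image_singleton_iff)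
    qed
    have "p \<in> cls C T p" by (simp add: cls_def coend_eq_def)
    then show "?R \<subseteq> ?L" unfolding cls_def by blast
  qed
  then show ?thesis using assms(2) by (simp add: coend_map_def cls_in_coend)
qed

text \<open>Steps in all coordinates at once include, with trivial steps elsewhere, steps in a single coordinate;
so invariance under the former gives invariance along a path in each coordinate.\<close>

lemma rtrancl_coordinatewise:
  fixes h :: "'p list \<Rightarrow> 'r"
  assumes inv: "\<And>ps qs. \<lbrakk>length ps = n; length qs = n;
      \<And>i. i < n \<Longrightarrow> (ps ! i, qs ! i) \<in> S i\<rbrakk> \<Longrightarrow> h ps = h qs"
    and refl: "\<And>i p. i < n \<Longrightarrow> p \<in> P i \<Longrightarrow> (p, p) \<in> S i"
    and ps: "length ps = n" "\<And>i. i < n \<Longrightarrow> ps ! i \<in> P i"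
    and qs: "length qs = n" "\<And>i. i < n \<Longrightarrow> qs ! i \<in> P i"
    and eq: "\<And>i. i < n \<Longrightarrow> (ps ! i, qs ! i) \<in> (S i \<union> (S i)\<inverse>)\<^sup>*"
  shows "h ps = h qs"
proof -
  have one: "h rs = h (rs[k := q])"
    if "k < n" "length rs = n" "\<And>i. i < n \<Longrightarrow> rs ! i \<in> P i"
      "(rs ! k, q) \<in> (S k \<union> (S k)\<inverse>)\<^sup>*" for rs k q
    using that(4)
  proof (induction rule: rtrancl_induct)
    case base
    then show ?case by simp
  next
    case (step y z)
    from step(2) consider "(y, z) \<in> S k" | "(z, y) \<in> S k" by auto
    then have "h (rs[k := y]) = h (rs[k := z])"
    proof cases
      case 1
      show ?thesis
        by (rule inv) (use that(1-3) 1 refl in \<open>auto simp: nth_list_update\<close>)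
    next
      case 2
      have "h (rs[k := z]) = h (rs[k := y])"
        by (rule inv) (use that(1-3) 2 refl in \<open>auto simp: nth_list_update\<close>)
      then show ?thesis by simp
    qed
    with step show ?case by simp
  qed
  have "h ps = h (take k qs @ drop k ps)" if "k \<le> n" for k
    using that
  proof (induction k)
    case (Suc k)
    let ?rs = "take k qs @ drop k ps"
    have nth: "?rs ! i = (if i < k then qs ! i else ps ! i)" if "i < n" for i
      using that Suc.prems ps(1) qs(1) by (auto simp: nth_append)
    have "h ?rs = h (?rs[k := qs ! k])"
    proof (rule one)
      show "?rs ! i \<in> P i" if "i < n" for i
        using nth[OF that] ps(2) qs(2) that by simp
      show "(?rs ! k, qs ! k) \<in> (S k \<union> (S k)\<inverse>)\<^sup>*"
        using nth[of k] eq[of k] Suc.prems by simp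
    qed (use Suc.prems ps(1) qs(1) in auto)
    also have "?rs[k := qs ! k] = take (Suc k) qs @ drop (Suc k) ps"
      by (rule nth_equalityI)
        (use Suc.prems ps(1) qs(1) in \<open>auto simp: nth_append nth_list_update less_Suc_eq min_def\<close>)
    finally show ?case using Suc by simp
  qed simp
  from this[of n] show ?thesis using ps(1) qs(1) by simp
qed

definition tlift :: "(nat \<Rightarrow> ('o, 'a) cat) \<Rightarrow> (nat \<Rightarrow> ('o, 'a, 't) bif) \<Rightarrow> (('o \<times> 't) list \<Rightarrow> 'r)
    \<Rightarrow> ('o \<times> 't) set list \<Rightarrow> 'r" where
  "tlift C T h Ks =
    h (map (\<lambda>i. SOME p. p \<in> gens (C i) (T i) \<and> Ks ! i = cls (C i) (T i) p) [0..<length Ks])"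

text \<open>The form in which functions of several coends are shown to be well defined: the test is a single
slide \<open>fs ! i\<close> in every coordinate, which keeps it a statement about lists of morphisms.\<close>

lemma tlift_cls:
  fixes h :: "('o \<times> 't) list \<Rightarrow> 'r"
  assumes inv: "\<And>fs cs cs' ts.
      \<lbrakk>length fs = n; length cs = n; length cs' = n; length ts = n;
       \<And>i. i < n \<Longrightarrow> fs ! i \<in> Hom (C i) (cs ! i) (cs' ! i);
       \<And>i. i < n \<Longrightarrow> ts ! i \<in> BO (T i) (cs' ! i) (cs ! i)\<rbrakk> \<Longrightarrow>
       h (map (\<lambda>i. (cs ! i, BA (T i) (fs ! i) (Ide (C i) (cs ! i)) (ts ! i))) [0..<n]) =
       h (map (\<lambda>i. (cs' ! i, BA (T i) (Ide (C i) (cs' ! i)) (fs ! i) (ts ! i))) [0..<n])"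
    and Ide_in: "\<And>i c. \<lbrakk>i < n; c \<in> Obj (C i)\<rbrakk> \<Longrightarrow> Ide (C i) c \<in> Hom (C i) c c"
    and BA_Ide: "\<And>i c t. \<lbrakk>i < n; c \<in> Obj (C i); t \<in> BO (T i) c c\<rbrakk> \<Longrightarrow>
       BA (T i) (Ide (C i) c) (Ide (C i) c) t = t"
    and ps: "length ps = n" "\<And>i. i < n \<Longrightarrow> ps ! i \<in> gens (C i) (T i)"
  shows "tlift C T h (map (\<lambda>i. cls (C i) (T i) (ps ! i)) [0..<n]) = h ps"
proof -
  let ?q = "\<lambda>i. SOME p. p \<in> gens (C i) (T i) \<and> cls (C i) (T i) (ps ! i) = cls (C i) (T i) p"
  have q: "?q i \<in> gens (C i) (T i) \<and> cls (C i) (T i) (ps ! i) = cls (C i) (T i) (?q i)" if "i < n" for i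
    by (rule someI_ex) (use ps(2) that in blast)
  let ?qs = "map ?q [0..<n]"
  have "h ps = h ?qs"
  proof (rule rtrancl_coordinatewise[where n = n and S = "\<lambda>i. coend_step (C i) (T i)"
        and P = "\<lambda>i. gens (C i) (T i)"])
    fix ps qs :: "('o \<times> 't) list"
    assume len: "length ps = n" "length qs = n"
      and step: "\<And>i. i < n \<Longrightarrow> (ps ! i, qs ! i) \<in> coend_step (C i) (T i)"
    have "\<forall>i<n. \<exists>f c c' t. f \<in> Hom (C i) c c' \<and> t \<in> BO (T i) c' c \<and>
        ps ! i = (c, BA (T i) f (Ide (C i) c) t) \<and> qs ! i = (c', BA (T i) (Ide (C i) c') f t)"
      using step by (simp add: coend_step_def) blast
    then obtain f c c' t where *: "f i \<in> Hom (C i) (c i) (c' i)" "t i \<in> BO (T i) (c' i) (c i)"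
        "ps ! i = (c i, BA (T i) (f i) (Ide (C i) (c i)) (t i))"
        "qs ! i = (c' i, BA (T i) (Ide (C i) (c' i)) (f i) (t i))" if "i < n" for i
      by metis
    have "ps = map (\<lambda>i. (map c [0..<n] ! i, BA (T i) (map f [0..<n] ! i) (Ide (C i) (map c [0..<n] ! i)) (map t [0..<n] ! i))) [0..<n]"
      by (rule nth_equalityI) (use len * in auto)
    moreover have "qs = map (\<lambda>i. (map c' [0..<n] ! i, BA (T i) (Ide (C i) (map c' [0..<n] ! i)) (map f [0..<n] ! i) (map t [0..<n] ! i))) [0..<n]"
      by (rule nth_equalityI) (use len * in auto)
    moreover note inv[of "map f [0..<n]" "map c [0..<n]" "map c' [0..<n]" "map t [0..<n]"]
    ultimately show "h ps = h qs" using * by simp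
  next
    fix i p assume i: "i < n" and "p \<in> gens (C i) (T i)"
    then obtain c t where p: "p = (c, t)" "c \<in> Obj (C i)" "t \<in> BO (T i) c c"
      by (auto simp: gens_def)
    then show "(p, p) \<in> coend_step (C i) (T i)"
      using Ide_in[OF i p(2)] BA_Ide[OF i p(2,3)] unfolding coend_step_def by force
  next
    show "(ps ! i, ?qs ! i) \<in> (coend_step (C i) (T i) \<union> (coend_step (C i) (T i))\<inverse>)\<^sup>*" if "i < n" for i
      using q[OF that] that by (simp add: cls_eq_iff coend_eq_def)
  qed (use ps q in auto)
  moreover have "tlift C T h (map (\<lambda>i. cls (C i) (T i) (ps ! i)) [0..<n]) = h ?qs"
    unfolding tlift_def by (rule arg_cong[of _ _ h], rule nth_equalityI) auto
  ultimately show ?thesis by simp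
qed

section \<open>Functors into presheaf categories\<close>

lemma Hom_Obj:
  assumes "category C" "f \<in> Hom C x y"
  shows "x \<in> Obj C" "y \<in> Obj C" "f \<in> Arr C"
  using assms category.Dom_in category.Cod_in by (fastforce simp: Hom_def)+

lemma is_functor_fcomp:
  assumes "is_functor C D F" and "is_functor D E G"
  shows "is_functor C E (G \<odot> F)"
proof -
  interpret F: is_functor C D F by (rule assms)
  interpret G: is_functor D E G by (rule assms)
  show ?thesis
    by unfold_locales
      (auto simp: fcomp_def F.FO_in G.FO_in F.FA_Ide G.FA_Ide
            intro: F.FA_in G.FA_in F.FA_Cmp[THEN arg_cong, of _ _ _ _ _ "FA G", THEN trans] G.FA_Cmp)
qed

lemma fcomp_sel [simp]: "FO (G \<odot> F) x = FO G (FO F x)" "FA (G \<odot> F) f = FA G (FA F f)"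
  by (simp_all add: fcomp_def)

lemma fcomp_assoc: "G \<odot> F \<odot> E = G \<odot> (F \<odot> E)"
  by (simp add: fcomp_def comp_assoc)

lemma presheaf_Act_in:
  assumes "is_presheaf C P" "f \<in> Hom C c d" "x \<in> At P d" shows "Act P f x \<in> At P c"
  using is_presheaf.Act_in[OF assms(1,2)] assms(3) by blast

lemma psh_sel [simp]:
  "Obj (psh C) = {P. is_presheaf C P}" "Arr (psh C) = {\<alpha>. is_ptrans C \<alpha>}"
  "Dom (psh C) = NDom" "Cod (psh C) = NCod"
  by (simp_all add: psh_def)

lemma Hom_psh_iff: "\<alpha> \<in> Hom (psh C) P Q \<longleftrightarrow> is_ptrans C \<alpha> \<and> NDom \<alpha> = P \<and> NCod \<alpha> = Q"
  by (simp add: Hom_def)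

text \<open>Components are extensional on the fibres and fixed outside \<open>Obj C\<close>, so they are determined by
their values on elements.\<close>

lemma ptrans_eqI:
  assumes "is_ptrans C \<alpha>" "is_ptrans C \<beta>" "NDom \<alpha> = NDom \<beta>" "NCod \<alpha> = NCod \<beta>"
    and "\<And>c x. \<lbrakk>c \<in> Obj C; x \<in> At (NDom \<alpha>) c\<rbrakk> \<Longrightarrow> NAt \<alpha> c x = NAt \<beta> c x"
  shows "\<alpha> = \<beta>"
proof -
  have "NAt \<alpha> c = NAt \<beta> c" for c
  proof (cases "c \<in> Obj C")
    case True
    then have "NAt \<alpha> c \<in> extensional (At (NDom \<alpha>) c)" "NAt \<beta> c \<in> extensional (At (NDom \<alpha>) c)"
      using is_ptrans.NAt_in[OF assms(1)] is_ptrans.NAt_in[OF assms(2)] assms(3)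
      by (auto simp: PiE_iff)
    then show ?thesis using assms(5)[OF True] by (rule extensionalityI)
  next
    case False
    then show ?thesis
      using is_ptrans.NAt_outside[OF assms(1)] is_ptrans.NAt_outside[OF assms(2)] by simp
  qed
  then show ?thesis using assms(3,4) by (intro ptrans.equality) auto
qed

lemma ptrans_NAt_in:
  assumes "is_ptrans C \<alpha>" "c \<in> Obj C" "x \<in> At (NDom \<alpha>) c" shows "NAt \<alpha> c x \<in> At (NCod \<alpha>) c"
  using is_ptrans.NAt_in[OF assms(1,2)] assms(3) by blast

lemma NAt_Ide_psh: "c \<in> Obj C \<Longrightarrow> x \<in> At P c \<Longrightarrow> NAt (Ide (psh C) P) c x = x"
  by (simp add: psh_def)

lemma NAt_Cmp_psh:
  "c \<in> Obj C \<Longrightarrow> x \<in> At (NDom \<alpha>) c \<Longrightarrow> NAt (\<beta> \<cdot>\<^bsub>psh C\<^esub> \<alpha>) c x = NAt \<beta> c (NAt \<alpha> c x)"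
  by (simp add: psh_def)

lemma category_psh:
  fixes C :: "('o, 'a) cat"
  assumes C: "category C"
  shows "category (psh C :: (('o, 'a, 'x) presheaf, _) cat)"
proof -
  interpret category C by (rule C)
  let ?P = "psh C :: (('o, 'a, 'x) presheaf, _) cat"
  have sel: "NDom (Ide ?P P) = P" "NCod (Ide ?P P) = P" "NDom (\<beta> \<cdot>\<^bsub>?P\<^esub> \<alpha>) = NDom \<alpha>"
    "NCod (\<beta> \<cdot>\<^bsub>?P\<^esub> \<alpha>) = NCod \<beta>" for P \<alpha> \<beta>
    by (simp_all add: psh_def)
  have Ide: "is_ptrans C (Ide ?P P)" if "is_presheaf C P" for P
  proof -
    interpret P: is_presheaf C P by (rule that)
    show ?thesis
    proof (unfold_locales, unfold sel)
      show "NAt (Ide ?P P) c (Act P f x) = Act P f (NAt (Ide ?P P) d x)"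
        if "f \<in> Hom C c d" "x \<in> At P d" for f c d x
        using that Hom_Obj[OF C that(1)] presheaf_Act_in[OF P.is_presheaf_axioms that]
        by (simp add: NAt_Ide_psh)
    qed (use P.is_presheaf_axioms in \<open>auto simp: psh_def is_presheaf_def\<close>)
  qed
  have Cmp: "is_ptrans C (\<beta> \<cdot>\<^bsub>?P\<^esub> \<alpha>)" if "is_ptrans C \<alpha>" "is_ptrans C \<beta>" "NCod \<alpha> = NDom \<beta>" for \<alpha> \<beta>
  proof -
    interpret a: is_ptrans C \<alpha> by (rule that)
    interpret b: is_ptrans C \<beta> by (rule that)
    note in_a = ptrans_NAt_in[OF that(1)] and in_b = ptrans_NAt_in[OF that(2)]
    show ?thesis
    proof (intro is_ptrans.intro is_ptrans_axioms.intro, unfold sel)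
      show "NAt (\<beta> \<cdot>\<^bsub>?P\<^esub> \<alpha>) c \<in> At (NDom \<alpha>) c \<rightarrow>\<^sub>E At (NCod \<beta>) c" if "c \<in> Obj C" for c
        using that in_a in_b \<open>NCod \<alpha> = NDom \<beta>\<close> by (auto simp: psh_def)
      show "NAt (\<beta> \<cdot>\<^bsub>?P\<^esub> \<alpha>) c (Act (NDom \<alpha>) f x) = Act (NCod \<beta>) f (NAt (\<beta> \<cdot>\<^bsub>?P\<^esub> \<alpha>) d x)"
        if "f \<in> Hom C c d" "x \<in> At (NDom \<alpha>) d" for f c d x
        using that Hom_Obj[OF C that(1)] presheaf_Act_in[OF a.dom.is_presheaf_axioms that] in_a
          \<open>NCod \<alpha> = NDom \<beta>\<close> by (simp add: NAt_Cmp_psh a.natural b.natural)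
    qed (auto simp: psh_def a.dom.is_presheaf_axioms b.cod.is_presheaf_axioms)
  qed
  show ?thesis
  proof
    fix f assume "f \<in> Arr ?P"
    then show "Dom ?P f \<in> Obj ?P" "Cod ?P f \<in> Obj ?P"
      by (auto simp: is_ptrans_def)
  next
    fix P assume "P \<in> Obj ?P" then show "Ide ?P P \<in> Hom ?P P P"
      using Ide by (simp add: Hom_psh_iff sel)
  next
    fix f g P Q R assume "f \<in> Hom ?P P Q" "g \<in> Hom ?P Q R"
    then show "g \<cdot>\<^bsub>?P\<^esub> f \<in> Hom ?P P R"
      using Cmp by (simp add: Hom_psh_iff sel)
  next
    fix f P Q assume f: "f \<in> Hom ?P P Q"
    then interpret f: is_ptrans C f by (simp add: Hom_psh_iff)
    note PQ = f.dom.is_presheaf_axioms f.cod.is_presheaf_axioms f[unfolded Hom_psh_iff]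
    show "f \<cdot>\<^bsub>?P\<^esub> Ide ?P P = f" "Ide ?P Q \<cdot>\<^bsub>?P\<^esub> f = f"
      by (rule ptrans_eqI[of C]; use PQ Cmp Ide in \<open>auto simp: sel NAt_Cmp_psh NAt_Ide_psh ptrans_NAt_in\<close>)+
  next
    fix f g h P Q R S assume fgh: "f \<in> Hom ?P P Q" "g \<in> Hom ?P Q R" "h \<in> Hom ?P R S"
    show "h \<cdot>\<^bsub>?P\<^esub> g \<cdot>\<^bsub>?P\<^esub> f = h \<cdot>\<^bsub>?P\<^esub> (g \<cdot>\<^bsub>?P\<^esub> f)"
      by (rule ptrans_eqI[of C]; use fgh Cmp in \<open>auto simp: Hom_psh_iff sel NAt_Cmp_psh ptrans_NAt_in\<close>)
  qed
qed

text \<open>All later arguments compute with elements of presheaves; this lemma and the next translate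
between functors into \<open>psh C\<close> and their elements.\<close>

lemma psh_functor:
  assumes "is_functor K (psh C) P"
  shows "k \<in> Obj K \<Longrightarrow> is_presheaf C (FO P k)"
    and "h \<in> Hom K k k' \<Longrightarrow> c \<in> Obj C \<Longrightarrow> x \<in> At (FO P k) c \<Longrightarrow> NAt (FA P h) c x \<in> At (FO P k') c"
    and "k \<in> Obj K \<Longrightarrow> c \<in> Obj C \<Longrightarrow> x \<in> At (FO P k) c \<Longrightarrow> NAt (FA P (Ide K k)) c x = x"
    and "h \<in> Hom K k k' \<Longrightarrow> h' \<in> Hom K k' k'' \<Longrightarrow> c \<in> Obj C \<Longrightarrow> x \<in> At (FO P k) c \<Longrightarrow>
      NAt (FA P (h' \<cdot>\<^bsub>K\<^esub> h)) c x = NAt (FA P h') c (NAt (FA P h) c x)"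
    and "h \<in> Hom K k k' \<Longrightarrow> f \<in> Hom C c d \<Longrightarrow> x \<in> At (FO P k) d \<Longrightarrow>
      NAt (FA P h) c (Act (FO P k) f x) = Act (FO P k') f (NAt (FA P h) d x)"
proof -
  interpret is_functor K "psh C" P by (rule assms)
  show "k \<in> Obj K \<Longrightarrow> is_presheaf C (FO P k)" using FO_in by simp
  have hom: "is_ptrans C (FA P h) \<and> NDom (FA P h) = FO P k \<and> NCod (FA P h) = FO P k'"
    if "h \<in> Hom K k k'" for h k k'
    using FA_in[OF that] by (simp add: Hom_psh_iff)
  show "h \<in> Hom K k k' \<Longrightarrow> c \<in> Obj C \<Longrightarrow> x \<in> At (FO P k) c \<Longrightarrow> NAt (FA P h) c x \<in> At (FO P k') c"
    using hom[of h k k'] ptrans_NAt_in[of C "FA P h" c x] by simp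
  show "k \<in> Obj K \<Longrightarrow> c \<in> Obj C \<Longrightarrow> x \<in> At (FO P k) c \<Longrightarrow> NAt (FA P (Ide K k)) c x = x"
    by (simp add: FA_Ide NAt_Ide_psh)
  show "h \<in> Hom K k k' \<Longrightarrow> h' \<in> Hom K k' k'' \<Longrightarrow> c \<in> Obj C \<Longrightarrow> x \<in> At (FO P k) c \<Longrightarrow>
      NAt (FA P (h' \<cdot>\<^bsub>K\<^esub> h)) c x = NAt (FA P h') c (NAt (FA P h) c x)"
    using hom by (subst FA_Cmp) (auto intro: NAt_Cmp_psh)
  show "h \<in> Hom K k k' \<Longrightarrow> f \<in> Hom C c d \<Longrightarrow> x \<in> At (FO P k) d \<Longrightarrow>
      NAt (FA P h) c (Act (FO P k) f x) = Act (FO P k') f (NAt (FA P h) d x)"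
    using hom[of h k k'] is_ptrans.natural[of C "FA P h" f c d x] by simp
qed

lemma psh_functorI:
  assumes K: "category K" and C: "category C"
    and ob: "\<And>k. k \<in> Obj K \<Longrightarrow> is_presheaf C (FO P k)"
    and sel: "\<And>h. h \<in> Arr K \<Longrightarrow> NDom (FA P h) = FO P (Dom K h)"
      "\<And>h. h \<in> Arr K \<Longrightarrow> NCod (FA P h) = FO P (Cod K h)"
    and ext: "\<And>h k k' c. \<lbrakk>h \<in> Hom K k k'; c \<in> Obj C\<rbrakk> \<Longrightarrow> NAt (FA P h) c \<in> At (FO P k) c \<rightarrow>\<^sub>E At (FO P k') c"
    and outside: "\<And>h c. h \<in> Arr K \<Longrightarrow> c \<notin> Obj C \<Longrightarrow> NAt (FA P h) c = (\<lambda>_. undefined)"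
    and nat: "\<And>h k k' f c d x. \<lbrakk>h \<in> Hom K k k'; f \<in> Hom C c d; x \<in> At (FO P k) d\<rbrakk> \<Longrightarrow>
      NAt (FA P h) c (Act (FO P k) f x) = Act (FO P k') f (NAt (FA P h) d x)"
    and ide: "\<And>k c x. \<lbrakk>k \<in> Obj K; c \<in> Obj C; x \<in> At (FO P k) c\<rbrakk> \<Longrightarrow> NAt (FA P (Ide K k)) c x = x"
    and cmp: "\<And>h h' k k' k'' c x. \<lbrakk>h \<in> Hom K k k'; h' \<in> Hom K k' k''; c \<in> Obj C; x \<in> At (FO P k) c\<rbrakk> \<Longrightarrow>
      NAt (FA P (h' \<cdot>\<^bsub>K\<^esub> h)) c x = NAt (FA P h') c (NAt (FA P h) c x)"
  shows "is_functor K (psh C) P"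
proof -
  interpret K: category K by (rule K)
  interpret psh: category "psh C" by (rule category_psh[OF C])
  have FA: "is_ptrans C (FA P h) \<and> NDom (FA P h) = FO P k \<and> NCod (FA P h) = FO P k'"
    if h: "h \<in> Hom K k k'" for h k k'
  proof -
    have k: "k \<in> Obj K" "k' \<in> Obj K" "h \<in> Arr K" using Hom_Obj[OF K h] .
    have s: "NDom (FA P h) = FO P k" "NCod (FA P h) = FO P k'"
      using sel[OF k(3)] h by (auto simp: Hom_def)
    have "is_ptrans C (FA P h)"
      unfolding is_ptrans_def is_ptrans_axioms_def s
      using ob k ext[OF h] nat[OF h] outside[OF k(3)] by auto
    with s show ?thesis by simp
  qed
  have FA_in: "FA P h \<in> Hom (psh C) (FO P k) (FO P k')" if "h \<in> Hom K k k'" for h k k'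
    using FA[OF that] by (simp add: Hom_psh_iff)
  show ?thesis
  proof
    show "FO P k \<in> Obj (psh C)" if "k \<in> Obj K" for k using ob[OF that] by simp
    then show "FA P (Ide K k) = Ide (psh C) (FO P k)" if "k \<in> Obj K" for k
      using FA_in[OF K.Ide_in[OF that]] psh.Ide_in[of "FO P k"] that
      by (intro ptrans_eqI[of C]) (auto simp: Hom_psh_iff NAt_Ide_psh ide)
    show "FA P (g \<cdot>\<^bsub>K\<^esub> f) = FA P g \<cdot>\<^bsub>psh C\<^esub> FA P f" if "f \<in> Hom K x y" "g \<in> Hom K y z" for f g x y z
      using FA_in[OF K.Cmp_in[OF that]] psh.Cmp_in[OF FA_in FA_in, OF that] FA[OF that(1)]
      by (intro ptrans_eqI[of C]) (auto simp: Hom_psh_iff NAt_Cmp_psh cmp[OF that])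
  qed (rule FA_in)
qed

text \<open>Functors that send \<open>k\<close> to the presheaf \<open>d \<mapsto> coend (S k) (T k d)\<close>, where morphisms of \<open>D\<close> act on
representatives by \<open>m\<close> and morphisms of \<open>K\<close> by \<open>n\<close>.  The category \<open>S k\<close> of the integral
depends on \<open>k\<close> because \<open>\<lambda>\<close> of a list of presheaves integrates over a power of \<open>C\<close> whose exponent is
the length of the list.  The functoriality laws are asked of \<open>m\<close> and \<open>n\<close> strictly, on
representatives.\<close>

locale coend_functor = K: category K + D: category D
  for K :: "('k, 'l) cat" and D :: "('p, 'b) cat"
    and P :: "('k, 'l, ('p, 'b, ('o \<times> 't) set) presheaf, ('p, 'b, ('o \<times> 't) set) ptrans) fctr"
    and S :: "'k \<Rightarrow> ('o, 'a) cat" and T :: "'k \<Rightarrow> 'p \<Rightarrow> ('o, 'a, 't) bif"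
    and m :: "'k \<Rightarrow> 'b \<Rightarrow> 'o \<times> 't \<Rightarrow> 'o \<times> 't" and n :: "'l \<Rightarrow> 'o \<times> 't \<Rightarrow> 'o \<times> 't" +
  assumes FO: "\<And>k. FO P k = \<lparr>At = (\<lambda>d. if d \<in> Obj D then coend (S k) (T k d) else {}),
        Act = (\<lambda>g. if g \<in> Arr D
                   then coend_map (S k) (T k (Cod D g)) (S k) (T k (Dom D g)) (m k g)
                   else (\<lambda>_. undefined))\<rparr>"
    and FA: "\<And>h. FA P h = \<lparr>NDom = FO P (Dom K h), NCod = FO P (Cod K h),
        NAt = (\<lambda>d. if d \<in> Obj D
                   then coend_map (S (Dom K h)) (T (Dom K h) d) (S (Cod K h)) (T (Cod K h) d) (n h)
                   else (\<lambda>_. undefined))\<rparr>"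
    and m_cowedge: "\<And>k g c d. \<lbrakk>k \<in> Obj K; g \<in> Hom D c d\<rbrakk> \<Longrightarrow>
        cowedge (S k) (T k d) (\<lambda>p. cls (S k) (T k c) (m k g p))"
    and m_in: "\<And>k g c d p. \<lbrakk>k \<in> Obj K; g \<in> Hom D c d; p \<in> gens (S k) (T k d)\<rbrakk> \<Longrightarrow>
        m k g p \<in> gens (S k) (T k c)"
    and m_Ide: "\<And>k d p. \<lbrakk>k \<in> Obj K; d \<in> Obj D; p \<in> gens (S k) (T k d)\<rbrakk> \<Longrightarrow> m k (Ide D d) p = p"
    and m_Cmp: "\<And>k f g b c d p. \<lbrakk>k \<in> Obj K; f \<in> Hom D b c; g \<in> Hom D c d; p \<in> gens (S k) (T k d)\<rbrakk> \<Longrightarrow>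
        m k (g \<cdot>\<^bsub>D\<^esub> f) p = m k f (m k g p)"
    and n_cowedge: "\<And>h k k' d. \<lbrakk>h \<in> Hom K k k'; d \<in> Obj D\<rbrakk> \<Longrightarrow>
        cowedge (S k) (T k d) (\<lambda>p. cls (S k') (T k' d) (n h p))"
    and n_in: "\<And>h k k' d p. \<lbrakk>h \<in> Hom K k k'; d \<in> Obj D; p \<in> gens (S k) (T k d)\<rbrakk> \<Longrightarrow>
        n h p \<in> gens (S k') (T k' d)"
    and n_Ide: "\<And>k d p. \<lbrakk>k \<in> Obj K; d \<in> Obj D; p \<in> gens (S k) (T k d)\<rbrakk> \<Longrightarrow> n (Ide K k) p = p"
    and n_Cmp: "\<And>h h' k k' k'' d p. \<lbrakk>h \<in> Hom K k k'; h' \<in> Hom K k' k''; d \<in> Obj D; p \<in> gens (S k) (T k d)\<rbrakk> \<Longrightarrow>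
        n (h' \<cdot>\<^bsub>K\<^esub> h) p = n h' (n h p)"
    and nm: "\<And>h k k' g c d p. \<lbrakk>h \<in> Hom K k k'; g \<in> Hom D c d; p \<in> gens (S k) (T k d)\<rbrakk> \<Longrightarrow>
        n h (m k g p) = m k' g (n h p)"
begin

lemma At: "At (FO P k) d = (if d \<in> Obj D then coend (S k) (T k d) else {})"
  by (simp add: FO)

lemma Act: "g \<in> Hom D c d \<Longrightarrow> Act (FO P k) g = coend_map (S k) (T k d) (S k) (T k c) (m k g)"
  by (simp add: FO Hom_def)

lemma NAt: "\<lbrakk>h \<in> Hom K k k'; d \<in> Obj D\<rbrakk> \<Longrightarrow>
    NAt (FA P h) d = coend_map (S k) (T k d) (S k') (T k' d) (n h)"
  by (simp add: FA Hom_def)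

lemma Act_cls:
  assumes "k \<in> Obj K" "g \<in> Hom D c d" "p \<in> gens (S k) (T k d)"
  shows "Act (FO P k) g (cls (S k) (T k d) p) = cls (S k) (T k c) (m k g p)"
  by (simp add: Act[OF assms(2)] coend_map_cls[OF m_cowedge[OF assms(1,2)] assms(3)])

lemma NAt_cls:
  assumes "h \<in> Hom K k k'" "d \<in> Obj D" "p \<in> gens (S k) (T k d)"
  shows "NAt (FA P h) d (cls (S k) (T k d) p) = cls (S k') (T k' d) (n h p)"
  by (simp add: NAt[OF assms(1,2)] coend_map_cls[OF n_cowedge[OF assms(1,2)] assms(3)])

lemma is_functor: "is_functor K (psh D) P"
proof -
  have ext: "coend_map C T C' T' m' \<in> extensional (coend C T)" for C T C' T' m'
    by (simp add: coend_map_def)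
  show "is_functor K (psh D) P"
  proof (rule psh_functorI[OF K.category_axioms D.category_axioms])
    fix k assume k: "k \<in> Obj K"
    show "is_presheaf D (FO P k)"
    proof
      fix f c d assume f: "f \<in> Hom D c d"
      note cd = Hom_Obj[OF D.category_axioms f]
      show "Act (FO P k) f \<in> At (FO P k) d \<rightarrow>\<^sub>E At (FO P k) c"
        using cd ext by (auto simp: PiE_iff At Act[OF f] coend_map_cls[OF m_cowedge[OF k f]]
            elim!: coendE intro!: cls_in_coend m_in[OF k f])
    next
      fix c x assume c: "c \<in> Obj D" and "x \<in> At (FO P k) c"
      then show "Act (FO P k) (Ide D c) x = x"
        using Act_cls[OF k D.Ide_in[OF c]] m_Ide[OF k c] by (auto simp: At elim!: coendE)
    next
      fix f g b c d x assume fg: "f \<in> Hom D b c" "g \<in> Hom D c d" and x: "x \<in> At (FO P k) d"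
      then obtain p where p: "p \<in> gens (S k) (T k d)" "x = cls (S k) (T k d) p"
        by (auto simp: At elim!: coendE split: if_splits)
      then show "Act (FO P k) (g \<cdot>\<^bsub>D\<^esub> f) x = Act (FO P k) f (Act (FO P k) g x)"
        using Act_cls[OF k D.Cmp_in[OF fg]] Act_cls[OF k fg(1)] Act_cls[OF k fg(2)] m_in[OF k fg(2)] m_Cmp[OF k fg]
        by simp
    qed (simp_all add: FO)
  next
    fix h k k' c assume h: "h \<in> Hom K k k'" and c: "c \<in> Obj D"
    then show "NAt (FA P h) c \<in> At (FO P k) c \<rightarrow>\<^sub>E At (FO P k') c"
      using ext by (auto simp: PiE_iff At NAt[OF h] coend_map_cls[OF n_cowedge[OF h]]
          elim!: coendE intro!: cls_in_coend n_in[OF h])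
  next
    fix h k k' f c d x assume h: "h \<in> Hom K k k'" and f: "f \<in> Hom D c d" and "x \<in> At (FO P k) d"
    then obtain p where p: "p \<in> gens (S k) (T k d)" "x = cls (S k) (T k d) p"
      by (auto simp: At elim!: coendE split: if_splits)
    note cd = Hom_Obj[OF D.category_axioms f] and kk = Hom_Obj[OF K.category_axioms h]
    show "NAt (FA P h) c (Act (FO P k) f x) = Act (FO P k') f (NAt (FA P h) d x)"
      using p Act_cls[OF kk(1) f] Act_cls[OF kk(2) f] NAt_cls[OF h cd(1)] NAt_cls[OF h cd(2)]
        m_in[OF kk(1) f] n_in[OF h cd(2)] nm[OF h f] by simp
  next
    fix k c x assume k: "k \<in> Obj K" and c: "c \<in> Obj D" and "x \<in> At (FO P k) c"
    then show "NAt (FA P (Ide K k)) c x = x"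
      using NAt_cls[OF K.Ide_in[OF k] c] n_Ide[OF k c] by (auto simp: At elim!: coendE)
  next
    fix h h' k k' k'' c x
    assume h: "h \<in> Hom K k k'" "h' \<in> Hom K k' k''" and c: "c \<in> Obj D" and x: "x \<in> At (FO P k) c"
    then obtain p where p: "p \<in> gens (S k) (T k c)" "x = cls (S k) (T k c) p"
      by (auto simp: At elim!: coendE)
    then show "NAt (FA P (h' \<cdot>\<^bsub>K\<^esub> h)) c x = NAt (FA P h') c (NAt (FA P h) c x)"
      using NAt_cls[OF K.Cmp_in[OF h] c] NAt_cls[OF h(1) c] NAt_cls[OF h(2) c] n_in[OF h(1) c] n_Cmp[OF h c]
      by simp
  qed (auto simp: FA)
qed

end

section \<open>Isomorphisms of functors into presheaf categories\<close>

text \<open>Both fibres are quotients of one set \<open>G k c\<close> of generators.  When the quotient maps \<open>q\<close> and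
\<open>r\<close> identify the same generators, sending \<open>q x\<close> to \<open>r x\<close> is a bijection, and it is natural as
soon as both structure maps can be computed by one operation on generators.  Neither the map nor its
inverse has to be defined on classes.\<close>

lemma psh_isoI_generators:
  assumes P: "is_functor K (psh C) P" and Q: "is_functor K (psh C) Q"
    and P_gen: "\<And>k c. \<lbrakk>k \<in> Obj K; c \<in> Obj C\<rbrakk> \<Longrightarrow> At (FO P k) c = q k c ` G k c"
    and Q_gen: "\<And>k c. \<lbrakk>k \<in> Obj K; c \<in> Obj C\<rbrakk> \<Longrightarrow> At (FO Q k) c = r k c ` G k c"
    and eq: "\<And>k c x y. \<lbrakk>k \<in> Obj K; c \<in> Obj C; x \<in> G k c; y \<in> G k c\<rbrakk> \<Longrightarrow>
      q k c x = q k c y \<longleftrightarrow> r k c x = r k c y"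
    and act: "\<And>k f c d x. \<lbrakk>k \<in> Obj K; f \<in> Hom C c d; x \<in> G k d\<rbrakk> \<Longrightarrow>
      \<exists>y \<in> G k c. Act (FO P k) f (q k d x) = q k c y \<and> Act (FO Q k) f (r k d x) = r k c y"
    and nat: "\<And>h k k' c x. \<lbrakk>h \<in> Hom K k k'; c \<in> Obj C; x \<in> G k c\<rbrakk> \<Longrightarrow>
      \<exists>y \<in> G k' c. NAt (FA P h) c (q k c x) = q k' c y \<and> NAt (FA Q h) c (r k c x) = r k' c y"
  shows "\<exists>\<phi>. psh_iso K C P Q \<phi> \<and> (\<forall>k \<in> Obj K. \<forall>c \<in> Obj C. \<forall>x \<in> G k c. \<phi> k c (q k c x) = r k c x)"
proof -
  define \<phi> where "\<phi> k c v = r k c (SOME x. x \<in> G k c \<and> q k c x = v)" for k c v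
  have \<phi>: "\<phi> k c (q k c x) = r k c x" if "k \<in> Obj K" "c \<in> Obj C" "x \<in> G k c" for k c x
  proof -
    have "(SOME y. y \<in> G k c \<and> q k c y = q k c x) \<in> G k c \<and>
        q k c (SOME y. y \<in> G k c \<and> q k c y = q k c x) = q k c x"
      by (rule someI_ex) (use that in blast)
    then show ?thesis unfolding \<phi>_def using eq[OF that(1,2) _ that(3)] by blast
  qed
  interpret P: is_functor K "psh C" P by (rule P)
  interpret Q: is_functor K "psh C" Q by (rule Q)
  have K: "category K" by (rule P.dom.category_axioms)
  have "psh_iso K C P Q \<phi>"
  proof
    fix k c assume kc: "k \<in> Obj K" "c \<in> Obj C"
    have "\<phi> k c ` q k c ` G k c = r k c ` G k c"
      using \<phi>[OF kc] by (simp add: image_image)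
    moreover have "inj_on (\<phi> k c) (q k c ` G k c)"
      using \<phi>[OF kc] eq[OF kc] by (auto simp: inj_on_def)
    ultimately show "bij_betw (\<phi> k c) (At (FO P k) c) (At (FO Q k) c)"
      by (simp add: bij_betw_def P_gen[OF kc] Q_gen[OF kc])
  next
    fix k f c d x assume k: "k \<in> Obj K" and f: "f \<in> Hom C c d" and x: "x \<in> At (FO P k) d"
    have d: "d \<in> Obj C"
      using x is_presheaf.At_outside[OF psh_functor(1)[OF P k]] by blast
    have c: "c \<in> Obj C"
      using presheaf_Act_in[OF psh_functor(1)[OF P k] f x] is_presheaf.At_outside[OF psh_functor(1)[OF P k]]
      by blast
    obtain y where y: "y \<in> G k d" "x = q k d y" using x P_gen[OF k d] by blast
    obtain z where "z \<in> G k c" "Act (FO P k) f (q k d y) = q k c z" "Act (FO Q k) f (r k d y) = r k c z"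
      using act[OF k f y(1)] by blast
    then show "\<phi> k c (Act (FO P k) f x) = Act (FO Q k) f (\<phi> k d x)"
      using y \<phi>[OF k c] \<phi>[OF k d] by simp
  next
    fix h k k' c x assume h: "h \<in> Hom K k k'" and c: "c \<in> Obj C" and x: "x \<in> At (FO P k) c"
    note k = Hom_Obj[OF K h]
    obtain y where y: "y \<in> G k c" "x = q k c y" using x P_gen[OF k(1) c] by blast
    obtain z where "z \<in> G k' c" "NAt (FA P h) c (q k c y) = q k' c z" "NAt (FA Q h) c (r k c y) = r k' c z"
      using nat[OF h c y(1)] by blast
    then show "\<phi> k' c (NAt (FA P h) c x) = NAt (FA Q h) c (\<phi> k c x)"
      using y \<phi>[OF k(1) c] \<phi>[OF k(2) c] by simp
  qed
  then show ?thesis using \<phi> by blast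
qed

lemma psh_iso_whisker:
  assumes "psh_iso K C P Q \<phi>" and F: "is_functor J K F"
  shows "psh_iso J C (P \<odot> F) (Q \<odot> F) (\<lambda>j. \<phi> (FO F j))"
proof -
  interpret psh_iso K C P Q \<phi> by (rule assms)
  interpret F: is_functor J K F by (rule F)
  show ?thesis
    by (intro psh_iso.intro psh_iso_axioms.intro is_functor_fcomp[OF F] P.is_functor_axioms Q.is_functor_axioms)
      (auto intro: bij natural_Act natural_NAt F.FO_in F.FA_in)
qed

lemma psh_iso_trans:
  assumes "psh_iso K C P Q \<phi>" and "psh_iso K C Q R \<psi>"
  shows "psh_iso K C P R (\<lambda>k c x. \<psi> k c (\<phi> k c x))"
proof -
  interpret PQ: psh_iso K C P Q \<phi> by (rule assms)
  interpret QR: psh_iso K C Q R \<psi> by (rule assms)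
  have \<phi>_in: "\<phi> k c x \<in> At (FO Q k) c" if "k \<in> Obj K" "x \<in> At (FO P k) c" for k c x
  proof -
    have "c \<in> Obj C"
      using is_presheaf.At_outside[OF psh_functor(1)[OF PQ.P.is_functor_axioms that(1)]] that(2) by blast
    then show ?thesis using PQ.bij[OF that(1)] that(2) by (auto simp: bij_betw_def)
  qed
  show ?thesis
  proof (intro psh_iso.intro psh_iso_axioms.intro PQ.P.is_functor_axioms QR.Q.is_functor_axioms)
    show "bij_betw (\<lambda>x. \<psi> k c (\<phi> k c x)) (At (FO P k) c) (At (FO R k) c)" if "k \<in> Obj K" "c \<in> Obj C" for k c
      using bij_betw_trans[OF PQ.bij[OF that] QR.bij[OF that]] by (simp add: comp_def)
  next
    fix h k k' c x assume h: "h \<in> Hom K k k'" and "c \<in> Obj C" and "x \<in> At (FO P k) c"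
    then show "\<psi> k' c (\<phi> k' c (NAt (FA P h) c x)) = NAt (FA R h) c (\<psi> k c (\<phi> k c x))"
      using PQ.natural_NAt QR.natural_NAt \<phi>_in Hom_Obj[OF PQ.P.dom.category_axioms h] by simp
  qed (use PQ.natural_Act QR.natural_Act \<phi>_in in simp)
qed

section \<open>The Kleisli extension is a functor\<close>

lemma kan_bif_sel [simp]:
  "BO (kan_bif F Z d) c' c = At Z c' \<times> At (FO F c) d"
  "BA (kan_bif F Z d) f g (z, y) = (Act Z f z, NAt (FA F g) d y)"
  by (simp_all add: kan_bif_def)

lemma cowedge_kanI:
  assumes F: "is_functor C (psh D) F" and Z: "is_presheaf C Z" and d: "d \<in> Obj D"
    and h: "\<And>f c c' z y. \<lbrakk>f \<in> Hom C c c'; z \<in> At Z c'; y \<in> At (FO F c) d\<rbrakk> \<Longrightarrow>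
      h (c, Act Z f z, y) = h (c', z, NAt (FA F f) d y)"
  shows "cowedge C (kan_bif F Z d) h"
proof -
  interpret F: is_functor C "psh D" F by (rule F)
  show ?thesis
    unfolding cowedge_def
  proof clarsimp
    fix f c c' z y assume *: "f \<in> Hom C c c'" "z \<in> At Z c'" "y \<in> At (FO F c) d"
    note cc = Hom_Obj[OF F.dom.category_axioms *(1)]
    show "h (c, Act Z f z, NAt (FA F (Ide C c)) d y) = h (c', Act Z (Ide C c') z, NAt (FA F f) d y)"
      using h[OF *] * cc psh_functor(3)[OF F cc(1) d] is_presheaf.Act_Ide[OF Z cc(2)] by simp
  qed
qed

lemma BA_kan_Ide:
  assumes F: "is_functor C (psh D) F" and Z: "is_presheaf C Z" and d: "d \<in> Obj D"
    and *: "c \<in> Obj C" "t \<in> BO (kan_bif F Z d) c c"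
  shows "BA (kan_bif F Z d) (Ide C c) (Ide C c) t = t"
  using psh_functor(3)[OF F *(1) d] is_presheaf.Act_Ide[OF Z *(1)] *(2) by (cases t) simp

text \<open>The slide of the Kleisli extension, with the identities that the general coend inserts removed.\<close>

lemma cls_kan_step:
  assumes F: "is_functor C (psh D) F" and Z: "is_presheaf C Z" and d: "d \<in> Obj D"
    and *: "f \<in> Hom C c c'" "z \<in> At Z c'" "y \<in> At (FO F c) d"
  shows "cls C (kan_bif F Z d) (c, Act Z f z, y) = cls C (kan_bif F Z d) (c', z, NAt (FA F f) d y)"
proof -
  interpret F: is_functor C "psh D" F by (rule F)
  note cc = Hom_Obj[OF F.dom.category_axioms *(1)]
  have "cls C (kan_bif F Z d) (c, BA (kan_bif F Z d) f (Ide C c) (z, y)) =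
      cls C (kan_bif F Z d) (c', BA (kan_bif F Z d) (Ide C c') f (z, y))"
    using cowedge_cls[of C "kan_bif F Z d"] * unfolding cowedge_def by auto
  then show ?thesis
    using * psh_functor(3)[OF F cc(1) d] is_presheaf.Act_Ide[OF Z cc(2)] by simp
qed

lemma gens_kan [simp]:
  "(c, z, y) \<in> gens C (kan_bif F Z d) \<longleftrightarrow> c \<in> Obj C \<and> z \<in> At Z c \<and> y \<in> At (FO F c) d"
  by (simp add: gens_def)

lemma coend_functor_kan:
  fixes F :: "('o, 'a, ('p, 'b, 'y) presheaf, ('p, 'b, 'y) ptrans) fctr"
  assumes F: "is_functor C (psh D) F" and D: "category D"
  shows "coend_functor (psh C) D (kan C D F :: (('o, 'a, 'x) presheaf, _, _, _) fctr)
    (\<lambda>_. C) (\<lambda>Z d. kan_bif F Z d) (\<lambda>Z g (c, z, y). (c, z, Act (FO F c) g y))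
    (\<lambda>\<alpha> (c, z, y). (c, NAt \<alpha> c z, y))"
    (is "coend_functor _ _ _ _ _ ?m ?n")
proof -
  interpret F: is_functor C "psh D" F by (rule F)
  have C: "category C" by (rule F.dom.category_axioms)
  interpret psh: category "psh C" by (rule category_psh[OF C])
  interpret D: category D by (rule D)
  have pF: "c \<in> Obj C \<Longrightarrow> is_presheaf D (FO F c)" for c by (rule psh_functor(1)[OF F])
  show ?thesis
  proof
    fix Z :: "('o, 'a, 'x) presheaf" and g c d assume Z: "Z \<in> Obj (psh C)" and g: "g \<in> Hom D c d"
    note cd = Hom_Obj[OF D g]
    show "cowedge C (kan_bif F Z d) (\<lambda>p. cls C (kan_bif F Z c) (?m Z g p))"
    proof (rule cowedge_kanI[OF F _ cd(2)], use Z in simp, clarsimp)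
      fix f a b z y assume *: "f \<in> Hom C a b" "z \<in> At Z b" "y \<in> At (FO F a) d"
      note ab = Hom_Obj[OF C *(1)]
      show "cls C (kan_bif F Z c) (a, Act Z f z, Act (FO F a) g y) =
          cls C (kan_bif F Z c) (b, z, Act (FO F b) g (NAt (FA F f) d y))"
        using cls_kan_step[OF F _ cd(1) *(1,2) presheaf_Act_in[OF pF[OF ab(1)] g *(3)]]
          psh_functor(5)[OF F *(1) g *(3)] Z by simp
    qed
    show "?m Z g p \<in> gens C (kan_bif F Z c)" if "p \<in> gens C (kan_bif F Z d)" for p
      using that presheaf_Act_in[OF pF g] by (cases p) auto
  next
    fix \<alpha> and Z Z' :: "('o, 'a, 'x) presheaf" and d assume \<alpha>: "\<alpha> \<in> Hom (psh C) Z Z'" and d: "d \<in> Obj D"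
    then interpret \<alpha>: is_ptrans C \<alpha> by (simp add: Hom_psh_iff)
    have sel: "NDom \<alpha> = Z" "NCod \<alpha> = Z'" using \<alpha> by (simp_all add: Hom_psh_iff)
    note NAt_in = ptrans_NAt_in[OF \<alpha>.is_ptrans_axioms, unfolded sel]
    show "cowedge C (kan_bif F Z d) (\<lambda>p. cls C (kan_bif F Z' d) (?n \<alpha> p))"
    proof (rule cowedge_kanI[OF F _ d], use \<alpha>.dom.is_presheaf_axioms sel in simp, clarsimp)
      fix f a b z y assume *: "f \<in> Hom C a b" "z \<in> At Z b" "y \<in> At (FO F a) d"
      note ab = Hom_Obj[OF C *(1)]
      show "cls C (kan_bif F Z' d) (a, NAt \<alpha> a (Act Z f z), y) =
          cls C (kan_bif F Z' d) (b, NAt \<alpha> b z, NAt (FA F f) d y)"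
        using cls_kan_step[OF F _ d *(1) NAt_in[OF ab(2) *(2)] *(3)]
          \<alpha>.natural[unfolded sel, OF *(1,2)] \<alpha>.cod.is_presheaf_axioms sel by simp
    qed
    show "?n \<alpha> p \<in> gens C (kan_bif F Z' d)" if "p \<in> gens C (kan_bif F Z d)" for p
      using that NAt_in by (cases p) auto
  next
    fix Z :: "('o, 'a, 'x) presheaf" and d p assume "Z \<in> Obj (psh C)" "d \<in> Obj D" "p \<in> gens C (kan_bif F Z d)"
    then show "?m Z (Ide D d) p = p" "?n (Ide (psh C) Z) p = p"
      using is_presheaf.Act_Ide[OF pF] by (cases p, auto simp: NAt_Ide_psh)+
  next
    fix Z :: "('o, 'a, 'x) presheaf" and f g b c d p
    assume *: "Z \<in> Obj (psh C)" "f \<in> Hom D b c" "g \<in> Hom D c d" "p \<in> gens C (kan_bif F Z d)"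
    then show "?m Z (g \<cdot>\<^bsub>D\<^esub> f) p = ?m Z f (?m Z g p)"
      using is_presheaf.Act_Cmp[OF pF *(2,3)] by (cases p) auto
  next
    fix \<alpha> \<beta> and Z Z' Z'' :: "('o, 'a, 'x) presheaf" and d p
    assume "\<alpha> \<in> Hom (psh C) Z Z'" "\<beta> \<in> Hom (psh C) Z' Z''" "d \<in> Obj D" "p \<in> gens C (kan_bif F Z d)"
    then show "?n (\<beta> \<cdot>\<^bsub>psh C\<^esub> \<alpha>) p = ?n \<beta> (?n \<alpha> p)"
      by (cases p) (auto simp: NAt_Cmp_psh Hom_psh_iff)
  qed (auto simp: kan_def kan_ob_def)
qed

lemmas is_functor_kan = coend_functor.is_functor[OF coend_functor_kan]
lemmas Act_kan = coend_functor.Act_cls[OF coend_functor_kan]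
lemmas NAt_kan = coend_functor.NAt_cls[OF coend_functor_kan]

lemma At_kan: "d \<in> Obj D \<Longrightarrow> At (FO (kan C D F) Z) d = cls C (kan_bif F Z d) ` gens C (kan_bif F Z d)"
  by (simp add: kan_def kan_ob_def coend_eq_cls)

text \<open>Applying \<open>\<phi>\<close> to the last component of a representative, and its inverse for the converse, is
compatible with slides because \<open>\<phi>\<close> is natural in the first variable.\<close>

lemma psh_iso_kan:
  fixes F :: "('o, 'a, ('p, 'b, 'y) presheaf, ('p, 'b, 'y) ptrans) fctr"
    and F' :: "('o, 'a, ('p, 'b, 'w) presheaf, ('p, 'b, 'w) ptrans) fctr"
  assumes "psh_iso C D F F' \<phi>" and D: "category D"
  shows "\<exists>\<psi>. psh_iso (psh C) D (kan C D F :: (('o, 'a, 'x) presheaf, _, _, _) fctr) (kan C D F') \<psi> \<and>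
    (\<forall>Z \<in> Obj (psh C). \<forall>d \<in> Obj D. \<forall>(c, z, y) \<in> gens C (kan_bif F Z d).
       \<psi> Z d (cls C (kan_bif F Z d) (c, z, y)) = cls C (kan_bif F' Z d) (c, z, \<phi> c d y))"
proof -
  interpret psh_iso C D F F' \<phi> by (rule assms)
  have F: "is_functor C (psh D) F" and F': "is_functor C (psh D) F'" by unfold_locales
  have C: "category C" by unfold_locales
  define inv where "inv c d = inv_into (At (FO F c) d) (\<phi> c d)" for c d
  have \<phi>_in: "\<phi> c d y \<in> At (FO F' c) d" and inv_\<phi>: "inv c d (\<phi> c d y) = y"
    if "c \<in> Obj C" "d \<in> Obj D" "y \<in> At (FO F c) d" for c d y
    using bij[OF that(1,2)] that(3) by (auto simp: bij_betw_def inv_def inv_into_f_f)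
  have inv_in: "inv c d y \<in> At (FO F c) d" and \<phi>_inv: "\<phi> c d (inv c d y) = y"
    if "c \<in> Obj C" "d \<in> Obj D" "y \<in> At (FO F' c) d" for c d y
    using bij[OF that(1,2)] that(3) by (auto simp: bij_betw_def inv_def inv_into_into f_inv_into_f)
  let ?q = "\<lambda>Z d. cls C (kan_bif F Z d)" and ?q' = "\<lambda>Z d. cls C (kan_bif F' Z d)"
  let ?t = "\<lambda>Z d (c, z, y). (c, z, \<phi> c d y)"
  have "\<exists>\<psi>. psh_iso (psh C) D (kan C D F :: (('o, 'a, 'x) presheaf, _, _, _) fctr) (kan C D F') \<psi> \<and>
    (\<forall>Z \<in> Obj (psh C). \<forall>d \<in> Obj D. \<forall>p \<in> gens C (kan_bif F Z d).
       \<psi> Z d (?q Z d p) = ?q' Z d (?t Z d p))"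
  proof (rule psh_isoI_generators[OF is_functor_kan[OF F D] is_functor_kan[OF F' D]])
    fix Z :: "('o, 'a, 'x) presheaf" and d assume Z: "Z \<in> Obj (psh C)" and d: "d \<in> Obj D"
    then have pZ: "is_presheaf C Z" by simp
    show "At (FO (kan C D F) Z) d = ?q Z d ` gens C (kan_bif F Z d)" by (rule At_kan[OF d])
    have "gens C (kan_bif F' Z d) = ?t Z d ` gens C (kan_bif F Z d)"
    proof (intro equalityI subsetI)
      fix p assume p: "p \<in> gens C (kan_bif F' Z d)"
      obtain c z y where "p = (c, z, y)" by (cases p)
      then show "p \<in> ?t Z d ` gens C (kan_bif F Z d)"
        using p inv_in \<phi>_inv d by (intro image_eqI[of _ _ "(c, z, inv c d y)"]) auto
    qed (auto simp: \<phi>_in d)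
    then show "At (FO (kan C D F') Z) d = (\<lambda>p. ?q' Z d (?t Z d p)) ` gens C (kan_bif F Z d)"
      by (simp add: At_kan[OF d] image_image)
    have fwd: "cowedge C (kan_bif F Z d) (\<lambda>p. ?q' Z d (?t Z d p))"
    proof (rule cowedge_kanI[OF F pZ d], clarsimp)
      fix f a b z y assume *: "f \<in> Hom C a b" "z \<in> At Z b" "y \<in> At (FO F a) d"
      note ab = Hom_Obj[OF C *(1)]
      show "?q' Z d (a, Act Z f z, \<phi> a d y) = ?q' Z d (b, z, \<phi> b d (NAt (FA F f) d y))"
        using cls_kan_step[OF F' pZ d *(1,2) \<phi>_in[OF ab(1) d *(3)]] natural_NAt[OF *(1) d *(3)] by simp
    qed
    have bwd: "cowedge C (kan_bif F' Z d) (\<lambda>(c, z, y). ?q Z d (c, z, inv c d y))"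
    proof (rule cowedge_kanI[OF F' pZ d], clarsimp)
      fix f a b z y assume *: "f \<in> Hom C a b" "z \<in> At Z b" "y \<in> At (FO F' a) d"
      note ab = Hom_Obj[OF C *(1)]
      note y = inv_in[OF ab(1) d *(3)] \<phi>_inv[OF ab(1) d *(3)]
      have "inv b d (NAt (FA F' f) d y) = NAt (FA F f) d (inv a d y)"
        using natural_NAt[OF *(1) d y(1)] y inv_\<phi>[OF ab(2) d psh_functor(2)[OF F *(1) d y(1)]] by simp
      then show "?q Z d (a, Act Z f z, inv a d y) = ?q Z d (b, z, inv b d (NAt (FA F' f) d y))"
        using cls_kan_step[OF F pZ d *(1,2) y(1)] by simp
    qed
    show "?q Z d p = ?q Z d p' \<longleftrightarrow> ?q' Z d (?t Z d p) = ?q' Z d (?t Z d p')"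
      if "p \<in> gens C (kan_bif F Z d)" "p' \<in> gens C (kan_bif F Z d)" for p p'
    proof
      assume "?q' Z d (?t Z d p) = ?q' Z d (?t Z d p')"
      from cowedge_eq[OF bwd this] show "?q Z d p = ?q Z d p'"
        using that inv_\<phi> d by (cases p; cases p') simp
    qed (rule cowedge_eq[OF fwd])
  next
    fix Z :: "('o, 'a, 'x) presheaf" and g c d p
    assume Z: "Z \<in> Obj (psh C)" and g: "g \<in> Hom D c d" and p: "p \<in> gens C (kan_bif F Z d)"
    note cd = Hom_Obj[OF D g]
    obtain a z y where [simp]: "p = (a, z, y)" by (cases p)
    from p have a: "a \<in> Obj C" "z \<in> At Z a" "y \<in> At (FO F a) d" by auto
    show "\<exists>p' \<in> gens C (kan_bif F Z c).
        Act (FO (kan C D F) Z) g (?q Z d p) = ?q Z c p' \<and>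
        Act (FO (kan C D F') Z) g (?q' Z d (?t Z d p)) = ?q' Z c (?t Z c p')"
      using a Z cd \<phi>_in natural_Act[OF a(1) g a(3)] presheaf_Act_in[OF psh_functor(1)[OF F a(1)] g a(3)]
      by (intro bexI[of _ "(a, z, Act (FO F a) g y)"])
        (simp_all add: Act_kan[OF F D _ g] Act_kan[OF F' D _ g])
  next
    fix \<alpha> and Z Z' :: "('o, 'a, 'x) presheaf" and d p
    assume \<alpha>: "\<alpha> \<in> Hom (psh C) Z Z'" and d: "d \<in> Obj D" and p: "p \<in> gens C (kan_bif F Z d)"
    obtain a z y where [simp]: "p = (a, z, y)" by (cases p)
    from p have a: "a \<in> Obj C" "z \<in> At Z a" "y \<in> At (FO F a) d" by auto
    have "NAt \<alpha> a z \<in> At Z' a"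
      using \<alpha> a ptrans_NAt_in[of C \<alpha>] by (auto simp: Hom_psh_iff)
    then show "\<exists>p' \<in> gens C (kan_bif F Z' d).
        NAt (FA (kan C D F) \<alpha>) d (?q Z d p) = ?q Z' d p' \<and>
        NAt (FA (kan C D F') \<alpha>) d (?q' Z d (?t Z d p)) = ?q' Z' d (?t Z' d p')"
      using a \<phi>_in d
      by (intro bexI[of _ "(a, NAt \<alpha> a z, y)"])
        (simp_all add: NAt_kan[OF F D \<alpha> d] NAt_kan[OF F' D \<alpha> d])
  qed
  then show ?thesis by force
qed

section \<open>Wirings\<close>

definition wirable :: "combinator set \<Rightarrow> bool" where
  "wirable X \<longleftrightarrow> X \<in> {{}, {Epsilon_c}, {Sigma_c}, {Sigma_c, Delta_c}, {Sigma_c, Epsilon_c},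
                        {Sigma_c, Delta_c, Epsilon_c}}"

text \<open>As properties of lists, the conditions on wirings are easier to transport along \<open>map\<close> and
\<open>concat\<close>.\<close>

lemma wiring_iff:
  "wiring X n f \<longleftrightarrow> set f \<subseteq> {..<n} \<and>
    (X = {} \<and> f = [0..<n] \<or> X = {Epsilon_c} \<and> sorted_wrt (<) f \<or>
     X = {Sigma_c} \<and> distinct f \<and> set f = {..<n} \<or> X = {Sigma_c, Delta_c} \<and> set f = {..<n} \<or>
     X = {Sigma_c, Epsilon_c} \<and> distinct f \<or> X = {Sigma_c, Delta_c, Epsilon_c})"
proof -
  have "inj_on ((!) f) {..<length f} \<longleftrightarrow> distinct f"
    by (auto simp: inj_on_def distinct_conv_nth)
  moreover have "(!) f ` {..<length f} = set f"
    by (auto simp: set_conv_nth)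
  moreover have "mono_on {..<length f} ((!) f) \<and> distinct f \<longleftrightarrow> sorted_wrt (<) f"
    by (auto simp: mono_on_def strict_sorted_iff sorted_iff_nth_mono)
  ultimately show ?thesis
    unfolding wiring_def bij_betw_def by auto
qed

lemma wiring_less: "wiring X n f \<Longrightarrow> j < length f \<Longrightarrow> f ! j < n"
  using subsetD[OF _ nth_mem, of f "{..<n}" j] by (simp add: wiring_iff)

lemma wiring_set_less: "wiring X n f \<Longrightarrow> j \<in> set f \<Longrightarrow> j < n"
  by (auto simp: wiring_def)

lemma wiring_simps:
  "wiring {} n f \<longleftrightarrow> f = [0..<n]"
  "wiring {Epsilon_c} n f \<longleftrightarrow> set f \<subseteq> {..<n} \<and> sorted_wrt (<) f"
  "wiring {Sigma_c} n f \<longleftrightarrow> distinct f \<and> set f = {..<n}"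
  "wiring {Sigma_c, Delta_c} n f \<longleftrightarrow> set f = {..<n}"
  "wiring {Sigma_c, Epsilon_c} n f \<longleftrightarrow> set f \<subseteq> {..<n} \<and> distinct f"
  "wiring {Sigma_c, Delta_c, Epsilon_c} n f \<longleftrightarrow> set f \<subseteq> {..<n}"
  by (auto simp: wiring_iff)

lemma wiring_cases:
  assumes "wiring X n f"
  obtains "X = {}" | "X = {Epsilon_c}" | "X = {Sigma_c}" | "X = {Sigma_c, Delta_c}"
    | "X = {Sigma_c, Epsilon_c}" | "X = {Sigma_c, Delta_c, Epsilon_c}"
  using assms unfolding wiring_iff by blast

lemma wiring_upt: "wirable X \<Longrightarrow> wiring X n [0..<n]"
  unfolding wiring_iff wirable_def by (auto simp: sorted_wrt_upt)

lemma wiring_comp: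
  assumes f: "wiring X n f" and k: "wiring X (length f) k"
  shows "wiring X n (map ((!) f) k)"
proof -
  have k_less: "set k \<subseteq> {..<length f}" using k by (simp add: wiring_iff)
  have "set (map ((!) f) k) \<subseteq> {..<n}"
    using k_less wiring_less[OF f] by auto
  moreover have "map ((!) f) k = [0..<n]" if "f = [0..<n]" "k = [0..<length f]"
    using that map_nth[of "[0..<n]"] by simp
  moreover have "sorted_wrt (<) (map ((!) f) k)" if "sorted_wrt (<) f" "sorted_wrt (<) k"
    using that wiring_less[OF k] by (auto simp: sorted_wrt_iff_nth_less)
  moreover have "distinct (map ((!) f) k)" if "distinct f" "distinct k"
    using that k_less by (auto simp: distinct_map intro!: inj_on_nth)
  moreover have "set (map ((!) f) k) = {..<n}" if "set f = {..<n}" "set k = {..<length f}"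
    using that nth_image[of "length f" f] by (simp add: lessThan_atLeast0)
  ultimately show ?thesis
    using f k by (cases rule: wiring_cases[OF f]) (simp_all only: wiring_simps simp_thms)
qed

text \<open>Position \<open>p\<close> of block \<open>i\<close> is \<open>off ns i + p\<close> if the blocks have lengths \<open>ns\<close>.\<close>

definition off :: "nat list \<Rightarrow> nat \<Rightarrow> nat" where
  "off ns i = sum_list (take i ns)"

definition blocks :: "nat list \<Rightarrow> nat list \<Rightarrow> nat list list \<Rightarrow> nat list" where
  "blocks ns w ws = concat (map (\<lambda>j. map (\<lambda>p. off ns (w ! j) + p) (ws ! j)) [0..<length w])"

lemma off_simps [simp]: "off ns 0 = 0" "i < length ns \<Longrightarrow> off ns (Suc i) = off ns i + ns ! i"
  "off ns (length ns) = sum_list ns"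
  by (simp_all add: off_def take_Suc_conv_app_nth)

text \<open>Positions of blocks are ordered lexicographically by block and by position in the block.\<close>

lemma off_less:
  assumes "i < i'" "i' \<le> length ns" "p < ns ! i"
  shows "off ns i + p < off ns i'"
  using assms
proof (induction i')
  case (Suc k)
  then show ?case by (cases "i = k") auto
qed simp

lemma off_inj:
  assumes "i < length ns" "p < ns ! i" "i' < length ns" "p' < ns ! i'" "off ns i + p = off ns i' + p'"
  shows "i = i' \<and> p = p'"
  using off_less[of i i' ns p] off_less[of i' i ns p'] assms by (cases i i' rule: linorder_cases) auto

lemma off_cases:
  assumes "J < off ns k" "k \<le> length ns"
  obtains i p where "i < k" "p < ns ! i" "J = off ns i + p"
  using assms
proof (induction k arbitrary: thesis)
  case (Suc k)
  show ?case
  proof (cases "J < off ns k")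
    case True
    then show ?thesis using Suc by (metis Suc_leD less_SucI)
  next
    case False
    then show ?thesis using Suc.prems(1)[of k "J - off ns k"] Suc.prems(2,3) by simp
  qed
qed simp

lemma nth_concat_off:
  assumes "i < length xss" "p < length (xss ! i)" "ns = map length xss"
  shows "concat xss ! (off ns i + p) = xss ! i ! p"
proof -
  have "concat xss = concat (take i xss) @ xss ! i @ concat (drop (Suc i) xss)"
    using id_take_nth_drop[OF assms(1)] by (metis concat.simps(2) concat_append)
  moreover have "off ns i = length (concat (take i xss))"
    by (simp add: off_def assms(3) length_concat take_map)
  ultimately show ?thesis using assms(2) by (simp add: nth_append)
qed

lemma length_blocks:
  assumes "length ws = length w"
  shows "length (blocks ns w ws) = sum_list (map length ws)"
proof -
  have "map (\<lambda>j. length (ws ! j)) [0..<length w] = map length ws"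
    using assms by (intro nth_equalityI) auto
  then show ?thesis by (simp add: blocks_def length_concat comp_def)
qed

lemma nth_blocks:
  assumes "length ws = length w" "j < length w" "p < length (ws ! j)" "ms = map length ws"
  shows "blocks ns w ws ! (off ms j + p) = off ns (w ! j) + ws ! j ! p"
proof -
  have "map length (map (\<lambda>j. map (\<lambda>p. off ns (w ! j) + p) (ws ! j)) [0..<length w]) = ms"
    using assms by (intro nth_equalityI) auto
  then show ?thesis
    unfolding blocks_def using assms by (subst nth_concat_off[where ns = ms]) auto
qed

text \<open>The underlying function of a flattened morphism.  As \<open>off ns i + p\<close> determines \<open>i\<close> and \<open>p\<close> and
is lexicographically increasing in them, being the identity, increasing, injective or surjective can be
checked first on the indices of the blocks and then inside the blocks.\<close>

lemma wiring_blocks: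
  assumes w: "wiring X (length ns) w"
    and ws: "\<And>j. j < length w \<Longrightarrow> wiring X (ns ! (w ! j)) (ws ! j)"
  shows "wiring X (sum_list ns) (blocks ns w ws)"
proof -
  define B where "B j = map (\<lambda>p. off ns (w ! j) + p) (ws ! j)" for j
  have pre: "blocks ns w ws = concat (map B [0..<length w])"
    unfolding blocks_def B_def by (rule refl)
  have w_less: "w ! j < length ns" if "j < length w" for j
    using wiring_less[OF w that] .
  have B_in: "\<exists>p < ns ! (w ! j). p \<in> set (ws ! j) \<and> J = off ns (w ! j) + p" if "j < length w" "J \<in> set (B j)" for j J
    using that ws[OF that(1)] by (auto simp: B_def wiring_iff)
  have "set (blocks ns w ws) \<subseteq> {..<sum_list ns}"
  proof
    fix J assume "J \<in> set (blocks ns w ws)"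
    then obtain j where j: "j < length w" "J \<in> set (B j)" by (auto simp: pre)
    then show "J \<in> {..<sum_list ns}"
      using B_in[OF j] off_less[of "w ! j" "length ns" ns] w_less[OF j(1)] by auto
  qed
  moreover have "blocks ns w ws = [0..<sum_list ns]"
    if w_upt: "w = [0..<length ns]" and ws_upt: "\<And>j. j < length w \<Longrightarrow> ws ! j = [0..<ns ! (w ! j)]"
  proof -
    have "concat (map B [0..<k]) = [0..<off ns k]" if "k \<le> length ns" for k
      using that
    proof (induction k)
      case (Suc k)
      then have "B k = map (\<lambda>p. off ns k + p) [0..<ns ! k]"
        using w_upt ws_upt[of k] by (simp add: B_def)
      also have "\<dots> = [off ns k..<off ns k + ns ! k]"
        using map_add_upt[of "off ns k" "ns ! k"] by (simp add: add.commute)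
      finally show ?case using Suc upt_add_eq_append[of 0 "off ns k" "ns ! k"] by simp
    qed simp
    from this[of "length ns"] show ?thesis using arg_cong[OF w_upt, of length] by (simp add: pre)
  qed
  moreover have "sorted_wrt (<) (blocks ns w ws)"
    if sw: "sorted_wrt (<) w" and sws: "\<And>j. j < length w \<Longrightarrow> sorted_wrt (<) (ws ! j)"
  proof -
    have "sorted_wrt (<) (concat (map B [0..<k]))" if "k \<le> length w" for k
      using that
    proof (induction k)
      case (Suc k)
      have "sorted_wrt (<) (B k)"
        using sws[of k] Suc.prems by (simp add: B_def sorted_wrt_map)
      moreover have "J < K" if J: "j < k" "J \<in> set (B j)" and K: "K \<in> set (B k)" for j J K
      proof -
        have "w ! j < w ! k"
          using sw J(1) Suc.prems by (auto simp: sorted_wrt_iff_nth_less)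
        then show ?thesis
          using B_in[of j J] B_in[of k K] J K Suc.prems off_less[of "w ! j" "w ! k" ns] w_less[of k]
          by fastforce
      qed
      ultimately show ?case using Suc by (auto simp: sorted_wrt_append)
    qed simp
    from this[of "length w"] show ?thesis by (simp add: pre)
  qed
  moreover have "distinct (blocks ns w ws)"
    if sw: "distinct w" and sws: "\<And>j. j < length w \<Longrightarrow> distinct (ws ! j)"
  proof -
    have "distinct (concat (map B [0..<k]))" if "k \<le> length w" for k
      using that
    proof (induction k)
      case (Suc k)
      have "distinct (B k)"
        using sws[of k] Suc.prems by (simp add: B_def distinct_map)
      moreover have False if J: "j < k" "J \<in> set (B j)" and K: "J \<in> set (B k)" for j J
      proof -
        have jk: "j < length w" "k < length w" using J(1) Suc.prems by auto
        obtain p where p: "p < ns ! (w ! j)" "J = off ns (w ! j) + p"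
          using B_in[OF jk(1) J(2)] by blast
        obtain p' where p': "p' < ns ! (w ! k)" "J = off ns (w ! k) + p'"
          using B_in[OF jk(2) K] by blast
        have "w ! j = w ! k"
          using off_inj[of "w ! j" ns p "w ! k" p'] p p' w_less[OF jk(1)] w_less[OF jk(2)] by simp
        then show False
          using sw J(1) Suc.prems by (auto simp: distinct_conv_nth)
      qed
      ultimately show ?case using Suc by auto
    qed simp
    from this[of "length w"] show ?thesis by (simp add: pre)
  qed
  moreover have "set (blocks ns w ws) = {..<sum_list ns}"
    if "set w = {..<length ns}" and s: "\<And>j. j < length w \<Longrightarrow> set (ws ! j) = {..<ns ! (w ! j)}"
  proof (intro equalityI subsetI)
    fix J assume "J \<in> {..<sum_list ns}"
    then obtain i p where ip: "i < length ns" "p < ns ! i" "J = off ns i + p"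
      using off_cases[of J ns "length ns"] by auto
    then obtain j where j: "j < length w" "w ! j = i"
      using \<open>set w = _\<close> by (metis in_set_conv_nth lessThan_iff)
    then have "J \<in> set (B j)" using ip s[OF j(1)] by (auto simp: B_def)
    then show "J \<in> set (blocks ns w ws)" using j(1) by (auto simp: pre)
  qed (use \<open>set (blocks ns w ws) \<subseteq> _\<close> in blast)
  ultimately show ?thesis
    using w ws by (cases rule: wiring_cases[OF w]) (simp_all only: wiring_simps simp_thms)
qed

section \<open>The category \<open>!C\<close>\<close>

lemma bang_sel [simp]:
  "Obj (bang X C) = lists (Obj C)" "Dom (bang X C) = Src" "Cod (bang X C) = Tgt"
  "Src (Ide (bang X C) xs) = xs" "Tgt (Ide (bang X C) xs) = xs"
  "Wir (Ide (bang X C) xs) = [0..<length xs]" "Lab (Ide (bang X C) xs) = map (Ide C) xs"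
  "Src (k \<cdot>\<^bsub>bang X C\<^esub> h) = Src h" "Tgt (k \<cdot>\<^bsub>bang X C\<^esub> h) = Tgt k"
  "Wir (k \<cdot>\<^bsub>bang X C\<^esub> h) = map (\<lambda>j. Wir h ! (Wir k ! j)) [0..<length (Tgt k)]"
  "Lab (k \<cdot>\<^bsub>bang X C\<^esub> h) = map (\<lambda>j. Lab k ! j \<cdot>\<^bsub>C\<^esub> Lab h ! (Wir k ! j)) [0..<length (Tgt k)]"
  by (simp_all add: bang_def)

lemma Hom_bang_iff:
  "h \<in> Hom (bang X C) Cs Ds \<longleftrightarrow> Src h = Cs \<and> Tgt h = Ds \<and> Cs \<in> lists (Obj C) \<and> Ds \<in> lists (Obj C) \<and>
    length (Wir h) = length Ds \<and> length (Lab h) = length Ds \<and> wiring X (length Cs) (Wir h) \<and>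
    (\<forall>j < length Ds. Lab h ! j \<in> Hom C (Cs ! (Wir h ! j)) (Ds ! j))"
  by (auto simp: Hom_def bang_def)

lemma bang_eqI:
  assumes "Src h = Src k" "Tgt h = Tgt k" "length (Wir h) = length (Wir k)" "length (Lab h) = length (Lab k)"
    "\<And>j. j < length (Wir k) \<Longrightarrow> Wir h ! j = Wir k ! j"
    "\<And>j. j < length (Lab k) \<Longrightarrow> Lab h ! j = Lab k ! j"
  shows "h = (k :: ('o, 'a) barr)"
  using assms by (intro barr.equality nth_equalityI) auto

lemma Hom_bangD:
  assumes "h \<in> Hom (bang X C) Cs Ds"
  shows "Src h = Cs" "Tgt h = Ds" "length (Wir h) = length Ds" "length (Lab h) = length Ds"
    "j < length Ds \<Longrightarrow> Wir h ! j < length Cs"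
    "j < length Ds \<Longrightarrow> Lab h ! j \<in> Hom C (Cs ! (Wir h ! j)) (Ds ! j)"
  using assms wiring_less[of X "length Cs" "Wir h" j] by (auto simp: Hom_bang_iff)

lemma bang_hom_eqI:
  assumes "h \<in> Hom (bang X C) Cs Ds" "k \<in> Hom (bang X C) Cs Ds"
    and "\<And>j. j < length Ds \<Longrightarrow> Wir h ! j = Wir k ! j" "\<And>j. j < length Ds \<Longrightarrow> Lab h ! j = Lab k ! j"
  shows "h = k"
  using assms by (intro bang_eqI) (auto simp: Hom_bangD)

lemma lists_nth: "xs \<in> lists A \<Longrightarrow> i < length xs \<Longrightarrow> xs ! i \<in> A"
  by auto

lemma category_bang:
  assumes X: "wirable X" and C: "category C"
  shows "category (bang X C)"
proof -
  interpret category C by (rule C)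
  let ?B = "bang X C"
  show ?thesis
  proof
    fix h assume "h \<in> Arr ?B"
    then show "Dom ?B h \<in> Obj ?B" "Cod ?B h \<in> Obj ?B" by (auto simp: bang_def)
  next
    fix Cs assume "Cs \<in> Obj ?B"
    then show "Ide ?B Cs \<in> Hom ?B Cs Cs"
      using Ide_in wiring_upt[OF X] by (auto simp: Hom_bang_iff)
  next
    fix h k Cs Ds Es assume h: "h \<in> Hom ?B Cs Ds" and k: "k \<in> Hom ?B Ds Es"
    have "map (\<lambda>j. Wir h ! (Wir k ! j)) [0..<length Es] = map ((!) (Wir h)) (Wir k)"
      using k by (intro nth_equalityI) (auto simp: Hom_bang_iff)
    then have "wiring X (length Cs) (map (\<lambda>j. Wir h ! (Wir k ! j)) [0..<length Es])"
      using wiring_comp[of X "length Cs" "Wir h" "Wir k"] h k by (simp add: Hom_bang_iff)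
    then show "k \<cdot>\<^bsub>?B\<^esub> h \<in> Hom ?B Cs Es"
      using h k wiring_less[of X "length Ds" "Wir k"] by (auto simp: Hom_bang_iff intro!: Cmp_in)
  next
    fix h Cs Ds assume h: "h \<in> Hom ?B Cs Ds"
    then show "h \<cdot>\<^bsub>?B\<^esub> Ide ?B Cs = h" "Ide ?B Ds \<cdot>\<^bsub>?B\<^esub> h = h"
      using wiring_less[of X "length Cs" "Wir h"]
      by (auto simp: Hom_bang_iff intro!: bang_eqI Cmp_Ide Ide_Cmp)
  next
    fix f g h Cs Ds Es Fs
    assume f: "f \<in> Hom ?B Cs Ds" and g: "g \<in> Hom ?B Ds Es" and h: "h \<in> Hom ?B Es Fs"
    note D = Hom_bangD[OF f] Hom_bangD[OF g] Hom_bangD[OF h]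
    show "h \<cdot>\<^bsub>?B\<^esub> g \<cdot>\<^bsub>?B\<^esub> f = h \<cdot>\<^bsub>?B\<^esub> (g \<cdot>\<^bsub>?B\<^esub> f)"
      by (rule bang_eqI) (auto simp: D Cmp_assoc[OF Hom_bangD(6)[OF f] Hom_bangD(6)[OF g] Hom_bangD(6)[OF h]])
  qed
qed

lemma is_functor_bang_map:
  assumes X: "wirable X" and F: "is_functor C D F"
  shows "is_functor (bang X C) (bang X D) (bang_map F)"
proof -
  interpret F: is_functor C D F by (rule F)
  interpret C: category "bang X C" by (rule category_bang[OF X F.dom.category_axioms])
  interpret D: category "bang X D" by (rule category_bang[OF X F.cod.category_axioms])
  have less: "Wir h ! j < length (Src h)" if "wiring X (length (Src h)) (Wir h)" "length (Wir h) = length (Tgt h)"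
    "j < length (Tgt h)" for h :: "('a, 'b) barr" and j
    using wiring_less[OF that(1)] that by simp
  show ?thesis
  proof
    show "FO (bang_map F) Cs \<in> Obj (bang X D)" if "Cs \<in> Obj (bang X C)" for Cs
      using that F.FO_in by (auto simp: bang_map_def)
    show "FA (bang_map F) h \<in> Hom (bang X D) (FO (bang_map F) Cs) (FO (bang_map F) Ds)"
      if "h \<in> Hom (bang X C) Cs Ds" for h Cs Ds
      using that F.FO_in less[of h] by (auto simp: Hom_bang_iff bang_map_def intro!: F.FA_in)
    show "FA (bang_map F) (Ide (bang X C) Cs) = Ide (bang X D) (FO (bang_map F) Cs)"
      if "Cs \<in> Obj (bang X C)" for Cs
      using that F.FA_Ide by (intro bang_eqI) (auto simp: bang_map_def)
    show "FA (bang_map F) (k \<cdot>\<^bsub>bang X C\<^esub> h) = FA (bang_map F) k \<cdot>\<^bsub>bang X D\<^esub> FA (bang_map F) h"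
      if "h \<in> Hom (bang X C) Cs Ds" "k \<in> Hom (bang X C) Ds Es" for h k Cs Ds Es
      by (intro bang_eqI)
        (auto simp: bang_map_def Hom_bangD[OF that(1)] Hom_bangD[OF that(2)]
          F.FA_Cmp[OF Hom_bangD(6)[OF that(1)] Hom_bangD(6)[OF that(2)]])
  qed
qed

lemma bang_map_fcomp: "bang_map (G \<odot> F) = bang_map G \<odot> bang_map F"
  by (simp add: bang_map_def fcomp_def comp_def)

lemma is_functor_eta_bang:
  assumes X: "wirable X" and C: "category C"
  shows "is_functor C (bang X C) (eta_bang C)"
proof -
  interpret category C by (rule C)
  interpret B: category "bang X C" by (rule category_bang[OF X C])
  show ?thesis
  proof
    show "FA (eta_bang C) f \<in> Hom (bang X C) (FO (eta_bang C) x) (FO (eta_bang C) y)"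
      if "f \<in> Hom C x y" for f x y
      using that Hom_Obj[OF C that] wiring_upt[OF X, of 1] by (auto simp: Hom_bang_iff eta_bang_def Hom_def[of C])
  qed (use Ide_in Cmp_in in \<open>auto intro!: bang_eqI simp: eta_bang_def Hom_def[of C]\<close>)
qed

lemma mu_bang_sel:
  assumes "length (Wir h) = length (Tgt h)" "length (Lab h) = length (Tgt h)"
  shows "Src (FA mu_bang h) = concat (Src h)" "Tgt (FA mu_bang h) = concat (Tgt h)"
    "Wir (FA mu_bang h) = blocks (map length (Src h)) (Wir h) (map Wir (Lab h))"
    "Lab (FA mu_bang h) = concat (map Lab (Lab h))"
proof -
  have "map (\<lambda>j. map (\<lambda>p. length (concat (take (Wir h ! j) (Src h))) + p) (Wir (Lab h ! j))) [0..<length (Tgt h)] =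
      map (\<lambda>j. map (\<lambda>p. off (map length (Src h)) (Wir h ! j) + p) (map Wir (Lab h) ! j)) [0..<length (Wir h)]"
    using assms by (intro nth_equalityI) (simp_all add: off_def length_concat take_map)
  then show "Wir (FA mu_bang h) = blocks (map length (Src h)) (Wir h) (map Wir (Lab h))"
    by (simp add: mu_bang_def blocks_def)
qed (simp_all add: mu_bang_def)

lemma concat_position:
  assumes "J < length (concat xss)" "ns = map length xss"
  obtains i p where "i < length xss" "p < length (xss ! i)" "J = off ns i + p"
proof -
  have "J < off ns (length ns)" using assms by (simp add: length_concat off_def)
  from off_cases[OF this order_refl] obtain i p where "i < length ns" "p < ns ! i" "J = off ns i + p" .
  then show ?thesis using that assms(2) by simp
qed

lemma concat_lists: "xss \<in> lists (lists A) \<Longrightarrow> concat xss \<in> lists A"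
  by (auto simp: in_lists_conv_set)

text \<open>The coordinates of flattening that all later computations use: position \<open>p\<close> of block \<open>j\<close> of the
target.\<close>

lemma mu_bang_nth:
  assumes h: "h \<in> Hom (bang X (bang X C)) Css Dss" and j: "j < length Dss" "p < length (Dss ! j)"
  shows "Wir (FA mu_bang h) ! (off (map length Dss) j + p) =
      off (map length Css) (Wir h ! j) + Wir (Lab h ! j) ! p"
    and "Lab (FA mu_bang h) ! (off (map length Dss) j + p) = Lab (Lab h ! j) ! p"
proof -
  note D = Hom_bangD[OF h]
  have len: "length (Wir (Lab h ! j)) = length (Dss ! j) \<and> length (Lab (Lab h ! j)) = length (Dss ! j)"
    if "j < length Dss" for j
    using Hom_bangD(3,4)[OF D(6)[OF that]] by simp
  have ms: "map length Dss = map length (map Wir (Lab h))" "map length Dss = map length (map Lab (Lab h))"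
    by (rule nth_equalityI; simp add: D len)+
  show "Wir (FA mu_bang h) ! (off (map length Dss) j + p) =
      off (map length Css) (Wir h ! j) + Wir (Lab h ! j) ! p"
    using nth_blocks[OF _ _ _ ms(1), of "Wir h" j p "map length Css"] D j len by (simp add: mu_bang_sel)
  show "Lab (FA mu_bang h) ! (off (map length Dss) j + p) = Lab (Lab h ! j) ! p"
    using nth_concat_off[OF _ _ ms(2), of j p] D j len by (simp add: mu_bang_sel)
qed

lemma mu_bang_in:
  assumes h: "h \<in> Hom (bang X (bang X C)) Css Dss"
  shows "FA mu_bang h \<in> Hom (bang X C) (concat Css) (concat Dss)"
proof -
  note D = Hom_bangD[OF h]
  have lists: "Css \<in> lists (lists (Obj C))" "Dss \<in> lists (lists (Obj C))"
    using h by (simp_all add: Hom_bang_iff)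
  have len: "length (Wir (Lab h ! j)) = length (Dss ! j) \<and> length (Lab (Lab h ! j)) = length (Dss ! j)"
    if "j < length Dss" for j
    using Hom_bangD(3,4)[OF D(6)[OF that]] by simp
  have ms: "map length (map Wir (Lab h)) = map length Dss" "map length (map Lab (Lab h)) = map length Dss"
    by (rule nth_equalityI; simp add: D len)+
  have "wiring X (sum_list (map length Css)) (blocks (map length Css) (Wir h) (map Wir (Lab h)))"
  proof (rule wiring_blocks)
    show "wiring X (length (map length Css)) (Wir h)" using h by (simp add: Hom_bang_iff)
    show "wiring X (map length Css ! (Wir h ! j)) (map Wir (Lab h) ! j)" if "j < length (Wir h)" for j
      using that D(6)[of j] D(1-5) by (simp add: Hom_bang_iff)
  qed
  moreover have "Lab (FA mu_bang h) ! J \<in> Hom C (concat Css ! (Wir (FA mu_bang h) ! J)) (concat Dss ! J)"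
    if J: "J < length (concat Dss)" for J
  proof -
    obtain j p where jp: "j < length Dss" "p < length (Dss ! j)" "J = off (map length Dss) j + p"
      using concat_position[OF J refl] .
    note L = D(6)[OF jp(1)]
    show ?thesis
      using Hom_bangD(5,6)[OF L jp(2)] D(5)[OF jp(1)] jp(1,2)
      by (simp add: jp(3) mu_bang_nth[OF h jp(1,2)] nth_concat_off)
  qed
  moreover have "length (Wir (FA mu_bang h)) = length (concat Dss)" "length (Lab (FA mu_bang h)) = length (concat Dss)"
    using ms by (simp_all add: mu_bang_sel D length_blocks length_concat)
  ultimately show ?thesis
    using concat_lists[OF lists(1)] concat_lists[OF lists(2)] D(1-4)
    unfolding Hom_bang_iff[of "FA mu_bang h"] by (simp add: mu_bang_sel length_concat)
qed

lemma is_functor_mu_bang: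
  assumes X: "wirable X" and C: "category C"
  shows "is_functor (bang X (bang X C)) (bang X C) mu_bang"
proof -
  interpret category C by (rule C)
  have B: "category (bang X C)" by (rule category_bang[OF X C])
  interpret B: category "bang X C" by (rule B)
  interpret BB: category "bang X (bang X C)" by (rule category_bang[OF X B])
  have FO: "FO mu_bang = concat" by (simp add: mu_bang_def)
  show ?thesis
  proof (unfold_locales, unfold FO)
    show "concat Css \<in> Obj (bang X C)" if "Css \<in> Obj (bang X (bang X C))" for Css
      using that concat_lists by simp
    show "FA mu_bang h \<in> Hom (bang X C) (concat Css) (concat Dss)"
      if "h \<in> Hom (bang X (bang X C)) Css Dss" for h Css Dss
      by (rule mu_bang_in[OF that])
  next
    fix Css assume Css: "Css \<in> Obj (bang X (bang X C))"
    then have "concat Css \<in> Obj (bang X C)" using concat_lists by simp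
    note I = BB.Ide_in[OF Css] and I' = B.Ide_in[OF this]
    show "FA mu_bang (Ide (bang X (bang X C)) Css) = Ide (bang X C) (concat Css)"
    proof (rule bang_hom_eqI[OF mu_bang_in[OF I] I'])
      fix J assume J: "J < length (concat Css)"
      obtain j p where jp: "j < length Css" "p < length (Css ! j)" "J = off (map length Css) j + p"
        using concat_position[OF J refl] .
      show "Wir (FA mu_bang (Ide (bang X (bang X C)) Css)) ! J = Wir (Ide (bang X C) (concat Css)) ! J"
        "Lab (FA mu_bang (Ide (bang X (bang X C)) Css)) ! J = Lab (Ide (bang X C) (concat Css)) ! J"
        using jp(1,2) J by (simp_all add: jp(3) mu_bang_nth[OF I jp(1,2)] nth_concat_off)
    qed
  next
    fix h k Css Dss Ess
    assume h: "h \<in> Hom (bang X (bang X C)) Css Dss" and k: "k \<in> Hom (bang X (bang X C)) Dss Ess"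
    note kh = BB.Cmp_in[OF h k]
    show "FA mu_bang (k \<cdot>\<^bsub>bang X (bang X C)\<^esub> h) = FA mu_bang k \<cdot>\<^bsub>bang X C\<^esub> FA mu_bang h"
    proof (rule bang_hom_eqI[OF mu_bang_in[OF kh] B.Cmp_in[OF mu_bang_in[OF h] mu_bang_in[OF k]]])
      fix J assume J: "J < length (concat Ess)"
      obtain j p where jp: "j < length Ess" "p < length (Ess ! j)" "J = off (map length Ess) j + p"
        using concat_position[OF J refl] .
      \<comment> \<open>\<open>(i, q)\<close> is the position of the middle object that feeds position \<open>(j, p)\<close> of the target\<close>
      define i q where "i = Wir k ! j" and "q = Wir (Lab k ! j) ! p"
      have iq: "i < length Dss" "q < length (Dss ! i)"
        using Hom_bangD(5)[OF k jp(1)] Hom_bangD(5)[OF Hom_bangD(6)[OF k jp(1)] jp(2)]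
        by (simp_all add: i_def q_def)
      have W: "Wir (FA mu_bang k) ! J = off (map length Dss) i + q"
        by (simp add: jp(3) mu_bang_nth[OF k jp(1,2)] i_def q_def)
      have Tgt: "Tgt (FA mu_bang k) = concat Ess" "Tgt k = Ess" "Tgt (Lab k ! j) = Ess ! j"
        using Hom_bangD[OF mu_bang_in[OF k]] Hom_bangD[OF k] Hom_bangD(2)[OF Hom_bangD(6)[OF k jp(1)]] by auto
      show "Wir (FA mu_bang (k \<cdot>\<^bsub>bang X (bang X C)\<^esub> h)) ! J =
          Wir (FA mu_bang k \<cdot>\<^bsub>bang X C\<^esub> FA mu_bang h) ! J"
        using J W jp Tgt mu_bang_nth(1)[OF h iq] by (simp add: mu_bang_nth(1)[OF kh jp(1,2)] i_def q_def)
      show "Lab (FA mu_bang (k \<cdot>\<^bsub>bang X (bang X C)\<^esub> h)) ! J =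
          Lab (FA mu_bang k \<cdot>\<^bsub>bang X C\<^esub> FA mu_bang h) ! J"
        using J W jp Tgt mu_bang_nth(2)[OF h iq] mu_bang_nth(2)[OF k jp(1,2)]
        by (simp add: mu_bang_nth(2)[OF kh jp(1,2)] i_def q_def)
    qed
  qed
qed

section \<open>Labels and wirings of morphisms of \<open>!C\<close>\<close>

lemma pow_sel [simp]:
  "Obj (pow C n) = {xs. length xs = n \<and> set xs \<subseteq> Obj C}" "Ide (pow C n) = map (Ide C)"
  by (simp_all add: pow_def)

lemma Hom_pow_iff:
  "fs \<in> Hom (pow C n) Ds Es \<longleftrightarrow> length fs = n \<and> length Ds = n \<and> length Es = n \<and>
    (\<forall>i < n. fs ! i \<in> Hom C (Ds ! i) (Es ! i))"
  by (auto simp: Hom_def pow_def list_eq_iff_nth_eq set_conv_nth subset_iff)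

lemma Hom_pow_lists:
  assumes "category C" "fs \<in> Hom (pow C n) Ds Es"
  shows "Ds \<in> lists (Obj C)" "Es \<in> lists (Obj C)" "length fs = n" "length Ds = n" "length Es = n"
  using assms Hom_Obj[OF assms(1)] by (fastforce simp: Hom_pow_iff in_set_conv_nth)+

lemma par_sel [simp]:
  "Wir (par C fs) = [0..<length fs]" "Lab (par C fs) = fs"
  "Src (par C fs) = map (Dom C) fs" "Tgt (par C fs) = map (Cod C) fs"
  by (simp_all add: par_def)

lemma rewire_sel [simp]:
  "Src (rewire C w Ds) = Ds" "Tgt (rewire C w Ds) = map ((!) Ds) w" "Wir (rewire C w Ds) = w"
  "Lab (rewire C w Ds) = map (\<lambda>j. Ide C (Ds ! j)) w"
  by (simp_all add: rewire_def)

lemma par_in: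
  assumes "wirable X" "category C" "fs \<in> Hom (pow C n) Ds Es"
  shows "par C fs \<in> Hom (bang X C) Ds Es"
  using Hom_pow_lists[OF assms(2,3)] wiring_upt[OF assms(1)] assms(3)
  by (auto simp: Hom_bang_iff Hom_pow_iff Hom_def[of C] list_eq_iff_nth_eq)

lemma par_Ide:
  assumes "category C" "Ds \<in> lists (Obj C)"
  shows "par C (map (Ide C) Ds) = Ide (bang X C) Ds"
proof -
  have "Dom C (Ide C x) = x \<and> Cod C (Ide C x) = x" if "x \<in> set Ds" for x
    using category.Ide_in[OF assms(1), of x] that assms(2) by (auto simp: Hom_def[of C])
  then show ?thesis
    by (intro bang_eqI) (auto intro!: map_idI)
qed

lemma rewire_in:
  assumes "category C" "Ds \<in> lists (Obj C)" "wiring X (length Ds) w"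
  shows "rewire C w Ds \<in> Hom (bang X C) Ds (map ((!) Ds) w)"
proof -
  have "Ds ! (w ! j) \<in> Obj C" if "j < length w" for j
    using wiring_less[OF assms(3) that] assms(2) by (rule lists_nth[rotated])
  then show ?thesis
    using assms by (auto simp: Hom_bang_iff in_set_conv_nth intro!: category.Ide_in)
qed

lemma rewire_upt:
  assumes "n = length Ds"
  shows "rewire C [0..<n] Ds = Ide (bang X C) Ds"
  using assms by (intro bang_eqI) (auto simp: map_nth)

lemma rewire_rewire:
  assumes C: "category C" and Ds: "Ds \<in> lists (Obj C)" and f: "wiring X (length Ds) f" and k: "wiring X (length f) k"
  shows "rewire C k (map ((!) Ds) f) \<cdot>\<^bsub>bang X C\<^esub> rewire C f Ds = rewire C (map ((!) f) k) Ds"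
proof (rule bang_eqI)
  fix j assume "j < length (Lab (rewire C (map ((!) f) k) Ds))"
  then have j: "j < length k" by simp
  then have "k ! j < length f" using wiring_less[OF k] by simp
  then have "Ds ! (f ! (k ! j)) \<in> Obj C" using wiring_less[OF f] Ds by auto
  from category.Ide_Cmp[OF C category.Ide_in[OF C this]]
  show "Lab (rewire C k (map ((!) Ds) f) \<cdot>\<^bsub>bang X C\<^esub> rewire C f Ds) ! j = Lab (rewire C (map ((!) f) k) Ds) ! j"
    using j \<open>k ! j < length f\<close> by simp
qed (use wiring_less[OF k] wiring_set_less[OF k] in auto)

text \<open>Naturality of the combinators with respect to morphisms of \<open>C\<close>: labels can be moved past a
wiring.\<close>

lemma rewire_par:
  assumes C: "category C" and fs: "fs \<in> Hom (pow C n) Ds Es" and w: "wiring X n w"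
  shows "rewire C w Es \<cdot>\<^bsub>bang X C\<^esub> par C fs = par C (map ((!) fs) w) \<cdot>\<^bsub>bang X C\<^esub> rewire C w Ds"
proof -
  have hom: "fs ! (w ! j) \<in> Hom C (Ds ! (w ! j)) (Es ! (w ! j)) \<and> w ! j < n" if "j < length w" for j
    using fs wiring_less[OF w that] by (simp add: Hom_pow_iff)
  have len: "length fs = n" "length Ds = n" "length Es = n" using Hom_pow_lists[OF C fs] by auto
  have DC: "Cod C (fs ! i) = Es ! i" "Dom C (fs ! i) = Ds ! i" if "i < n" for i
    using fs that by (auto simp: Hom_pow_iff Hom_def[of C])
  have wn: "i < n" if "i \<in> set w" for i using wiring_set_less[OF w that] .
  have "Ide C (Es ! (w ! j)) \<cdot>\<^bsub>C\<^esub> fs ! (w ! j) = fs ! (w ! j) \<cdot>\<^bsub>C\<^esub> Ide C (Ds ! (w ! j))" if "j < length w" for j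
    using category.Ide_Cmp[OF C] category.Cmp_Ide[OF C] hom[OF that] by metis
  moreover have "map (Dom C) fs = Ds"
    using DC len by (intro nth_equalityI) auto
  ultimately show ?thesis
    using hom len wn by (intro bang_eqI) (simp_all add: DC)
qed

text \<open>Composing with labels and then with any morphism \<open>h\<close> of \<open>!C\<close> can be done wiring first.\<close>

lemma bang_par_rewire:
  assumes C: "category C" and h: "h \<in> Hom (bang X C) Ds Es" and fs: "fs \<in> Hom (pow C (length Ds)) Bs Ds"
  shows "h \<cdot>\<^bsub>bang X C\<^esub> par C fs =
    par C (map (\<lambda>j. Lab h ! j \<cdot>\<^bsub>C\<^esub> fs ! (Wir h ! j)) [0..<length Es]) \<cdot>\<^bsub>bang X C\<^esub> rewire C (Wir h) Bs"
proof -
  note D = Hom_bangD[OF h]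
  have fs_hom: "fs ! (Wir h ! j) \<in> Hom C (Bs ! (Wir h ! j)) (Ds ! (Wir h ! j))" if "j < length Es" for j
    using fs D(5)[OF that] by (simp add: Hom_pow_iff)
  have c: "Lab h ! j \<cdot>\<^bsub>C\<^esub> fs ! (Wir h ! j) \<in> Hom C (Bs ! (Wir h ! j)) (Es ! j)" if "j < length Es" for j
    using category.Cmp_in[OF C fs_hom D(6), OF that that] .
  have len: "length fs = length Ds" "length Bs = length Ds" using Hom_pow_lists[OF C fs] by auto
  have "map (Dom C) fs = Bs"
    using fs by (auto simp: Hom_pow_iff Hom_def[of C] list_eq_iff_nth_eq)
  moreover have "Tgt h = map (Cod C) (map (\<lambda>j. Lab h ! j \<cdot>\<^bsub>C\<^esub> fs ! (Wir h ! j)) [0..<length Es])"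
    using c D(2) by (intro nth_equalityI) (auto simp: Hom_def)
  moreover have "Lab h ! j \<cdot>\<^bsub>C\<^esub> fs ! (Wir h ! j) \<cdot>\<^bsub>C\<^esub> Ide C (Bs ! (Wir h ! j)) =
      Lab h ! j \<cdot>\<^bsub>C\<^esub> fs ! (Wir h ! j)" if "j < length Es" for j
    using category.Cmp_Ide[OF C c[OF that]] .
  ultimately show ?thesis
    using D(1-5) len by (intro bang_eqI) simp_all
qed

section \<open>The Yoneda embedding\<close>

lemma At_yoneda [simp]: "At (FO (yoneda C) c) d = Hom C d c"
  by (simp add: yoneda_def Let_def)

lemma Act_yoneda: "g \<in> Hom C d d' \<Longrightarrow> h \<in> Hom C d' c \<Longrightarrow> Act (FO (yoneda C) c) g h = h \<cdot>\<^bsub>C\<^esub> g"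
  by (simp add: yoneda_def Let_def Hom_def)

lemma NAt_yoneda:
  "\<lbrakk>f \<in> Hom C c c'; d \<in> Obj C; h \<in> Hom C d c\<rbrakk> \<Longrightarrow> NAt (FA (yoneda C) f) d h = f \<cdot>\<^bsub>C\<^esub> h"
  by (simp add: yoneda_def Let_def Hom_def)

lemma is_functor_yoneda:
  assumes C: "category C" shows "is_functor C (psh C) (yoneda C)"
proof -
  interpret category C by (rule C)
  show ?thesis
  proof (rule psh_functorI[OF C C])
    fix c assume c: "c \<in> Obj C"
    show "is_presheaf C (FO (yoneda C) c)"
    proof
      fix f d d' assume f: "f \<in> Hom C d d'"
      then show "Act (FO (yoneda C) c) f \<in> At (FO (yoneda C) c) d' \<rightarrow>\<^sub>E At (FO (yoneda C) c) d"
        using Cmp_in[OF f] Hom_Obj[OF C f] by (auto simp: yoneda_def Let_def Hom_def[of C])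
    next
      fix d h assume "d \<in> Obj C" "h \<in> At (FO (yoneda C) c) d"
      then show "Act (FO (yoneda C) c) (Ide C d) h = h"
        using Act_yoneda[OF Ide_in] Cmp_Ide by simp
    next
      fix f g a b d h assume f: "f \<in> Hom C a b" and g: "g \<in> Hom C b d" and "h \<in> At (FO (yoneda C) c) d"
      then have h: "h \<in> Hom C d c" by simp
      show "Act (FO (yoneda C) c) (g \<cdot>\<^bsub>C\<^esub> f) h = Act (FO (yoneda C) c) f (Act (FO (yoneda C) c) g h)"
        using Act_yoneda[OF Cmp_in[OF f g] h] Act_yoneda[OF g h] Act_yoneda[OF f Cmp_in[OF g h]]
          Cmp_assoc[OF f g h] by simp
    next
      fix d assume "d \<notin> Obj C"
      then show "At (FO (yoneda C) c) d = {}" using Hom_Obj[OF C] by auto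
    qed (simp add: yoneda_def Let_def)
  next
    fix h c c' d assume h: "h \<in> Hom C c c'" and d: "d \<in> Obj C"
    then show "NAt (FA (yoneda C) h) d \<in> At (FO (yoneda C) c) d \<rightarrow>\<^sub>E At (FO (yoneda C) c') d"
      using Cmp_in[OF _ h] by (auto simp: yoneda_def Let_def Hom_def[of C])
  next
    fix h c c' f d d' x assume h: "h \<in> Hom C c c'" and f: "f \<in> Hom C d d'" and "x \<in> At (FO (yoneda C) c) d'"
    then have x: "x \<in> Hom C d' c" by simp
    note d = Hom_Obj[OF C f]
    show "NAt (FA (yoneda C) h) d (Act (FO (yoneda C) c) f x) =
        Act (FO (yoneda C) c') f (NAt (FA (yoneda C) h) d' x)"
      using Act_yoneda[OF f x] NAt_yoneda[OF h d(1) Cmp_in[OF f x]] NAt_yoneda[OF h d(2) x]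
        Act_yoneda[OF f Cmp_in[OF x h]] Cmp_assoc[OF f x h] by simp
  next
    fix c d x assume "c \<in> Obj C" "d \<in> Obj C" "x \<in> At (FO (yoneda C) c) d"
    then show "NAt (FA (yoneda C) (Ide C c)) d x = x"
      using NAt_yoneda[OF Ide_in] Ide_Cmp by simp
  next
    fix h h' c c' c'' d x
    assume h: "h \<in> Hom C c c'" and h': "h' \<in> Hom C c' c''" and d: "d \<in> Obj C" and "x \<in> At (FO (yoneda C) c) d"
    then have x: "x \<in> Hom C d c" by simp
    show "NAt (FA (yoneda C) (h' \<cdot>\<^bsub>C\<^esub> h)) d x = NAt (FA (yoneda C) h') d (NAt (FA (yoneda C) h) d x)"
      using NAt_yoneda[OF Cmp_in[OF h h'] d x] NAt_yoneda[OF h d x] NAt_yoneda[OF h' d Cmp_in[OF x h]]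
        Cmp_assoc[OF x h h'] by simp
  qed (auto simp: yoneda_def Let_def)
qed

section \<open>Coends over tuples of objects\<close>

definition tup_at :: "('o, 'a, 'x) presheaf list \<Rightarrow> 'o list \<Rightarrow> 'x list set" where
  "tup_at Fs Ds = {xs. length xs = length Fs \<and> (\<forall>i < length Fs. xs ! i \<in> At (Fs ! i) (Ds ! i))}"

definition tup_act :: "('o, 'a, 'x) presheaf list \<Rightarrow> 'a list \<Rightarrow> 'x list \<Rightarrow> 'x list" where
  "tup_act Fs fs xs = map (\<lambda>i. Act (Fs ! i) (fs ! i) (xs ! i)) [0..<length Fs]"

text \<open>The integrand \<open>F\<^sub>1D\<^sub>1 \<times> \<dots> \<times> F\<^sub>nD\<^sub>n \<times> G(D\<^sub>1, \<dots>, D\<^sub>n)\<close>.  The integrand of \<open>\<lambda>\<close> is the case where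
\<open>G\<close> is a hom-set of \<open>!C\<close>; the co-Yoneda reduction produces the same shape for other \<open>G\<close>.\<close>

definition tup_bif :: "('o, 'a, 'x) presheaf list \<Rightarrow> ('o list \<Rightarrow> 'y set) \<Rightarrow> ('a list \<Rightarrow> 'y \<Rightarrow> 'y)
    \<Rightarrow> ('o list, 'a list, 'x list \<times> 'y) bif" where
  "tup_bif Fs G GA = \<lparr>BO = (\<lambda>Ds' Ds. tup_at Fs Ds' \<times> G Ds), BA = (\<lambda>fs gs (xs, y). (tup_act Fs fs xs, GA gs y))\<rparr>"

lemma lam_bif_eq: "lam_bif X C Fs Cs = tup_bif Fs (Hom (bang X C) Cs) (\<lambda>gs u. par C gs \<cdot>\<^bsub>bang X C\<^esub> u)"
  by (simp add: lam_bif_def tup_bif_def tup_at_def tup_act_def)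

lemma tup_atD: "xs \<in> tup_at Fs Ds \<Longrightarrow> length xs = length Fs"
  "xs \<in> tup_at Fs Ds \<Longrightarrow> i < length Fs \<Longrightarrow> xs ! i \<in> At (Fs ! i) (Ds ! i)"
  by (simp_all add: tup_at_def)

lemma tup_act_in:
  assumes "\<And>i. i < length Fs \<Longrightarrow> is_presheaf C (Fs ! i)" "fs \<in> Hom (pow C (length Fs)) Ds Es" "xs \<in> tup_at Fs Es"
  shows "tup_act Fs fs xs \<in> tup_at Fs Ds"
  using assms by (auto simp: tup_at_def tup_act_def Hom_pow_iff intro: presheaf_Act_in)

lemma tup_act_Ide:
  assumes "\<And>i. i < length Fs \<Longrightarrow> is_presheaf C (Fs ! i)" "Ds \<in> lists (Obj C)" "length Ds = length Fs"
    "xs \<in> tup_at Fs Ds"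
  shows "tup_act Fs (map (Ide C) Ds) xs = xs"
  using assms by (intro nth_equalityI) (auto simp: tup_at_def tup_act_def intro!: is_presheaf.Act_Ide)

locale tup_coend = category C for C :: "('o, 'a) cat" +
  fixes Fs :: "('o, 'a, 'x) presheaf list" and n :: nat
    and G :: "'o list \<Rightarrow> 'y set" and GA :: "'a list \<Rightarrow> 'y \<Rightarrow> 'y"
  assumes presheaf: "i < n \<Longrightarrow> is_presheaf C (Fs ! i)"
    and length_Fs: "length Fs = n"
    and G_Ide: "\<lbrakk>Ds \<in> lists (Obj C); length Ds = n; y \<in> G Ds\<rbrakk> \<Longrightarrow> GA (map (Ide C) Ds) y = y"
begin

lemma bif_sel [simp]:
  "BO (tup_bif Fs G GA) Ds' Ds = tup_at Fs Ds' \<times> G Ds"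
  "BA (tup_bif Fs G GA) fs gs (xs, y) = (tup_act Fs fs xs, GA gs y)"
  by (simp_all add: tup_bif_def)

lemma gens_iff [simp]:
  "(Ds, xs, y) \<in> gens (pow C n) (tup_bif Fs G GA) \<longleftrightarrow>
    Ds \<in> lists (Obj C) \<and> length Ds = n \<and> xs \<in> tup_at Fs Ds \<and> y \<in> G Ds"
  by (auto simp: gens_def)

lemma act_in: "\<lbrakk>fs \<in> Hom (pow C n) Ds Es; xs \<in> tup_at Fs Es\<rbrakk> \<Longrightarrow> tup_act Fs fs xs \<in> tup_at Fs Ds"
  using tup_act_in[of Fs C fs Ds Es xs] presheaf length_Fs by simp

lemma act_Ide: "\<lbrakk>Ds \<in> lists (Obj C); length Ds = n; xs \<in> tup_at Fs Ds\<rbrakk> \<Longrightarrow> tup_act Fs (map (Ide C) Ds) xs = xs"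
  using tup_act_Ide[of Fs C Ds xs] presheaf length_Fs by simp

lemma cowedgeI:
  assumes "\<And>fs Ds Es xs y. \<lbrakk>fs \<in> Hom (pow C n) Ds Es; Ds \<in> lists (Obj C); Es \<in> lists (Obj C);
      length Ds = n; length Es = n; xs \<in> tup_at Fs Es; y \<in> G Ds\<rbrakk> \<Longrightarrow>
      h (Ds, tup_act Fs fs xs, y) = h (Es, xs, GA fs y)"
  shows "cowedge (pow C n) (tup_bif Fs G GA) h"
  unfolding cowedge_def
proof clarsimp
  fix fs Ds Es xs y assume *: "fs \<in> Hom (pow C n) Ds Es" "xs \<in> tup_at Fs Es" "y \<in> G Ds"
  note ** = Hom_pow_lists[OF category_axioms *(1)]
  show "h (Ds, tup_act Fs fs xs, GA (map (Ide C) Ds) y) = h (Es, tup_act Fs (map (Ide C) Es) xs, GA fs y)"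
    using assms[OF *(1) **(1,2,4,5) *(2,3)] * ** by (simp add: act_Ide G_Ide)
qed

lemma BA_Ide:
  "\<lbrakk>Ds \<in> Obj (pow C n); t \<in> BO (tup_bif Fs G GA) Ds Ds\<rbrakk> \<Longrightarrow>
    BA (tup_bif Fs G GA) (Ide (pow C n) Ds) (Ide (pow C n) Ds) t = t"
  by (cases t) (simp add: act_Ide G_Ide in_lists_conv_set subset_eq)

lemma step:
  assumes "fs \<in> Hom (pow C n) Ds Es" "xs \<in> tup_at Fs Es" "y \<in> G Ds"
  shows "cls (pow C n) (tup_bif Fs G GA) (Ds, tup_act Fs fs xs, y) =
    cls (pow C n) (tup_bif Fs G GA) (Es, xs, GA fs y)"
proof -
  note ** = Hom_pow_lists[OF category_axioms assms(1)]
  have "cls (pow C n) (tup_bif Fs G GA) (Ds, BA (tup_bif Fs G GA) fs (Ide (pow C n) Ds) (xs, y)) =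
      cls (pow C n) (tup_bif Fs G GA) (Es, BA (tup_bif Fs G GA) (Ide (pow C n) Es) fs (xs, y))"
    using cowedge_cls[of "pow C n" "tup_bif Fs G GA"] assms unfolding cowedge_def by force
  then show ?thesis
    using assms ** by (simp add: act_Ide G_Ide)
qed

end

section \<open>The functor \<open>\<lambda>\<close>\<close>

lemma tup_coend_lam:
  assumes X: "wirable X" and C: "category C" and Cs: "Cs \<in> lists (Obj C)"
    and Fs: "Fs \<in> lists {P. is_presheaf C P}"
  shows "tup_coend C Fs (length Fs) (Hom (bang X C) Cs) (\<lambda>gs u. par C gs \<cdot>\<^bsub>bang X C\<^esub> u)"
proof -
  interpret category C by (rule C)
  interpret B: category "bang X C" by (rule category_bang[OF X C])
  show ?thesis
  proof (intro tup_coend.intro category_axioms tup_coend_axioms.intro)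
    show "is_presheaf C (Fs ! i)" if "i < length Fs" for i
      using lists_nth[OF Fs that] by simp
    show "par C (map (Ide C) Ds) \<cdot>\<^bsub>bang X C\<^esub> y = y" if "Ds \<in> lists (Obj C)" "y \<in> Hom (bang X C) Cs Ds" for Ds y
      using that by (simp add: par_Ide[OF C, of _ X] B.Ide_Cmp)
  qed (rule refl)
qed

definition lam_wire :: "combinator set \<Rightarrow> ('o, 'a) cat \<Rightarrow> (('o, 'a, 'x) presheaf, ('o, 'a, 'x) ptrans) barr
    \<Rightarrow> 'o list \<times> 'x list \<times> ('o, 'a) barr \<Rightarrow> 'o list \<times> 'x list \<times> ('o, 'a) barr" where
  "lam_wire X C h = (\<lambda>(Ds, xs, u). (map ((!) Ds) (Wir h),
     map (\<lambda>j. NAt (Lab h ! j) (Ds ! (Wir h ! j)) (xs ! (Wir h ! j))) [0..<length (Wir h)],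
     rewire C (Wir h) Ds \<cdot>\<^bsub>bang X C\<^esub> u))"

lemma lam_tup_in:
  assumes C: "category C" and h: "h \<in> Hom (bang X (psh C)) Fs Gs"
    and Ds: "Ds \<in> lists (Obj C)" "length Ds = length Fs" and xs: "xs \<in> tup_at Fs Ds"
  shows "map (\<lambda>j. NAt (Lab h ! j) (Ds ! (Wir h ! j)) (xs ! (Wir h ! j))) [0..<length (Wir h)]
    \<in> tup_at Gs (map ((!) Ds) (Wir h))"
proof -
  note D = Hom_bangD[OF h]
  have "NAt (Lab h ! j) (Ds ! (Wir h ! j)) (xs ! (Wir h ! j)) \<in> At (Gs ! j) (Ds ! (Wir h ! j))"
    if "j < length Gs" for j
    using D(6)[OF that] ptrans_NAt_in[of C "Lab h ! j" "Ds ! (Wir h ! j)"] tup_atD(2)[OF xs D(5)[OF that]]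
      D(5)[OF that] lists_nth[OF Ds(1)] Ds(2) by (simp add: Hom_psh_iff)
  then show ?thesis using D by (simp add: tup_at_def)
qed

text \<open>On representatives, precomposition with \<open>h\<close> and wiring are strictly functorial and commute.  They
respect slides: for precomposition this is associativity of \<open>!C\<close>, and for wiring a slide of
\<open>fs\<close> in the source becomes, by \<open>rewire_par\<close> and naturality of the labels of \<open>h\<close>, a slide of the
wired \<open>fs\<close> in the target.\<close>

lemma coend_functor_lam:
  fixes C :: "('o, 'a) cat"
  assumes X: "wirable X" and C: "category C"
  shows "coend_functor (bang X (psh C)) (bang X C) (lam X C :: (('o, 'a, 'x) presheaf list, _, _, _) fctr)
    (\<lambda>Fs. pow C (length Fs)) (lam_bif X C) (\<lambda>Fs h (Ds, xs, u). (Ds, xs, u \<cdot>\<^bsub>bang X C\<^esub> h)) (lam_wire X C)"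
    (is "coend_functor _ _ _ _ _ ?m _")
proof -
  interpret category C by (rule C)
  have B: "category (bang X C)" by (rule category_bang[OF X C])
  interpret B: category "bang X C" by (rule B)
  have P: "category (psh C :: (('o, 'a, 'x) presheaf, _) cat)" by (rule category_psh[OF C])
  interpret BP: category "bang X (psh C :: (('o, 'a, 'x) presheaf, _) cat)" by (rule category_bang[OF X P])
  show ?thesis
  proof
    fix Fs :: "('o, 'a, 'x) presheaf list" and g Cs Cs'
    assume "Fs \<in> Obj (bang X (psh C))" and g: "g \<in> Hom (bang X C) Cs Cs'"
    then have Fs: "Fs \<in> lists {P. is_presheaf C P}" by simp
    have Cs: "Cs \<in> lists (Obj C)" "Cs' \<in> lists (Obj C)" using g by (auto simp: Hom_bang_iff)
    interpret T: tup_coend C Fs "length Fs" "Hom (bang X C) Cs" "\<lambda>gs u. par C gs \<cdot>\<^bsub>bang X C\<^esub> u"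
      by (rule tup_coend_lam[OF X C Cs(1) Fs])
    interpret T': tup_coend C Fs "length Fs" "Hom (bang X C) Cs'" "\<lambda>gs u. par C gs \<cdot>\<^bsub>bang X C\<^esub> u"
      by (rule tup_coend_lam[OF X C Cs(2) Fs])
    show "cowedge (pow C (length Fs)) (lam_bif X C Fs Cs') (\<lambda>p. cls (pow C (length Fs)) (lam_bif X C Fs Cs) (?m Fs g p))"
      unfolding lam_bif_eq
    proof (rule T'.cowedgeI, clarsimp simp del: in_lists_conv_set)
      fix fs Ds Es xs u
      assume *: "fs \<in> Hom (pow C (length Fs)) Ds Es" "xs \<in> tup_at Fs Es" "u \<in> Hom (bang X C) Cs' Ds"
      show "cls (pow C (length Fs)) (tup_bif Fs (Hom (bang X C) Cs) (\<lambda>gs u. par C gs \<cdot>\<^bsub>bang X C\<^esub> u))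
             (Ds, tup_act Fs fs xs, u \<cdot>\<^bsub>bang X C\<^esub> g) =
          cls (pow C (length Fs)) (tup_bif Fs (Hom (bang X C) Cs) (\<lambda>gs u. par C gs \<cdot>\<^bsub>bang X C\<^esub> u))
             (Es, xs, par C fs \<cdot>\<^bsub>bang X C\<^esub> u \<cdot>\<^bsub>bang X C\<^esub> g)"
        using T.step[OF *(1,2) B.Cmp_in[OF g *(3)]] B.Cmp_assoc[OF g *(3) par_in[OF X C *(1)]] by simp
    qed
    show "?m Fs g p \<in> gens (pow C (length Fs)) (lam_bif X C Fs Cs)"
      if "p \<in> gens (pow C (length Fs)) (lam_bif X C Fs Cs')" for p
      using that B.Cmp_in[OF g] unfolding lam_bif_eq by (cases p) simp
  next
    fix Fs :: "('o, 'a, 'x) presheaf list" and Cs p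
    assume "Fs \<in> Obj (bang X (psh C))" and Cs: "Cs \<in> Obj (bang X C)" and p: "p \<in> gens (pow C (length Fs)) (lam_bif X C Fs Cs)"
    then have Fs: "Fs \<in> lists {P. is_presheaf C P}" by simp
    interpret T: tup_coend C Fs "length Fs" "Hom (bang X C) Cs" "\<lambda>gs u. par C gs \<cdot>\<^bsub>bang X C\<^esub> u"
      by (rule tup_coend_lam[OF X C _ Fs]) (use Cs in simp)
    obtain Ds xs u where [simp]: "p = (Ds, xs, u)" by (cases p)
    have *: "Ds \<in> lists (Obj C)" "length Ds = length Fs" "xs \<in> tup_at Fs Ds" "u \<in> Hom (bang X C) Cs Ds"
      using p by (simp_all add: lam_bif_eq)
    show "?m Fs (Ide (bang X C) Cs) p = p" using *(4) by (simp add: B.Cmp_Ide)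
    have "NAt (map (Ide (psh C)) Fs ! j) (Ds ! j) (xs ! j) = xs ! j" if "j < length Fs" for j
      using that NAt_Ide_psh[of "Ds ! j" C "xs ! j" "Fs ! j"] lists_nth[OF *(1)] *(2) tup_atD[OF *(3)] by simp
    moreover have "map ((!) Ds) [0..<length Fs] = Ds" using map_nth[of Ds] *(2) by simp
    moreover have "rewire C [0..<length Fs] Ds \<cdot>\<^bsub>bang X C\<^esub> u = u"
      using *(2) rewire_upt[of "length Fs" Ds C X] B.Ide_Cmp[OF *(4)] by simp
    moreover have "map (\<lambda>j. NAt (map (Ide (psh C)) Fs ! j) (Ds ! ([0..<length Fs] ! j)) (xs ! ([0..<length Fs] ! j))) [0..<length Fs] = xs"
      using calculation(1) tup_atD(1)[OF *(3)] by (intro nth_equalityI) simp_all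
    ultimately show "lam_wire X C (Ide (bang X (psh C)) Fs) p = p"
      by (simp add: lam_wire_def)
  next
    fix Fs :: "('o, 'a, 'x) presheaf list" and f g Bs Cs Ds p
    assume "Fs \<in> Obj (bang X (psh C))" and fg: "f \<in> Hom (bang X C) Bs Cs" "g \<in> Hom (bang X C) Cs Ds"
      and p: "p \<in> gens (pow C (length Fs)) (lam_bif X C Fs Ds)"
    then show "?m Fs (g \<cdot>\<^bsub>bang X C\<^esub> f) p = ?m Fs f (?m Fs g p)"
      using B.Cmp_assoc[OF fg] by (cases p) (auto simp: gens_def lam_bif_def)
  next
    fix h and Fs Gs :: "('o, 'a, 'x) presheaf list" and Cs
    assume h: "h \<in> Hom (bang X (psh C)) Fs Gs" and "Cs \<in> Obj (bang X C)"
    then have Fs: "Fs \<in> lists {P. is_presheaf C P}" "Gs \<in> lists {P. is_presheaf C P}"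
      and Cs: "Cs \<in> lists (Obj C)" and w: "wiring X (length Fs) (Wir h)"
      by (simp_all add: Hom_bang_iff)
    note D = Hom_bangD[OF h]
    interpret F: tup_coend C Fs "length Fs" "Hom (bang X C) Cs" "\<lambda>gs u. par C gs \<cdot>\<^bsub>bang X C\<^esub> u"
      by (rule tup_coend_lam[OF X C Cs Fs(1)])
    interpret G: tup_coend C Gs "length Gs" "Hom (bang X C) Cs" "\<lambda>gs u. par C gs \<cdot>\<^bsub>bang X C\<^esub> u"
      by (rule tup_coend_lam[OF X C Cs Fs(2)])
    have rew: "rewire C (Wir h) Ds \<in> Hom (bang X C) Ds (map ((!) Ds) (Wir h))"
      if "Ds \<in> lists (Obj C)" "length Ds = length Fs" for Ds
      using rewire_in[OF C that(1)] w that(2) by simp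
    show "lam_wire X C h p \<in> gens (pow C (length Gs)) (lam_bif X C Gs Cs)"
      if "p \<in> gens (pow C (length Fs)) (lam_bif X C Fs Cs)" for p
    proof -
      obtain Ds xs u where p: "p = (Ds, xs, u)" by (cases p)
      have *: "Ds \<in> lists (Obj C)" "length Ds = length Fs" "xs \<in> tup_at Fs Ds" "u \<in> Hom (bang X C) Cs Ds"
        using that by (simp_all add: lam_bif_eq p)
      have r: "rewire C (Wir h) Ds \<cdot>\<^bsub>bang X C\<^esub> u \<in> Hom (bang X C) Cs (map ((!) Ds) (Wir h))"
        by (rule B.Cmp_in[OF *(4) rew[OF *(1,2)]])
      then have "map ((!) Ds) (Wir h) \<in> lists (Obj C)" by (simp only: Hom_bang_iff)
      then show ?thesis
        using r lam_tup_in[OF C h *(1-3)] D(3)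
        by (simp add: p lam_wire_def lam_bif_eq del: in_lists_conv_set)
    qed
    show "cowedge (pow C (length Fs)) (lam_bif X C Fs Cs) (\<lambda>p. cls (pow C (length Gs)) (lam_bif X C Gs Cs) (lam_wire X C h p))"
      unfolding lam_bif_eq
    proof (rule F.cowedgeI)
      fix fs Ds Es xs u
      assume *: "fs \<in> Hom (pow C (length Fs)) Ds Es" "Ds \<in> lists (Obj C)" "Es \<in> lists (Obj C)"
        "length Ds = length Fs" "length Es = length Fs" "xs \<in> tup_at Fs Es" "u \<in> Hom (bang X C) Cs Ds"
      let ?ys = "map (\<lambda>j. NAt (Lab h ! j) (Es ! (Wir h ! j)) (xs ! (Wir h ! j))) [0..<length (Wir h)]"
      have fsw: "map ((!) fs) (Wir h) \<in> Hom (pow C (length Gs)) (map ((!) Ds) (Wir h)) (map ((!) Es) (Wir h))"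
        using *(1) D by (simp add: Hom_pow_iff)
      have "map (\<lambda>j. NAt (Lab h ! j) (Ds ! (Wir h ! j)) (tup_act Fs fs xs ! (Wir h ! j))) [0..<length (Wir h)] =
          tup_act Gs (map ((!) fs) (Wir h)) ?ys"
      proof (rule nth_equalityI)
        fix j assume "j < length (map (\<lambda>j. NAt (Lab h ! j) (Ds ! (Wir h ! j)) (tup_act Fs fs xs ! (Wir h ! j))) [0..<length (Wir h)])"
        then have j: "j < length Gs" using D by simp
        note L = D(6)[OF j]
        have "fs ! (Wir h ! j) \<in> Hom C (Ds ! (Wir h ! j)) (Es ! (Wir h ! j))"
          using *(1) D(5)[OF j] by (simp add: Hom_pow_iff)
        then have "NAt (Lab h ! j) (Ds ! (Wir h ! j)) (Act (Fs ! (Wir h ! j)) (fs ! (Wir h ! j)) (xs ! (Wir h ! j))) =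
            Act (Gs ! j) (fs ! (Wir h ! j)) (NAt (Lab h ! j) (Es ! (Wir h ! j)) (xs ! (Wir h ! j)))"
          using is_ptrans.natural[of C "Lab h ! j"] L tup_atD(2)[OF *(6) D(5)[OF j]] by (simp add: Hom_psh_iff)
        then show "map (\<lambda>j. NAt (Lab h ! j) (Ds ! (Wir h ! j)) (tup_act Fs fs xs ! (Wir h ! j))) [0..<length (Wir h)] ! j =
            tup_act Gs (map ((!) fs) (Wir h)) ?ys ! j"
          using j D by (simp add: tup_act_def)
      qed (simp add: tup_act_def D)
      moreover have "rewire C (Wir h) Es \<cdot>\<^bsub>bang X C\<^esub> (par C fs \<cdot>\<^bsub>bang X C\<^esub> u) =
          par C (map ((!) fs) (Wir h)) \<cdot>\<^bsub>bang X C\<^esub> (rewire C (Wir h) Ds \<cdot>\<^bsub>bang X C\<^esub> u)"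
        using B.Cmp_assoc[OF *(7) par_in[OF X C *(1)] rew[OF *(3,5)]]
          B.Cmp_assoc[OF *(7) rew[OF *(2,4)] par_in[OF X C fsw]] rewire_par[OF C *(1) w] by simp
      moreover note G.step[OF fsw lam_tup_in[OF C h *(3,5,6)] B.Cmp_in[OF *(7) rew[OF *(2,4)]]]
      ultimately show "cls (pow C (length Gs)) (tup_bif Gs (Hom (bang X C) Cs) (\<lambda>gs u. par C gs \<cdot>\<^bsub>bang X C\<^esub> u))
            (lam_wire X C h (Ds, tup_act Fs fs xs, u)) =
          cls (pow C (length Gs)) (tup_bif Gs (Hom (bang X C) Cs) (\<lambda>gs u. par C gs \<cdot>\<^bsub>bang X C\<^esub> u))
            (lam_wire X C h (Es, xs, par C fs \<cdot>\<^bsub>bang X C\<^esub> u))"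
        by (simp add: lam_wire_def)
    qed
  next
    fix h k and Fs Gs Hs :: "('o, 'a, 'x) presheaf list" and Cs p
    assume h: "h \<in> Hom (bang X (psh C)) Fs Gs" and k: "k \<in> Hom (bang X (psh C)) Gs Hs" and "Cs \<in> Obj (bang X C)"
      and p: "p \<in> gens (pow C (length Fs)) (lam_bif X C Fs Cs)"
    obtain Ds xs u where [simp]: "p = (Ds, xs, u)" by (cases p)
    have *: "Ds \<in> lists (Obj C)" "length Ds = length Fs" "xs \<in> tup_at Fs Ds" "u \<in> Hom (bang X C) Cs Ds"
      using p by (auto simp: gens_def lam_bif_def tup_at_def)
    note D = Hom_bangD[OF h] and E = Hom_bangD[OF k]
    have w: "wiring X (length Ds) (Wir h)" "wiring X (length (Wir h)) (Wir k)"
      using h k *(2) by (simp_all add: Hom_bang_iff)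
    have W: "map (\<lambda>j. Wir h ! (Wir k ! j)) [0..<length Hs] = map ((!) (Wir h)) (Wir k)"
      using E by (intro nth_equalityI) auto
    have "NAt (Lab k ! j \<cdot>\<^bsub>psh C\<^esub> Lab h ! (Wir k ! j)) (Ds ! (Wir h ! (Wir k ! j))) (xs ! (Wir h ! (Wir k ! j))) =
        NAt (Lab k ! j) (Ds ! (Wir h ! (Wir k ! j))) (NAt (Lab h ! (Wir k ! j)) (Ds ! (Wir h ! (Wir k ! j))) (xs ! (Wir h ! (Wir k ! j))))"
      if j: "j < length Hs" for j
      using NAt_Cmp_psh[of "Ds ! (Wir h ! (Wir k ! j))" C "xs ! (Wir h ! (Wir k ! j))"
          "Lab h ! (Wir k ! j)" "Lab k ! j"] D(6)[OF E(5)[OF j]] D(5)[OF E(5)[OF j]]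
        lists_nth[OF *(1)] *(2) tup_atD(2)[OF *(3)] by (simp add: Hom_psh_iff)
    moreover have "rewire C (map ((!) (Wir h)) (Wir k)) Ds \<cdot>\<^bsub>bang X C\<^esub> u =
        rewire C (Wir k) (map ((!) Ds) (Wir h)) \<cdot>\<^bsub>bang X C\<^esub> (rewire C (Wir h) Ds \<cdot>\<^bsub>bang X C\<^esub> u)"
      using B.Cmp_assoc[OF *(4) rewire_in[OF C *(1) w(1)], of "rewire C (Wir k) (map ((!) Ds) (Wir h))"]
        rewire_in[OF C, of "map ((!) Ds) (Wir h)" X "Wir k"] w rewire_in[OF C *(1) w(1)]
        rewire_rewire[OF C *(1) w] by (simp add: Hom_bang_iff)
    moreover have "map ((!) Ds) (map ((!) (Wir h)) (Wir k)) = map ((!) (map ((!) Ds) (Wir h))) (Wir k)"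
      using D(3) E by (intro nth_equalityI) simp_all
    moreover have "Wir (k \<cdot>\<^bsub>bang X (psh C)\<^esub> h) = map ((!) (Wir h)) (Wir k)"
      using W E(2) by simp
    moreover have "map (\<lambda>j. NAt (Lab (k \<cdot>\<^bsub>bang X (psh C)\<^esub> h) ! j) (Ds ! (map ((!) (Wir h)) (Wir k) ! j))
          (xs ! (map ((!) (Wir h)) (Wir k) ! j))) [0..<length (Wir k)] =
        map (\<lambda>j. NAt (Lab k ! j) (map ((!) Ds) (Wir h) ! (Wir k ! j))
          (map (\<lambda>i. NAt (Lab h ! i) (Ds ! (Wir h ! i)) (xs ! (Wir h ! i))) [0..<length (Wir h)] ! (Wir k ! j)))
          [0..<length (Wir k)]"
      by (intro nth_equalityI) (simp_all add: calculation(1) D(3) E(2,3,5))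
    ultimately show "lam_wire X C (k \<cdot>\<^bsub>bang X (psh C)\<^esub> h) p = lam_wire X C k (lam_wire X C h p)"
      by (simp add: lam_wire_def del: bang_sel map_map)
  next
    fix h and Fs Gs :: "('o, 'a, 'x) presheaf list" and g Cs Cs' p
    assume h: "h \<in> Hom (bang X (psh C)) Fs Gs" and g: "g \<in> Hom (bang X C) Cs Cs'"
      and p: "p \<in> gens (pow C (length Fs)) (lam_bif X C Fs Cs')"
    obtain Ds xs u where [simp]: "p = (Ds, xs, u)" by (cases p)
    have *: "Ds \<in> lists (Obj C)" "length Ds = length Fs" "u \<in> Hom (bang X C) Cs' Ds"
      using p by (auto simp: gens_def lam_bif_def)
    have "wiring X (length Ds) (Wir h)" using h *(2) by (simp add: Hom_bang_iff)
    then show "lam_wire X C h (?m Fs g p) = ?m Gs g (lam_wire X C h p)"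
      using B.Cmp_assoc[OF g *(3) rewire_in[OF C *(1)]] by (simp add: lam_wire_def)
  qed (auto simp: lam_def lam_ob_def lam_wire_def)
qed

lemmas is_functor_lam = coend_functor.is_functor[OF coend_functor_lam]
lemmas Act_lam = coend_functor.Act_cls[OF coend_functor_lam]
lemmas NAt_lam = coend_functor.NAt_cls[OF coend_functor_lam]

section \<open>The unit laws\<close>

lemma FO_lam: "FO (lam X C) = lam_ob X C"
  by (simp add: lam_def)

lemma At_lam: "Cs \<in> lists (Obj C) \<Longrightarrow>
    At (lam_ob X C Fs) Cs = cls (pow C (length Fs)) (lam_bif X C Fs Cs) ` gens (pow C (length Fs)) (lam_bif X C Fs Cs)"
  by (simp add: lam_ob_def coend_eq_cls)

lemma presheaf_lam:
  "\<lbrakk>wirable X; category C; Fs \<in> lists {P. is_presheaf C P}\<rbrakk> \<Longrightarrow> is_presheaf (bang X C) (lam_ob X C Fs)"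
  using psh_functor(1)[OF is_functor_lam, of X C Fs] by (simp add: FO_lam)

lemma gens_lam:
  "(Ds, xs, u) \<in> gens (pow C n) (lam_bif X C Fs Cs) \<longleftrightarrow>
    Ds \<in> lists (Obj C) \<and> length Ds = n \<and> xs \<in> tup_at Fs Ds \<and> u \<in> Hom (bang X C) Cs Ds"
  by (auto simp: gens_def lam_bif_def tup_at_def)

lemma par_Cmp:
  assumes C: "category C" and fs: "fs \<in> Hom (pow C n) Ds Es" and gs: "gs \<in> Hom (pow C n) Es Hs"
  shows "par C gs \<cdot>\<^bsub>bang X C\<^esub> par C fs = par C (map (\<lambda>i. gs ! i \<cdot>\<^bsub>C\<^esub> fs ! i) [0..<n])"
proof -
  have c: "gs ! i \<cdot>\<^bsub>C\<^esub> fs ! i \<in> Hom C (Ds ! i) (Hs ! i)" if "i < n" for i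
    using category.Cmp_in[OF C] fs gs that by (auto simp: Hom_pow_iff)
  have len: "length fs = n" "length gs = n" using fs gs by (simp_all add: Hom_pow_iff)
  have "map (Dom C) fs = map (Dom C) (map (\<lambda>i. gs ! i \<cdot>\<^bsub>C\<^esub> fs ! i) [0..<n])"
    using c fs by (intro nth_equalityI) (auto simp: Hom_pow_iff Hom_def[of C])
  moreover have "map (Cod C) gs = map (Cod C) (map (\<lambda>i. gs ! i \<cdot>\<^bsub>C\<^esub> fs ! i) [0..<n])"
    using c gs by (intro nth_equalityI) (auto simp: Hom_pow_iff Hom_def[of C])
  ultimately show ?thesis
    using len by (intro bang_eqI) simp_all
qed

lemma map_Ide_in:
  assumes "category C" "Ds \<in> lists (Obj C)"
  shows "map (Ide C) Ds \<in> Hom (pow C (length Ds)) Ds Ds"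
  using category.Ide_in[OF assms(1)] lists_nth[OF assms(2)] by (simp add: Hom_pow_iff)

text \<open>A tuple of elements of representable presheaves is a morphism of a power of \<open>C\<close>.\<close>

lemma tup_at_yoneda:
  assumes "length Ds = length Es"
  shows "tup_at (map (FO (yoneda C)) Es) Ds = Hom (pow C (length Es)) Ds Es"
  using assms by (auto simp: tup_at_def Hom_pow_iff)

lemma lists_yoneda:
  assumes "category C" "Es \<in> lists (Obj C)"
  shows "map (FO (yoneda C)) Es \<in> lists {P. is_presheaf C P}"
  using assms(2) psh_functor(1)[OF is_functor_yoneda[OF assms(1)]] by auto

lemma Act_yoneda_tup:
  assumes "fs \<in> Hom (pow C (length Es)) Cs Ds" "gs \<in> Hom (pow C (length Es)) Ds Es"
  shows "tup_act (map (FO (yoneda C)) Es) fs gs = map (\<lambda>i. gs ! i \<cdot>\<^bsub>C\<^esub> fs ! i) [0..<length Es]"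
  using assms unfolding tup_act_def
  by (intro nth_equalityI) (auto simp: Hom_pow_iff intro: Act_yoneda)

text \<open>Sliding \<open>fs\<close> gives \<open>[Ds, fs, u] = [Es, id, par C fs \<circ> u]\<close>, so a class is determined by the composite
\<open>par C fs \<circ> u\<close>; conversely the composite does not change along a slide.\<close>

lemma unit_psh:
  assumes X: "wirable X" and C: "category C"
  shows "\<exists>\<phi>. psh_iso (bang X C) (bang X C) (lam X C \<odot> bang_map (yoneda C)) (yoneda (bang X C)) \<phi> \<and>
    canonical_unit_psh X C \<phi>"
proof -
  interpret category C by (rule C)
  have B: "category (bang X C)" by (rule category_bang[OF X C])
  interpret B: category "bang X C" by (rule B)
  have Y: "is_functor (bang X C) (bang X (psh C)) (bang_map (yoneda C))"
    by (rule is_functor_bang_map[OF X is_functor_yoneda[OF C]])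
  let ?Y = "map (FO (yoneda C))"
  let ?q = "\<lambda>Es Cs. cls (pow C (length Es)) (lam_bif X C (?Y Es) Cs)"
  let ?r = "\<lambda>Es Cs (Ds, fs, u). par C fs \<cdot>\<^bsub>bang X C\<^esub> u"
  let ?G = "\<lambda>Es Cs. gens (pow C (length Es)) (lam_bif X C (?Y Es) Cs)"
  have FO: "FO (lam X C \<odot> bang_map (yoneda C)) Es = lam_ob X C (?Y Es)" for Es
    by (simp add: FO_lam) (simp add: bang_map_def)
  have G: "(Ds, fs, u) \<in> ?G Es Cs \<longleftrightarrow> fs \<in> Hom (pow C (length Es)) Ds Es \<and> u \<in> Hom (bang X C) Cs Ds"
    if "Es \<in> lists (Obj C)" for Ds fs u Es Cs
    using gens_lam[of Ds fs u C "length Es" X "?Y Es" Cs] tup_at_yoneda[of Ds Es C]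
      Hom_pow_lists[OF C, of fs "length Es" Ds Es] by auto
  have lists_Y: "Es \<in> lists (Obj C) \<Longrightarrow> ?Y Es \<in> lists {P. is_presheaf C P}" for Es
    by (rule lists_yoneda[OF C])
  have "\<exists>\<phi>. psh_iso (bang X C) (bang X C) (lam X C \<odot> bang_map (yoneda C)) (yoneda (bang X C)) \<phi> \<and>
    (\<forall>Es \<in> Obj (bang X C). \<forall>Cs \<in> Obj (bang X C). \<forall>p \<in> ?G Es Cs. \<phi> Es Cs (?q Es Cs p) = ?r Es Cs p)"
  proof (rule psh_isoI_generators[OF is_functor_fcomp[OF Y is_functor_lam[OF X C]] is_functor_yoneda[OF B]])
    fix Es Cs assume "Es \<in> Obj (bang X C)" and "Cs \<in> Obj (bang X C)"
    then have Es: "Es \<in> lists (Obj C)" and Cs: "Cs \<in> lists (Obj C)" by simp_all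
    interpret T: tup_coend C "?Y Es" "length Es" "Hom (bang X C) Cs" "\<lambda>gs u. par C gs \<cdot>\<^bsub>bang X C\<^esub> u"
      using tup_coend_lam[OF X C Cs lists_Y[OF Es]] by simp
    show "At (FO (lam X C \<odot> bang_map (yoneda C)) Es) Cs = ?q Es Cs ` ?G Es Cs"
      using At_lam[OF Cs, of X "?Y Es"] by (simp only: FO length_map)
    have ids: "map (Ide C) Es \<in> Hom (pow C (length Es)) Es Es"
      by (rule map_Ide_in[OF C Es])
    show "At (FO (yoneda (bang X C)) Es) Cs = ?r Es Cs ` ?G Es Cs"
    proof (intro equalityI subsetI)
      fix v assume "v \<in> At (FO (yoneda (bang X C)) Es) Cs"
      then have v: "v \<in> Hom (bang X C) Cs Es" by simp
      then have "v = ?r Es Cs (Es, map (Ide C) Es, v)" "(Es, map (Ide C) Es, v) \<in> ?G Es Cs"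
        using B.Ide_Cmp[OF v] ids Es by (simp_all add: par_Ide[OF C Es, of X] G del: in_lists_conv_set)
      then show "v \<in> ?r Es Cs ` ?G Es Cs" by (rule image_eqI)
    next
      fix v assume "v \<in> ?r Es Cs ` ?G Es Cs"
      then show "v \<in> At (FO (yoneda (bang X C)) Es) Cs"
        using B.Cmp_in par_in[OF X C] G[OF Es] by auto
    qed
    have fwd: "cowedge (pow C (length Es)) (lam_bif X C (?Y Es) Cs) (?r Es Cs)"
      unfolding lam_bif_eq
    proof (rule T.cowedgeI)
      fix fs Ds Ds' gs u
      assume *: "fs \<in> Hom (pow C (length Es)) Ds Ds'" "u \<in> Hom (bang X C) Cs Ds"
        and "length Ds' = length Es" "gs \<in> tup_at (?Y Es) Ds'"
      then have gs: "gs \<in> Hom (pow C (length Es)) Ds' Es" by (simp add: tup_at_yoneda)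
      show "?r Es Cs (Ds, tup_act (?Y Es) fs gs, u) = ?r Es Cs (Ds', gs, par C fs \<cdot>\<^bsub>bang X C\<^esub> u)"
        using B.Cmp_assoc[OF *(2) par_in[OF X C *(1)] par_in[OF X C gs]] Act_yoneda_tup[OF *(1) gs]
          par_Cmp[OF C *(1) gs, of X] by simp
    qed
    \<comment> \<open>the normal form of a class\<close>
    have normal: "?q Es Cs p = ?q Es Cs (Es, map (Ide C) Es, ?r Es Cs p)" if "p \<in> ?G Es Cs" for p
    proof -
      obtain Ds fs u where [simp]: "p = (Ds, fs, u)" by (cases p)
      have *: "fs \<in> Hom (pow C (length Es)) Ds Es" "u \<in> Hom (bang X C) Cs Ds"
        using that by (simp_all add: G[OF Es])
      have "fs ! i \<in> Hom C (Ds ! i) (Es ! i)" if "i < length Es" for i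
        using *(1) that by (simp add: Hom_pow_iff)
      then have "tup_act (?Y Es) fs (map (Ide C) Es) = fs"
        using Act_yoneda_tup[OF *(1) ids] *(1)
        by (intro nth_equalityI) (auto simp: Hom_pow_iff intro: Ide_Cmp)
      then show ?thesis
        using T.step[OF *(1) _ *(2), of "map (Ide C) Es"] ids tup_at_yoneda[of Es Es C]
        by (simp add: lam_bif_eq)
    qed
    show "?q Es Cs p = ?q Es Cs p' \<longleftrightarrow> ?r Es Cs p = ?r Es Cs p'" if "p \<in> ?G Es Cs" "p' \<in> ?G Es Cs" for p p'
    proof
      assume "?q Es Cs p = ?q Es Cs p'" then show "?r Es Cs p = ?r Es Cs p'"
        by (rule cowedge_eq[OF fwd])
    next
      assume "?r Es Cs p = ?r Es Cs p'" then show "?q Es Cs p = ?q Es Cs p'"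
        using normal[OF that(1)] normal[OF that(2)] by simp
    qed
  next
    fix Es h Bs Cs p assume "Es \<in> Obj (bang X C)" and h: "h \<in> Hom (bang X C) Bs Cs" and p: "p \<in> ?G Es Cs"
    then have Es: "Es \<in> lists (Obj C)" by simp
    obtain Ds fs u where [simp]: "p = (Ds, fs, u)" by (cases p)
    have *: "fs \<in> Hom (pow C (length Es)) Ds Es" "u \<in> Hom (bang X C) Cs Ds"
      using p by (simp_all add: G[OF Es])
    have "Act (lam_ob X C (?Y Es)) h (?q Es Cs p) = ?q Es Bs (Ds, fs, u \<cdot>\<^bsub>bang X C\<^esub> h)"
      using Act_lam[OF X C _ h, of "?Y Es" p] p lists_Y[OF Es] by (simp add: FO_lam)
    then show "\<exists>p' \<in> ?G Es Bs. Act (FO (lam X C \<odot> bang_map (yoneda C)) Es) h (?q Es Cs p) = ?q Es Bs p' \<and>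
        Act (FO (yoneda (bang X C)) Es) h (?r Es Cs p) = ?r Es Bs p'"
      using * B.Cmp_in[OF h *(2)] B.Cmp_assoc[OF h *(2) par_in[OF X C *(1)]]
        Act_yoneda[OF h B.Cmp_in[OF *(2) par_in[OF X C *(1)]]]
      by (intro bexI[of _ "(Ds, fs, u \<cdot>\<^bsub>bang X C\<^esub> h)"]) (simp_all only: FO G[OF Es] prod.case \<open>p = _\<close> simp_thms)
  next
    fix h Es Es' Cs p assume h: "h \<in> Hom (bang X C) Es Es'" and Cs: "Cs \<in> Obj (bang X C)" and p: "p \<in> ?G Es Cs"
    have Es: "Es \<in> lists (Obj C)" "Es' \<in> lists (Obj C)" using h by (simp_all add: Hom_bang_iff)
    obtain Ds fs u where [simp]: "p = (Ds, fs, u)" by (cases p)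
    have *: "fs \<in> Hom (pow C (length Es)) Ds Es" "u \<in> Hom (bang X C) Cs Ds"
      using p by (simp_all add: G[OF Es(1)])
    have Ds: "Ds \<in> lists (Obj C)" "length Ds = length Es" using Hom_pow_lists[OF C *(1)] by auto
    note D = Hom_bangD[OF h]
    let ?Fh = "FA (bang_map (yoneda C)) h"
    have Fh: "?Fh \<in> Hom (bang X (psh C)) (?Y Es) (?Y Es')"
      using is_functor.FA_in[OF Y h] by (simp add: bang_map_def)
    let ?gs = "map (\<lambda>j. Lab h ! j \<cdot>\<^bsub>C\<^esub> fs ! (Wir h ! j)) [0..<length Es']"
    have fsw: "fs ! (Wir h ! j) \<in> Hom C (Ds ! (Wir h ! j)) (Es ! (Wir h ! j))" if "j < length Es'" for j
      using *(1) D(5)[OF that] by (simp add: Hom_pow_iff)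
    have "map (\<lambda>j. NAt (Lab ?Fh ! j) (Ds ! (Wir ?Fh ! j)) (fs ! (Wir ?Fh ! j))) [0..<length (Wir ?Fh)] = ?gs"
    proof (rule nth_equalityI)
      fix j assume "j < length (map (\<lambda>j. NAt (Lab ?Fh ! j) (Ds ! (Wir ?Fh ! j)) (fs ! (Wir ?Fh ! j))) [0..<length (Wir ?Fh)])"
      then have j: "j < length Es'" using D by (simp add: bang_map_def)
      show "map (\<lambda>j. NAt (Lab ?Fh ! j) (Ds ! (Wir ?Fh ! j)) (fs ! (Wir ?Fh ! j))) [0..<length (Wir ?Fh)] ! j = ?gs ! j"
        using NAt_yoneda[OF D(6)[OF j] _ fsw[OF j]] Hom_Obj[OF C fsw[OF j]] j D by (simp add: bang_map_def)
    qed (simp add: D bang_map_def)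
    then have wire: "lam_wire X C ?Fh p = (map ((!) Ds) (Wir h), ?gs, rewire C (Wir h) Ds \<cdot>\<^bsub>bang X C\<^esub> u)"
      by (simp add: lam_wire_def bang_map_def)
    have w: "wiring X (length Ds) (Wir h)" using h Ds(2) by (simp add: Hom_bang_iff)
    note rew = rewire_in[OF C Ds(1) w]
    have gs: "?gs \<in> Hom (pow C (length Es')) (map ((!) Ds) (Wir h)) Es'"
      using Cmp_in[OF fsw D(6)] D(3) by (simp add: Hom_pow_iff)
    have "h \<cdot>\<^bsub>bang X C\<^esub> (par C fs \<cdot>\<^bsub>bang X C\<^esub> u) =
        par C ?gs \<cdot>\<^bsub>bang X C\<^esub> (rewire C (Wir h) Ds \<cdot>\<^bsub>bang X C\<^esub> u)"
      using B.Cmp_assoc[OF *(2) par_in[OF X C *(1)] h] B.Cmp_assoc[OF *(2) rew par_in[OF X C gs]]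
        bang_par_rewire[OF C h *(1)] by simp
    moreover have "NAt (FA (yoneda (bang X C)) h) Cs (par C fs \<cdot>\<^bsub>bang X C\<^esub> u) = h \<cdot>\<^bsub>bang X C\<^esub> (par C fs \<cdot>\<^bsub>bang X C\<^esub> u)"
      by (rule NAt_yoneda[OF h Cs B.Cmp_in[OF *(2) par_in[OF X C *(1)]]])
    moreover have "NAt (FA (lam X C) ?Fh) Cs (?q Es Cs p) = ?q Es' Cs (lam_wire X C ?Fh p)"
      using NAt_lam[OF X C Fh Cs, of p] p by simp
    moreover have "lam_wire X C ?Fh p \<in> ?G Es' Cs"
      using gs B.Cmp_in[OF *(2) rew] by (simp only: wire G[OF Es(2)])
    moreover note wire
    ultimately show "\<exists>p' \<in> ?G Es' Cs.
        NAt (FA (lam X C \<odot> bang_map (yoneda C)) h) Cs (?q Es Cs p) = ?q Es' Cs p' \<and>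
        NAt (FA (yoneda (bang X C)) h) Cs (?r Es Cs p) = ?r Es' Cs p'"
      by (intro bexI[of _ "lam_wire X C ?Fh p"]) simp_all
  qed
  then obtain \<phi> where iso: "psh_iso (bang X C) (bang X C) (lam X C \<odot> bang_map (yoneda C)) (yoneda (bang X C)) \<phi>"
    and \<phi>: "\<And>Es Cs p. \<lbrakk>Es \<in> lists (Obj C); Cs \<in> lists (Obj C); p \<in> ?G Es Cs\<rbrakk> \<Longrightarrow> \<phi> Es Cs (?q Es Cs p) = ?r Es Cs p"
    by (auto simp del: in_lists_conv_set)
  have "canonical_unit_psh X C \<phi>"
    unfolding canonical_unit_psh_def
  proof (intro allI impI, elim conjE)
    fix Es Cs Ds fs u
    assume "Es \<in> lists (Obj C)" "Cs \<in> lists (Obj C)" "length Ds = length Es" "length fs = length Es"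
      "\<forall>i<length Es. fs ! i \<in> Hom C (Ds ! i) (Es ! i)" "u \<in> Hom (bang X C) Cs Ds"
    then show "\<phi> Es Cs (?q Es Cs (Ds, fs, u)) = par C fs \<cdot>\<^bsub>bang X C\<^esub> u"
      using \<phi>[of Es Cs "(Ds, fs, u)"] G[of Es Ds fs u Cs] by (simp add: Hom_pow_iff del: in_lists_conv_set)
  qed
  with iso show ?thesis by blast
qed

text \<open>The two coends have the same representatives up to replacing \<open>D\<close>, \<open>x\<close> by one-element lists, and
the same slides, because \<open>par C [f]\<close> is the image of \<open>f\<close> under the unit of \<open>!\<close>.\<close>

lemma unit_bang:
  fixes C :: "('o, 'a) cat"
  assumes X: "wirable X" and C: "category C"
  shows "\<exists>\<phi>. psh_iso (psh C) (bang X C) (lam X C \<odot> eta_bang (psh C :: (('o, 'a, 'x) presheaf, _) cat))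
      (psh_map C (bang X C) (eta_bang C)) \<phi> \<and> canonical_unit_bang X C \<phi>"
proof -
  interpret category C by (rule C)
  have B: "category (bang X C)" by (rule category_bang[OF X C])
  interpret B: category "bang X C" by (rule B)
  have P: "category (psh C :: (('o, 'a, 'x) presheaf, _) cat)" by (rule category_psh[OF C])
  let ?eta = "eta_bang (psh C :: (('o, 'a, 'x) presheaf, _) cat)"
  have eta: "is_functor (psh C) (bang X (psh C)) ?eta" by (rule is_functor_eta_bang[OF X P])
  let ?E = "yoneda (bang X C) \<odot> eta_bang C"
  have E: "is_functor C (psh (bang X C)) ?E"
    by (rule is_functor_fcomp[OF is_functor_eta_bang[OF X C] is_functor_yoneda[OF B]])
  note kan = is_functor_kan[OF E B] and Act_k = Act_kan[OF E B] and NAt_k = NAt_kan[OF E B]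
  let ?r = "\<lambda>F Cs. cls C (kan_bif ?E F Cs)"
  let ?s = "\<lambda>(D, x, u). ([D], [x], u)"
  let ?q = "\<lambda>F Cs p. cls (pow C (Suc 0)) (lam_bif X C [F] Cs) (?s p)"
  let ?G = "\<lambda>F Cs. gens C (kan_bif ?E F Cs)"
  have At_E: "FO (eta_bang C) D = [D]" for D by (simp add: eta_bang_def)
  have par1: "par C [f] = FA (eta_bang C) f" for f by (simp add: par_def eta_bang_def)
  have pow1: "[f] \<in> Hom (pow C (Suc 0)) [D] [D']" if "f \<in> Hom C D D'" for f D D'
    using that by (simp add: Hom_pow_iff)
  have tup1: "[x] \<in> tup_at [F] [D] \<longleftrightarrow> x \<in> At F D" for x F D by (simp add: tup_at_def)
  have act1: "tup_act [F] [f] [x] = [Act F f x]" for F f x by (simp add: tup_act_def)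
  have s_in: "?s p \<in> gens (pow C (Suc 0)) (lam_bif X C [F] Cs)" if "p \<in> ?G F Cs" for F Cs p
    using that by (cases p) (simp add: At_E tup1 gens_lam)
  have FO: "FO (lam X C \<odot> ?eta) F = lam_ob X C [F]" for F by (simp add: FO_lam) (simp add: eta_bang_def)
  have "\<exists>\<phi>. psh_iso (psh C) (bang X C) (lam X C \<odot> ?eta) (psh_map C (bang X C) (eta_bang C)) \<phi> \<and>
    (\<forall>F \<in> Obj (psh C). \<forall>Cs \<in> Obj (bang X C). \<forall>p \<in> ?G F Cs. \<phi> F Cs (?q F Cs p) = ?r F Cs p)"
    unfolding psh_map_def
  proof (rule psh_isoI_generators[OF is_functor_fcomp[OF eta is_functor_lam[OF X C]] kan])
    fix F :: "('o, 'a, 'x) presheaf" and Cs assume "F \<in> Obj (psh C)" and Cs': "Cs \<in> Obj (bang X C)"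
    then have F: "is_presheaf C F" and Cs: "Cs \<in> lists (Obj C)" by simp_all
    interpret T: tup_coend C "[F]" "Suc 0" "Hom (bang X C) Cs" "\<lambda>gs u. par C gs \<cdot>\<^bsub>bang X C\<^esub> u"
      using tup_coend_lam[OF X C Cs, of "[F]"] F by simp
    show "At (FO (kan C (bang X C) ?E) F) Cs = ?r F Cs ` ?G F Cs" by (rule At_kan[OF Cs'])
    have At1: "At (FO (lam X C \<odot> ?eta) F) Cs =
        cls (pow C (Suc 0)) (lam_bif X C [F] Cs) ` gens (pow C (Suc 0)) (lam_bif X C [F] Cs)"
      unfolding FO using At_lam[OF Cs, of X "[F]"] by simp
    show "At (FO (lam X C \<odot> ?eta) F) Cs = ?q F Cs ` ?G F Cs"
      unfolding At1
    proof (intro equalityI subsetI)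
      fix v assume "v \<in> cls (pow C (Suc 0)) (lam_bif X C [F] Cs) ` gens (pow C (Suc 0)) (lam_bif X C [F] Cs)"
      then obtain Ds xs u where v: "v = cls (pow C (Suc 0)) (lam_bif X C [F] Cs) (Ds, xs, u)"
        and p: "(Ds, xs, u) \<in> gens (pow C (length [F])) (lam_bif X C [F] Cs)"
        by auto
      have *: "Ds \<in> lists (Obj C)" "length Ds = Suc 0" "xs \<in> tup_at [F] Ds" "u \<in> Hom (bang X C) Cs Ds"
        using p[unfolded gens_lam] by simp_all
      then obtain D x where [simp]: "Ds = [D]" "xs = [x]"
        using tup_atD(1)[OF *(3)] by (auto simp: length_Suc_conv)
      show "v \<in> ?q F Cs ` ?G F Cs"
        by (rule image_eqI[of _ _ "(D, x, u)"]) (use v * in \<open>simp_all add: At_E tup1\<close>)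
    next
      fix v assume "v \<in> ?q F Cs ` ?G F Cs"
      then show "v \<in> cls (pow C (Suc 0)) (lam_bif X C [F] Cs) ` gens (pow C (Suc 0)) (lam_bif X C [F] Cs)"
        using s_in by blast
    qed
    have fwd: "cowedge (pow C (Suc 0)) (lam_bif X C [F] Cs) (\<lambda>(Ds, xs, u). ?r F Cs (hd Ds, hd xs, u))"
      unfolding lam_bif_eq
    proof (rule T.cowedgeI)
      fix fs Ds Es xs u
      assume *: "fs \<in> Hom (pow C (Suc 0)) Ds Es" "length Ds = Suc 0" "length Es = Suc 0" "xs \<in> tup_at [F] Es"
        "u \<in> Hom (bang X C) Cs Ds"
      then obtain f D D' x where [simp]: "fs = [f]" "Ds = [D]" "Es = [D']" "xs = [x]"
        using tup_atD(1)[OF *(4)] by (auto simp: length_Suc_conv Hom_pow_iff)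
      have f: "f \<in> Hom C D D'" using *(1) by (simp add: Hom_pow_iff)
      then show "(case (Ds, tup_act [F] fs xs, u) of (Ds, xs, u) \<Rightarrow> ?r F Cs (hd Ds, hd xs, u)) =
          (case (Es, xs, par C fs \<cdot>\<^bsub>bang X C\<^esub> u) of (Ds, xs, u) \<Rightarrow> ?r F Cs (hd Ds, hd xs, u))"
        using cls_kan_step[OF E F Cs' f, of x u] * NAt_yoneda[OF par_in[OF X C pow1[OF f]] Cs' *(5)[simplified]]
        by (simp add: At_E tup1 act1 par1)
    qed
    have bwd: "cowedge C (kan_bif ?E F Cs) (?q F Cs)"
    proof (rule cowedge_kanI[OF E F Cs'])
      fix f D D' x u assume f: "f \<in> Hom C D D'" and x: "x \<in> At F D'" and "u \<in> At (FO ?E D) Cs"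
      then have u: "u \<in> Hom (bang X C) Cs [D]" by (simp add: At_E)
      show "?q F Cs (D, Act F f x, u) = ?q F Cs (D', x, NAt (FA ?E f) Cs u)"
        using T.step[OF pow1[OF f], of "[x]" u] x u NAt_yoneda[OF par_in[OF X C pow1[OF f]] Cs' u]
        by (simp add: lam_bif_eq tup1 act1 par1)
    qed
    show "?q F Cs p = ?q F Cs p' \<longleftrightarrow> ?r F Cs p = ?r F Cs p'" for p p'
    proof
      assume "?q F Cs p = ?q F Cs p'"
      from cowedge_eq[OF fwd this] show "?r F Cs p = ?r F Cs p'" by (cases p; cases p') simp
    qed (rule cowedge_eq[OF bwd])
  next
    fix F :: "('o, 'a, 'x) presheaf" and h Bs Cs p
    assume "F \<in> Obj (psh C)" and h: "h \<in> Hom (bang X C) Bs Cs" and p: "p \<in> ?G F Cs"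
    then have F: "is_presheaf C F" by simp
    obtain D x u where [simp]: "p = (D, x, u)" by (cases p)
    have *: "D \<in> Obj C" "x \<in> At F D" "u \<in> Hom (bang X C) Cs [D]" using p by (simp_all add: At_E)
    have y: "Act (FO (yoneda (bang X C)) [D]) h u = u \<cdot>\<^bsub>bang X C\<^esub> h" by (rule Act_yoneda[OF h *(3)])
    have "Act (lam_ob X C [F]) h (?q F Cs p) = ?q F Bs (D, x, u \<cdot>\<^bsub>bang X C\<^esub> h)"
      using Act_lam[OF X C _ h, of "[F]" "?s p"] s_in[OF p] F by (simp add: FO_lam)
    moreover have "Act (FO (kan C (bang X C) ?E) F) h (?r F Cs p) = ?r F Bs (D, x, u \<cdot>\<^bsub>bang X C\<^esub> h)"
      using Act_k[OF _ h p] F y by (simp add: eta_bang_def)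
    ultimately show "\<exists>p' \<in> ?G F Bs. Act (FO (lam X C \<odot> ?eta) F) h (?q F Cs p) = ?q F Bs p' \<and>
        Act (FO (kan C (bang X C) ?E) F) h (?r F Cs p) = ?r F Bs p'"
      using * B.Cmp_in[OF h *(3)] unfolding FO
      by (intro bexI[of _ "(D, x, u \<cdot>\<^bsub>bang X C\<^esub> h)"]) (simp_all add: At_E)
  next
    fix \<alpha> and F F' :: "('o, 'a, 'x) presheaf" and Cs p
    assume \<alpha>: "\<alpha> \<in> Hom (psh C) F F'" and Cs': "Cs \<in> Obj (bang X C)" and p: "p \<in> ?G F Cs"
    obtain D x u where [simp]: "p = (D, x, u)" by (cases p)
    have *: "D \<in> Obj C" "x \<in> At F D" "u \<in> Hom (bang X C) Cs [D]" using p by (simp_all add: At_E)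
    have x': "NAt \<alpha> D x \<in> At F' D" using \<alpha> * ptrans_NAt_in[of C \<alpha> D x] by (simp add: Hom_psh_iff)
    have \<alpha>': "FA ?eta \<alpha> \<in> Hom (bang X (psh C)) [F] [F']"
      using is_functor.FA_in[OF eta \<alpha>] by (simp add: eta_bang_def)
    have "rewire C [0] [D] = Ide (bang X C) [D]"
      by (rule bang_eqI) auto
    then have "rewire C [0] [D] \<cdot>\<^bsub>bang X C\<^esub> u = u"
      by (simp only: B.Ide_Cmp[OF *(3)])
    then have "lam_wire X C (FA ?eta \<alpha>) (?s p) = ?s (D, NAt \<alpha> D x, u)"
      by (simp add: lam_wire_def eta_bang_def)
    then have "NAt (FA (lam X C) (FA ?eta \<alpha>)) Cs (?q F Cs p) = ?q F' Cs (D, NAt \<alpha> D x, u)"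
      using NAt_lam[OF X C \<alpha>' Cs', of "?s p"] s_in[OF p] by simp
    moreover have "NAt (FA (kan C (bang X C) ?E) \<alpha>) Cs (?r F Cs p) = ?r F' Cs (D, NAt \<alpha> D x, u)"
      using NAt_k[OF \<alpha> Cs' p] by simp
    ultimately show "\<exists>p' \<in> ?G F' Cs. NAt (FA (lam X C \<odot> ?eta) \<alpha>) Cs (?q F Cs p) = ?q F' Cs p' \<and>
        NAt (FA (kan C (bang X C) ?E) \<alpha>) Cs (?r F Cs p) = ?r F' Cs p'"
      using * x' by (intro bexI[of _ "(D, NAt \<alpha> D x, u)"]) (simp_all add: At_E)
  qed
  then obtain \<phi> where iso: "psh_iso (psh C) (bang X C) (lam X C \<odot> ?eta) (psh_map C (bang X C) (eta_bang C)) \<phi>"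
    and \<phi>: "\<And>F Cs p. \<lbrakk>F \<in> Obj (psh C); Cs \<in> Obj (bang X C); p \<in> ?G F Cs\<rbrakk> \<Longrightarrow> \<phi> F Cs (?q F Cs p) = ?r F Cs p"
    by blast
  have "canonical_unit_bang X C \<phi>"
    unfolding canonical_unit_bang_def
  proof (intro allI impI, elim conjE)
    fix F :: "('o, 'a, 'x) presheaf" and Cs D x u
    assume "F \<in> Obj (psh C)" "Cs \<in> lists (Obj C)" "D \<in> Obj C" "x \<in> At F D" "u \<in> Hom (bang X C) Cs [D]"
    then show "\<phi> F Cs (cls (pow C 1) (lam_bif X C [F] Cs) ([D], [x], u)) = ?r F Cs (D, x, u)"
      using \<phi>[of F Cs "(D, x, u)"] by (simp add: At_E)
  qed
  with iso show ?thesis by blast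
qed

section \<open>The Kleisli extension of a functor on \<open>!A\<close>, restricted along \<open>\<lambda>\<close>\<close>

text \<open>The integrand \<open>Z\<^sub>1A\<^sub>1 \<times> \<dots> \<times> Z\<^sub>nA\<^sub>n \<times> F(A\<^sub>1, \<dots>, A\<^sub>n)(d)\<close> over \<open>A\<^sup>n\<close> to which the co-Yoneda lemma
reduces the value of the Kleisli extension of \<open>F\<close> at \<open>\<lambda>(Z\<^sub>1, \<dots>, Z\<^sub>n)\<close>.\<close>

definition mid_bif :: "('o, 'a) cat \<Rightarrow> ('o list, ('o, 'a) barr, ('p, 'b, 'y) presheaf, ('p, 'b, 'y) ptrans) fctr
    \<Rightarrow> ('o, 'a, 'x) presheaf list \<Rightarrow> 'p \<Rightarrow> ('o list, 'a list, 'x list \<times> 'y) bif" where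
  "mid_bif A F Zs d = tup_bif Zs (\<lambda>As. At (FO F As) d) (\<lambda>gs. NAt (FA F (par A gs)) d)"

definition mid_cls :: "('o, 'a) cat \<Rightarrow> ('o list, ('o, 'a) barr, ('p, 'b, 'y) presheaf, ('p, 'b, 'y) ptrans) fctr
    \<Rightarrow> ('o, 'a, 'x) presheaf list \<Rightarrow> 'p \<Rightarrow> 'o list \<times> 'x list \<times> 'y \<Rightarrow> ('o list \<times> 'x list \<times> 'y) set" where
  "mid_cls A F Zs d = cls (pow A (length Zs)) (mid_bif A F Zs d)"

text \<open>The comparison with the reduced integrand: \<open>[As, zs, y]\<close> is sent to \<open>[As, [As, zs, id], y]\<close>.\<close>

definition kan_lam_cls :: "combinator set \<Rightarrow> ('o, 'a) cat
    \<Rightarrow> ('o list, ('o, 'a) barr, ('p, 'b, 'y) presheaf, ('p, 'b, 'y) ptrans) fctr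
    \<Rightarrow> ('o, 'a, 'x) presheaf list \<Rightarrow> 'p \<Rightarrow> 'o list \<times> 'x list \<times> 'y
    \<Rightarrow> ('o list \<times> ('o list \<times> 'x list \<times> ('o, 'a) barr) set \<times> 'y) set" where
  "kan_lam_cls X A F Zs d = (\<lambda>(As, zs, y). cls (bang X A) (kan_bif F (lam_ob X A Zs) d)
     (As, cls (pow A (length Zs)) (lam_bif X A Zs As) (As, zs, Ide (bang X A) As), y))"

lemma lam_cls_in:
  assumes "As \<in> lists (Obj A)" "length As = length Zs" "zs \<in> tup_at Zs As" "v \<in> Hom (bang X A) As' As"
  shows "cls (pow A (length Zs)) (lam_bif X A Zs As') (As, zs, v) \<in> At (lam_ob X A Zs) As'"
proof -
  have "As' \<in> lists (Obj A)" using assms(4) by (simp add: Hom_bang_iff)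
  show ?thesis
    unfolding At_lam[OF \<open>As' \<in> _\<close>] by (rule imageI) (use assms in \<open>simp add: gens_lam\<close>)
qed

lemma At_lamE:
  assumes "Cs \<in> lists (Obj A)" "K \<in> At (lam_ob X A Zs) Cs"
  obtains As zs v where "K = cls (pow A (length Zs)) (lam_bif X A Zs Cs) (As, zs, v)"
    "As \<in> lists (Obj A)" "length As = length Zs" "zs \<in> tup_at Zs As" "v \<in> Hom (bang X A) Cs As"
proof -
  from assms(2) obtain p where "K = cls (pow A (length Zs)) (lam_bif X A Zs Cs) p"
      "p \<in> gens (pow A (length Zs)) (lam_bif X A Zs Cs)"
    unfolding At_lam[OF assms(1)] by blast
  then show ?thesis using that by (cases p) (simp add: gens_lam del: in_lists_conv_set)
qed

locale kan_lam = A: category A + D: category D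
  for A :: "('o, 'a) cat" and D :: "('p, 'b) cat" +
  fixes X :: "combinator set"
    and F :: "('o list, ('o, 'a) barr, ('p, 'b, 'y) presheaf, ('p, 'b, 'y) ptrans) fctr"
  assumes X: "wirable X" and F: "is_functor (bang X A) (psh D) F"
begin

lemma category_A: "category A" by (rule A.category_axioms)

lemma category_D: "category D" by (rule D.category_axioms)

sublocale B: category "bang X A" by (rule category_bang[OF X category_A])

lemma mid_tup:
  assumes "Zs \<in> lists {P. is_presheaf A P}" "d \<in> Obj D"
  shows "tup_coend A Zs (length Zs) (\<lambda>As. At (FO F As) d) (\<lambda>gs. NAt (FA F (par A gs)) d)"
proof (intro tup_coend.intro category_A tup_coend_axioms.intro)
  show "is_presheaf A (Zs ! i)" if "i < length Zs" for i
    using lists_nth[OF assms(1) that] by simp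
  show "NAt (FA F (par A (map (Ide A) Ds))) d y = y" if "Ds \<in> lists (Obj A)" "y \<in> At (FO F Ds) d" for Ds y
    using psh_functor(3)[OF F _ assms(2) that(2)] that(1) par_Ide[OF category_A that(1), of X] by simp
qed (rule refl)

lemma gens_mid:
  "(As, zs, y) \<in> gens (pow A n) (mid_bif A F Zs d) \<longleftrightarrow>
    As \<in> lists (Obj A) \<and> length As = n \<and> zs \<in> tup_at Zs As \<and> y \<in> At (FO F As) d"
  by (auto simp: gens_def mid_bif_def tup_bif_def)

lemma mid_step:
  assumes "Zs \<in> lists {P. is_presheaf A P}" "d \<in> Obj D"
    and "fs \<in> Hom (pow A (length Zs)) As Bs" "zs \<in> tup_at Zs Bs" "y \<in> At (FO F As) d"
  shows "mid_cls A F Zs d (As, tup_act Zs fs zs, y) = mid_cls A F Zs d (Bs, zs, NAt (FA F (par A fs)) d y)"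
  unfolding mid_cls_def mid_bif_def by (rule tup_coend.step[OF mid_tup[OF assms(1,2)] assms(3-5)])

text \<open>The co-Yoneda step: \<open>[As, zs, v]\<close> is the restriction of \<open>[As, zs, id]\<close> along \<open>v\<close>, so \<open>v\<close> can be slid
onto \<open>y\<close>.\<close>

lemma kan_lam_cls_eq:
  assumes Zs: "Zs \<in> lists {P. is_presheaf A P}" and d: "d \<in> Obj D"
    and As: "As \<in> lists (Obj A)" "length As = length Zs" and zs: "zs \<in> tup_at Zs As"
    and v: "v \<in> Hom (bang X A) As' As" and y: "y \<in> At (FO F As') d"
  shows "cls (bang X A) (kan_bif F (lam_ob X A Zs) d) (As', cls (pow A (length Zs)) (lam_bif X A Zs As') (As, zs, v), y) =
    kan_lam_cls X A F Zs d (As, zs, NAt (FA F v) d y)"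
proof -
  have I: "Ide (bang X A) As \<in> Hom (bang X A) As As" using B.Ide_in As(1) by simp
  have "cls (pow A (length Zs)) (lam_bif X A Zs As') (As, zs, v) =
      Act (lam_ob X A Zs) v (cls (pow A (length Zs)) (lam_bif X A Zs As) (As, zs, Ide (bang X A) As))"
    using Act_lam[OF X category_A _ v, of Zs "(As, zs, Ide (bang X A) As)"] Zs As zs I
      B.Ide_Cmp[OF v] by (simp add: FO_lam gens_lam)
  then show ?thesis
    using cls_kan_step[OF F presheaf_lam[OF X category_A Zs] d v lam_cls_in[OF As zs I] y]
    by (simp add: kan_lam_cls_def)
qed

lemma At_kan_lam:
  assumes Zs: "Zs \<in> lists {P. is_presheaf A P}" and d: "d \<in> Obj D"
  shows "At (FO (kan (bang X A) D F) (lam_ob X A Zs)) d =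
    kan_lam_cls X A F Zs d ` gens (pow A (length Zs)) (mid_bif A F Zs d)"
  unfolding At_kan[OF d]
proof (intro equalityI subsetI)
  fix v assume "v \<in> cls (bang X A) (kan_bif F (lam_ob X A Zs) d) ` gens (bang X A) (kan_bif F (lam_ob X A Zs) d)"
  then obtain As' K y where v: "v = cls (bang X A) (kan_bif F (lam_ob X A Zs) d) (As', K, y)"
    and *: "As' \<in> lists (Obj A)" "K \<in> At (lam_ob X A Zs) As'" "y \<in> At (FO F As') d"
    by auto
  obtain As zs w
    where K: "K = cls (pow A (length Zs)) (lam_bif X A Zs As') (As, zs, w)"
      and As: "As \<in> lists (Obj A)" "length As = length Zs" "zs \<in> tup_at Zs As" "w \<in> Hom (bang X A) As' As"
    using At_lamE[OF *(1,2)] .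
  show "v \<in> kan_lam_cls X A F Zs d ` gens (pow A (length Zs)) (mid_bif A F Zs d)"
    unfolding v K kan_lam_cls_eq[OF Zs d As *(3)]
    by (rule imageI) (use As psh_functor(2)[OF F As(4) d *(3)] in \<open>simp add: gens_mid\<close>)
next
  fix v assume "v \<in> kan_lam_cls X A F Zs d ` gens (pow A (length Zs)) (mid_bif A F Zs d)"
  then obtain As zs y where *: "v = kan_lam_cls X A F Zs d (As, zs, y)" "As \<in> lists (Obj A)"
      "length As = length Zs" "zs \<in> tup_at Zs As" "y \<in> At (FO F As) d"
    by (auto simp: gens_mid)
  have "Ide (bang X A) As \<in> Hom (bang X A) As As" using B.Ide_in *(2) by simp
  from lam_cls_in[OF *(2-4) this]
  show "v \<in> cls (bang X A) (kan_bif F (lam_ob X A Zs) d) ` gens (bang X A) (kan_bif F (lam_ob X A Zs) d)"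
    unfolding *(1) kan_lam_cls_def prod.case by (intro imageI) (use * in simp)
qed

text \<open>From right to left, a slide over \<open>A\<^sup>n\<close> is a slide over \<open>!A\<close> along \<open>par A fs\<close>.  From left to
right, \<open>[As', [As, zs, v], y] \<mapsto> [As, zs, F(v)(y)]\<close> is well defined on both levels of coends and
undoes \<open>kan_lam_cls\<close>.\<close>

lemma kan_lam_cls_iff:
  assumes Zs: "Zs \<in> lists {P. is_presheaf A P}" and d: "d \<in> Obj D"
    and p: "p \<in> gens (pow A (length Zs)) (mid_bif A F Zs d)"
    and p': "p' \<in> gens (pow A (length Zs)) (mid_bif A F Zs d)"
  shows "kan_lam_cls X A F Zs d p = kan_lam_cls X A F Zs d p' \<longleftrightarrow> mid_cls A F Zs d p = mid_cls A F Zs d p'"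
proof
  interpret M: tup_coend A Zs "length Zs" "\<lambda>As. At (FO F As) d" "\<lambda>gs. NAt (FA F (par A gs)) d"
    by (rule mid_tup[OF Zs d])
  have "cowedge (pow A (length Zs)) (mid_bif A F Zs d) (kan_lam_cls X A F Zs d)"
    unfolding mid_bif_def
  proof (rule M.cowedgeI)
    fix fs As Bs zs y
    assume *: "fs \<in> Hom (pow A (length Zs)) As Bs" "As \<in> lists (Obj A)" "Bs \<in> lists (Obj A)"
      "length As = length Zs" "length Bs = length Zs" "zs \<in> tup_at Zs Bs" "y \<in> At (FO F As) d"
    interpret L: tup_coend A Zs "length Zs" "Hom (bang X A) As" "\<lambda>gs u. par A gs \<cdot>\<^bsub>bang X A\<^esub> u"
      by (rule tup_coend_lam[OF X category_A *(2) Zs])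
    have I: "Ide (bang X A) As \<in> Hom (bang X A) As As" using B.Ide_in *(2) by simp
    note par = par_in[OF X category_A *(1)]
    have "cls (pow A (length Zs)) (lam_bif X A Zs As) (As, tup_act Zs fs zs, Ide (bang X A) As) =
        cls (pow A (length Zs)) (lam_bif X A Zs As) (Bs, zs, par A fs)"
      using L.step[OF *(1,6) I] B.Cmp_Ide[OF par] by (simp add: lam_bif_eq)
    then have "kan_lam_cls X A F Zs d (As, tup_act Zs fs zs, y) =
        cls (bang X A) (kan_bif F (lam_ob X A Zs) d)
          (As, cls (pow A (length Zs)) (lam_bif X A Zs As) (Bs, zs, par A fs), y)"
      by (simp add: kan_lam_cls_def)
    also have "\<dots> = kan_lam_cls X A F Zs d (Bs, zs, NAt (FA F (par A fs)) d y)"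
      by (rule kan_lam_cls_eq[OF Zs d *(3,5,6) par *(7)])
    finally show "kan_lam_cls X A F Zs d (As, tup_act Zs fs zs, y) =
        kan_lam_cls X A F Zs d (Bs, zs, NAt (FA F (par A fs)) d y)" .
  qed
  then show "mid_cls A F Zs d p = mid_cls A F Zs d p' \<Longrightarrow> kan_lam_cls X A F Zs d p = kan_lam_cls X A F Zs d p'"
    unfolding mid_cls_def by (rule cowedge_eq)
next
  \<comment> \<open>the inverse comparison, as a function on representatives of the outer coend\<close>
  define h where "h = (\<lambda>(As', K, y). clift (pow A (length Zs)) (lam_bif X A Zs As')
    (\<lambda>(As, zs, v). mid_cls A F Zs d (As, zs, NAt (FA F v) d y)) K)"
  have h: "h (As', cls (pow A (length Zs)) (lam_bif X A Zs As') (As, zs, v), y) =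
      mid_cls A F Zs d (As, zs, NAt (FA F v) d y)"
    if y: "y \<in> At (FO F As') d" and As: "As \<in> lists (Obj A)" "length As = length Zs" "zs \<in> tup_at Zs As"
      and v: "v \<in> Hom (bang X A) As' As" for As' As zs v y
  proof -
    have As': "As' \<in> lists (Obj A)" using v by (simp add: Hom_bang_iff)
    interpret L: tup_coend A Zs "length Zs" "Hom (bang X A) As'" "\<lambda>gs u. par A gs \<cdot>\<^bsub>bang X A\<^esub> u"
      by (rule tup_coend_lam[OF X category_A As' Zs])
    have "cowedge (pow A (length Zs)) (lam_bif X A Zs As') (\<lambda>(As, zs, v). mid_cls A F Zs d (As, zs, NAt (FA F v) d y))"
      unfolding lam_bif_eq
    proof (rule L.cowedgeI)
      fix fs As Bs zs v
      assume *: "fs \<in> Hom (pow A (length Zs)) As Bs" "zs \<in> tup_at Zs Bs" "v \<in> Hom (bang X A) As' As"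
      show "(case (As, tup_act Zs fs zs, v) of (As, zs, v) \<Rightarrow> mid_cls A F Zs d (As, zs, NAt (FA F v) d y)) =
          (case (Bs, zs, par A fs \<cdot>\<^bsub>bang X A\<^esub> v) of (As, zs, v) \<Rightarrow> mid_cls A F Zs d (As, zs, NAt (FA F v) d y))"
        using mid_step[OF Zs d *(1,2) psh_functor(2)[OF F *(3) d y]]
          psh_functor(4)[OF F *(3) par_in[OF X category_A *(1)] d y] by simp
    qed
    from clift_cls[OF this, of "(As, zs, v)"] show ?thesis
      using As v by (simp add: h_def gens_lam)
  qed
  have "cowedge (bang X A) (kan_bif F (lam_ob X A Zs) d) h"
  proof (rule cowedge_kanI[OF F presheaf_lam[OF X category_A Zs] d])
    fix f Bs Bs' K y assume f: "f \<in> Hom (bang X A) Bs Bs'" and K_in: "K \<in> At (lam_ob X A Zs) Bs'"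
      and y: "y \<in> At (FO F Bs) d"
    have Bs': "Bs' \<in> lists (Obj A)" using f by (simp add: Hom_bang_iff)
    obtain As zs v
      where K: "K = cls (pow A (length Zs)) (lam_bif X A Zs Bs') (As, zs, v)"
        and As: "As \<in> lists (Obj A)" "length As = length Zs" "zs \<in> tup_at Zs As" and v: "v \<in> Hom (bang X A) Bs' As"
      using At_lamE[OF Bs' K_in] .
    have "Act (lam_ob X A Zs) f K = cls (pow A (length Zs)) (lam_bif X A Zs Bs) (As, zs, v \<cdot>\<^bsub>bang X A\<^esub> f)"
      using Act_lam[OF X category_A _ f, of Zs "(As, zs, v)"] Zs As v by (simp add: K gens_lam FO_lam)
    then show "h (Bs, Act (lam_ob X A Zs) f K, y) = h (Bs', K, NAt (FA F f) d y)"
      using h[OF y As B.Cmp_in[OF f v]] h[OF psh_functor(2)[OF F f d y] As v]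
        psh_functor(4)[OF F f v d y] by (simp add: K)
  qed
  note inv = cowedge_eq[OF this]
  have h_gen: "h (case q of (As, zs, y) \<Rightarrow> (As, cls (pow A (length Zs)) (lam_bif X A Zs As) (As, zs, Ide (bang X A) As), y)) =
      mid_cls A F Zs d q" if "q \<in> gens (pow A (length Zs)) (mid_bif A F Zs d)" for q
  proof -
    obtain As zs y where q: "q = (As, zs, y)" by (cases q)
    with that have *: "As \<in> lists (Obj A)" "length As = length Zs" "zs \<in> tup_at Zs As" "y \<in> At (FO F As) d"
      by (simp_all add: gens_mid)
    have As: "As \<in> Obj (bang X A)" using *(1) by simp
    show ?thesis
      using h[OF *(4,1-3) B.Ide_in[OF As]] psh_functor(3)[OF F As d *(4)] by (simp add: q)
  qed
  assume "kan_lam_cls X A F Zs d p = kan_lam_cls X A F Zs d p'"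
  then show "mid_cls A F Zs d p = mid_cls A F Zs d p'"
    using inv[of "case p of (As, zs, y) \<Rightarrow> (As, cls (pow A (length Zs)) (lam_bif X A Zs As) (As, zs, Ide (bang X A) As), y)"
        "case p' of (As, zs, y) \<Rightarrow> (As, cls (pow A (length Zs)) (lam_bif X A Zs As) (As, zs, Ide (bang X A) As), y)"]
      h_gen[OF p] h_gen[OF p'] by (simp add: kan_lam_cls_def split_beta)
qed

lemma Act_kan_lam:
  assumes Zs: "Zs \<in> lists {P. is_presheaf A P}" and g: "g \<in> Hom D c d"
    and p: "(As, zs, y) \<in> gens (pow A (length Zs)) (mid_bif A F Zs d)"
  shows "Act (FO (kan (bang X A) D F) (lam_ob X A Zs)) g (kan_lam_cls X A F Zs d (As, zs, y)) =
    kan_lam_cls X A F Zs c (As, zs, Act (FO F As) g y)"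
proof -
  have *: "As \<in> lists (Obj A)" "length As = length Zs" "zs \<in> tup_at Zs As" "y \<in> At (FO F As) d"
    using p by (simp_all add: gens_mid)
  have "Ide (bang X A) As \<in> Hom (bang X A) As As" using B.Ide_in *(1) by simp
  from Act_kan[OF F category_D _ g, of "lam_ob X A Zs" "(As, cls (pow A (length Zs)) (lam_bif X A Zs As) (As, zs, Ide (bang X A) As), y)"]
    lam_cls_in[OF *(1-3) this]
  show ?thesis
    using presheaf_lam[OF X category_A Zs] * by (simp add: kan_lam_cls_def)
qed

lemma NAt_kan_lam:
  assumes h: "h \<in> Hom (bang X (psh A)) Zs Ws" and d: "d \<in> Obj D"
    and p: "(As, zs, y) \<in> gens (pow A (length Zs)) (mid_bif A F Zs d)"
  shows "NAt (FA (kan (bang X A) D F) (FA (lam X A) h)) d (kan_lam_cls X A F Zs d (As, zs, y)) =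
    kan_lam_cls X A F Ws d (map ((!) As) (Wir h),
      map (\<lambda>j. NAt (Lab h ! j) (As ! (Wir h ! j)) (zs ! (Wir h ! j))) [0..<length (Wir h)],
      NAt (FA F (rewire A (Wir h) As)) d y)"
proof -
  have *: "As \<in> lists (Obj A)" "length As = length Zs" "zs \<in> tup_at Zs As" "y \<in> At (FO F As) d"
    using p by (simp_all add: gens_mid)
  have As: "As \<in> Obj (bang X A)" using *(1) by simp
  have Ws: "Ws \<in> lists {P. is_presheaf A P}" using h by (simp add: Hom_bang_iff)
  note I = B.Ide_in[OF As]
  have w: "wiring X (length As) (Wir h)" using h *(2) by (simp add: Hom_bang_iff)
  note rew = rewire_in[OF category_A *(1) w]
  have lists: "map ((!) As) (Wir h) \<in> lists (Obj A)" using rew by (simp only: Hom_bang_iff)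
  have "FA (lam X A) h \<in> Hom (psh (bang X A)) (lam_ob X A Zs) (lam_ob X A Ws)"
    using is_functor.FA_in[OF is_functor_lam[OF X category_A] h] by (simp add: FO_lam)
  from NAt_kan[OF F category_D this d, of "(As, cls (pow A (length Zs)) (lam_bif X A Zs As) (As, zs, Ide (bang X A) As), y)"]
  have "NAt (FA (kan (bang X A) D F) (FA (lam X A) h)) d (kan_lam_cls X A F Zs d (As, zs, y)) =
      cls (bang X A) (kan_bif F (lam_ob X A Ws) d)
        (As, NAt (FA (lam X A) h) As (cls (pow A (length Zs)) (lam_bif X A Zs As) (As, zs, Ide (bang X A) As)), y)"
    using lam_cls_in[OF *(1-3) I] * by (simp add: kan_lam_cls_def)
  also have "NAt (FA (lam X A) h) As (cls (pow A (length Zs)) (lam_bif X A Zs As) (As, zs, Ide (bang X A) As)) =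
      cls (pow A (length Ws)) (lam_bif X A Ws As) (map ((!) As) (Wir h),
        map (\<lambda>j. NAt (Lab h ! j) (As ! (Wir h ! j)) (zs ! (Wir h ! j))) [0..<length (Wir h)], rewire A (Wir h) As)"
    using NAt_lam[OF X category_A h As, of "(As, zs, Ide (bang X A) As)"] * I B.Cmp_Ide[OF rew]
    by (simp add: gens_lam lam_wire_def)
  also have "cls (bang X A) (kan_bif F (lam_ob X A Ws) d) (As, \<dots>, y) =
      kan_lam_cls X A F Ws d (map ((!) As) (Wir h),
        map (\<lambda>j. NAt (Lab h ! j) (As ! (Wir h ! j)) (zs ! (Wir h ! j))) [0..<length (Wir h)],
        NAt (FA F (rewire A (Wir h) As)) d y)"
    using Hom_bangD(3)[OF h]
    by (intro kan_lam_cls_eq[OF Ws d lists _ lam_tup_in[OF category_A h *(1-3)] rew *(4)]) simp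
  finally show ?thesis .
qed

end

section \<open>Compatibility with the Kleisli extension\<close>

text \<open>The tuple \<open>[A\<^sub>1, z\<^sub>1, y\<^sub>1], \<dots>, [A\<^sub>n, z\<^sub>n, y\<^sub>n]\<close> of elements of the Kleisli extensions of \<open>Z\<^sub>1, \<dots>, Z\<^sub>n\<close> at
\<open>D\<^sub>1, \<dots>, D\<^sub>n\<close>.\<close>

definition kan_tuple :: "('o, 'a) cat \<Rightarrow> ('o, 'a, ('p, 'b, 'y) presheaf, ('p, 'b, 'y) ptrans) fctr
    \<Rightarrow> ('o, 'a, 'x) presheaf list \<Rightarrow> 'p list \<Rightarrow> 'o list \<Rightarrow> 'x list \<Rightarrow> 'y list \<Rightarrow> ('o \<times> 'x \<times> 'y) set list" where
  "kan_tuple A g Zs Ds As zs ys = map (\<lambda>i. cls A (kan_bif g (Zs ! i) (Ds ! i)) (As ! i, zs ! i, ys ! i)) [0..<length Zs]"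

locale kleisli_ext = src: category A + tgt: category B
  for A :: "('o, 'a) cat" and B :: "('p, 'b) cat" +
  fixes X :: "combinator set" and g :: "('o, 'a, ('p, 'b, 'y) presheaf, ('p, 'b, 'y) ptrans) fctr"
  assumes wX: "wirable X" and g: "is_functor A (psh B) g"
begin

lemma catA: "category A" by (rule src.category_axioms)

lemma catB: "category B" by (rule tgt.category_axioms)

sublocale BB: category "bang X B" by (rule category_bang[OF wX catB])

lemma bang_g: "is_functor (bang X A) (bang X (psh B)) (bang_map g)"
  by (rule is_functor_bang_map[OF wX g])

sublocale kan_lam A "bang X B" X "lam X B \<odot> bang_map g"
  by (intro kan_lam.intro catA BB.category_axioms kan_lam_axioms.intro wX
      is_functor_fcomp[OF bang_g is_functor_lam[OF wX catB]])

abbreviation "lam_g \<equiv> lam X B \<odot> bang_map g"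

lemma FO_lam_g: "FO lam_g As = lam_ob X B (map (FO g) As)"
  by (simp add: FO_lam) (simp add: bang_map_def)

lemma lists_g: "As \<in> lists (Obj A) \<Longrightarrow> map (FO g) As \<in> lists {P. is_presheaf B P}"
  using psh_functor(1)[OF g] by auto

lemma lists_kan:
  fixes Zs :: "('o, 'a, 'x) presheaf list"
  assumes "Zs \<in> lists {P. is_presheaf A P}"
  shows "map (FO (kan A B g)) Zs \<in> lists {P. is_presheaf B P}"
proof -
  have "is_functor (psh A) (psh B) (kan A B g :: (('o, 'a, 'x) presheaf, _, _, _) fctr)"
    by (rule is_functor_kan[OF g catB])
  from psh_functor(1)[OF this] show ?thesis using assms by auto
qed

lemma kan_tuple_in:
  assumes "As \<in> lists (Obj A)" "length As = length Zs" "Ds \<in> lists (Obj B)" "length Ds = length Zs"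
    and "zs \<in> tup_at Zs As" "ys \<in> tup_at (map (FO g) As) Ds"
  shows "kan_tuple A g Zs Ds As zs ys \<in> tup_at (map (FO (kan A B g)) Zs) Ds"
proof -
  have "cls A (kan_bif g (Zs ! i) (Ds ! i)) (As ! i, zs ! i, ys ! i) \<in> At (FO (kan A B g) (Zs ! i)) (Ds ! i)"
    if i: "i < length Zs" for i
  proof -
    have "Ds ! i \<in> Obj B" "As ! i \<in> Obj A" using lists_nth assms(1-4) i by metis+
    moreover have "ys ! i \<in> At (FO g (As ! i)) (Ds ! i)" "zs ! i \<in> At (Zs ! i) (As ! i)"
      using tup_atD(2)[OF assms(6), of i] tup_atD(2)[OF assms(5) i] i assms(2) by simp_all
    ultimately show ?thesis by (simp add: At_kan)
  qed
  then show ?thesis by (simp add: tup_at_def kan_tuple_def)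
qed

lemma kan_tupleE:
  fixes Zs :: "('o, 'a, 'x) presheaf list"
  assumes Ds: "Ds \<in> lists (Obj B)" "length Ds = length Zs"
    and Ks: "Ks \<in> tup_at (map (FO (kan A B g)) Zs) Ds"
  obtains As zs ys where "As \<in> lists (Obj A)" "length As = length Zs" "zs \<in> tup_at Zs As"
    "ys \<in> tup_at (map (FO g) As) Ds" "Ks = kan_tuple A g Zs Ds As zs ys"
proof -
  have "\<exists>p. p \<in> gens A (kan_bif g (Zs ! i) (Ds ! i)) \<and> Ks ! i = cls A (kan_bif g (Zs ! i) (Ds ! i)) p"
    if i: "i < length Zs" for i
  proof -
    have "Ks ! i \<in> At (FO (kan A B g) (Zs ! i)) (Ds ! i)" using tup_atD(2)[OF Ks, of i] i by simp
    moreover have "Ds ! i \<in> Obj B" using lists_nth[OF Ds(1)] Ds(2) i by simp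
    ultimately show ?thesis using At_kan[of "Ds ! i" B A g "Zs ! i"] by blast
  qed
  then obtain p where p: "p i \<in> gens A (kan_bif g (Zs ! i) (Ds ! i))"
      "Ks ! i = cls A (kan_bif g (Zs ! i) (Ds ! i)) (p i)" if "i < length Zs" for i
    by metis
  define As zs ys where "As = map (\<lambda>i. fst (p i)) [0..<length Zs]"
    and "zs = map (\<lambda>i. fst (snd (p i))) [0..<length Zs]" and "ys = map (\<lambda>i. snd (snd (p i))) [0..<length Zs]"
  have p_in: "fst (p i) \<in> Obj A \<and> fst (snd (p i)) \<in> At (Zs ! i) (fst (p i)) \<and>
      snd (snd (p i)) \<in> At (FO g (fst (p i))) (Ds ! i)" if "i < length Zs" for i
    using p(1)[OF that] by (cases "p i") simp
  show ?thesis
  proof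
    show "As \<in> lists (Obj A)" using p_in by (auto simp: As_def)
    show "length As = length Zs" by (simp add: As_def)
    show "zs \<in> tup_at Zs As" using p_in by (simp add: tup_at_def As_def zs_def)
    show "ys \<in> tup_at (map (FO g) As) Ds" using p_in by (simp add: tup_at_def As_def ys_def)
    show "Ks = kan_tuple A g Zs Ds As zs ys"
      using tup_atD(1)[OF Ks] p(2)
      by (intro nth_equalityI) (simp_all add: kan_tuple_def As_def zs_def ys_def)
  qed
qed

lemma kan_tuple_act:
  fixes Zs :: "('o, 'a, 'x) presheaf list"
  assumes Zs: "Zs \<in> lists {P. is_presheaf A P}" and As: "As \<in> lists (Obj A)" "length As = length Zs"
    and fs: "fs \<in> Hom (pow B (length Zs)) Ds Es"
    and zs: "zs \<in> tup_at Zs As" and ys: "ys \<in> tup_at (map (FO g) As) Es"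
  shows "tup_act (map (FO (kan A B g)) Zs) fs (kan_tuple A g Zs Es As zs ys) =
    kan_tuple A g Zs Ds As zs (tup_act (map (FO g) As) fs ys)"
proof (rule nth_equalityI)
  fix i assume "i < length (tup_act (map (FO (kan A B g)) Zs) fs (kan_tuple A g Zs Es As zs ys))"
  then have i: "i < length Zs" by (simp add: tup_act_def)
  have f: "fs ! i \<in> Hom B (Ds ! i) (Es ! i)" using fs i by (simp add: Hom_pow_iff)
  have "As ! i \<in> Obj A" using lists_nth[OF As(1)] As(2) i by simp
  moreover have "ys ! i \<in> At (FO g (As ! i)) (Es ! i)" "zs ! i \<in> At (Zs ! i) (As ! i)"
    using tup_atD(2)[OF ys, of i] tup_atD(2)[OF zs i] i As(2) by simp_all
  moreover have "is_presheaf A (Zs ! i)" using lists_nth[OF Zs i] by simp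
  ultimately show "tup_act (map (FO (kan A B g)) Zs) fs (kan_tuple A g Zs Es As zs ys) ! i =
      kan_tuple A g Zs Ds As zs (tup_act (map (FO g) As) fs ys) ! i"
    using i As(2) Act_kan[OF g catB _ f, of "Zs ! i" "(As ! i, zs ! i, ys ! i)"]
    by (simp add: tup_act_def kan_tuple_def)
qed (simp add: tup_act_def kan_tuple_def)

definition g_act :: "'a list \<Rightarrow> 'p list \<Rightarrow> 'y list \<Rightarrow> 'y list" where
  "g_act fs Ds ys = map (\<lambda>i. NAt (FA g (fs ! i)) (Ds ! i) (ys ! i)) [0..<length fs]"

lemma kan_tuple_step:
  fixes Zs :: "('o, 'a, 'x) presheaf list"
  assumes Zs: "Zs \<in> lists {P. is_presheaf A P}" and Ds: "Ds \<in> lists (Obj B)" "length Ds = length Zs"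
    and fs: "fs \<in> Hom (pow A (length Zs)) As As'"
    and zs: "zs \<in> tup_at Zs As'" and ys: "ys \<in> tup_at (map (FO g) As) Ds"
  shows "kan_tuple A g Zs Ds As (tup_act Zs fs zs) ys = kan_tuple A g Zs Ds As' zs (g_act fs Ds ys)"
proof (rule nth_equalityI)
  fix i assume "i < length (kan_tuple A g Zs Ds As (tup_act Zs fs zs) ys)"
  then have i: "i < length Zs" by (simp add: kan_tuple_def)
  have f: "fs ! i \<in> Hom A (As ! i) (As' ! i)" and len: "length fs = length Zs" "length As = length Zs"
    using fs i by (simp_all add: Hom_pow_iff)
  have "ys ! i \<in> At (FO g (As ! i)) (Ds ! i)" using tup_atD(2)[OF ys, of i] i len by simp
  moreover have "is_presheaf A (Zs ! i)" "Ds ! i \<in> Obj B"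
    using lists_nth[OF Zs i] lists_nth[OF Ds(1)] Ds(2) i by simp_all
  ultimately show "kan_tuple A g Zs Ds As (tup_act Zs fs zs) ys ! i = kan_tuple A g Zs Ds As' zs (g_act fs Ds ys) ! i"
    using i len cls_kan_step[OF g _ _ f tup_atD(2)[OF zs i], of "Ds ! i" "ys ! i"]
    by (simp add: tup_act_def kan_tuple_def g_act_def)
qed (simp add: kan_tuple_def)

lemma g_act_in:
  assumes fs: "fs \<in> Hom (pow A n) As As'" and Ds: "Ds \<in> lists (Obj B)" "length Ds = n"
    and ys: "ys \<in> tup_at (map (FO g) As) Ds"
  shows "g_act fs Ds ys \<in> tup_at (map (FO g) As') Ds"
proof -
  have len: "length fs = n" "length As = n" "length As' = n" using fs by (simp_all add: Hom_pow_iff)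
  have "NAt (FA g (fs ! i)) (Ds ! i) (ys ! i) \<in> At (FO g (As' ! i)) (Ds ! i)" if i: "i < n" for i
  proof -
    have "fs ! i \<in> Hom A (As ! i) (As' ! i)" using fs i by (simp add: Hom_pow_iff)
    moreover have "Ds ! i \<in> Obj B" using lists_nth[OF Ds(1)] Ds(2) i by simp
    moreover have "ys ! i \<in> At (FO g (As ! i)) (Ds ! i)" using tup_atD(2)[OF ys, of i] i len by simp
    ultimately show ?thesis by (rule psh_functor(2)[OF g])
  qed
  then show ?thesis using len by (simp add: tup_at_def g_act_def)
qed

lemma Act_lam_g:
  assumes As: "As \<in> lists (Obj A)" and h: "h \<in> Hom (bang X B) Bs Cs" and Ds: "Ds \<in> lists (Obj B)" "length Ds = length As"
    and ys: "ys \<in> tup_at (map (FO g) As) Ds" and u: "u \<in> Hom (bang X B) Cs Ds"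
  shows "Act (lam_ob X B (map (FO g) As)) h (cls (pow B (length As)) (lam_bif X B (map (FO g) As) Cs) (Ds, ys, u)) =
    cls (pow B (length As)) (lam_bif X B (map (FO g) As) Bs) (Ds, ys, u \<cdot>\<^bsub>bang X B\<^esub> h)"
  using Act_lam[OF wX catB _ h, of "map (FO g) As" "(Ds, ys, u)"] lists_g[OF As] Ds ys u
  by (simp add: gens_lam FO_lam)

lemma NAt_lam_g:
  assumes v: "v \<in> Hom (bang X A) As As'" and Bs: "Bs \<in> lists (Obj B)"
    and Ds: "Ds \<in> lists (Obj B)" "length Ds = length As"
    and ys: "ys \<in> tup_at (map (FO g) As) Ds" and u: "u \<in> Hom (bang X B) Bs Ds"
  shows "NAt (FA lam_g v) Bs (cls (pow B (length As)) (lam_bif X B (map (FO g) As) Bs) (Ds, ys, u)) =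
    cls (pow B (length As')) (lam_bif X B (map (FO g) As') Bs)
      (map ((!) Ds) (Wir v), map (\<lambda>j. NAt (FA g (Lab v ! j)) (Ds ! (Wir v ! j)) (ys ! (Wir v ! j))) [0..<length As'],
       rewire B (Wir v) Ds \<cdot>\<^bsub>bang X B\<^esub> u)"
proof -
  have gv: "FA (bang_map g) v \<in> Hom (bang X (psh B)) (map (FO g) As) (map (FO g) As')"
    using is_functor.FA_in[OF bang_g v] by (simp add: bang_map_def)
  have "lam_wire X B (FA (bang_map g) v) (Ds, ys, u) =
      (map ((!) Ds) (Wir v), map (\<lambda>j. NAt (FA g (Lab v ! j)) (Ds ! (Wir v ! j)) (ys ! (Wir v ! j))) [0..<length As'],
       rewire B (Wir v) Ds \<cdot>\<^bsub>bang X B\<^esub> u)"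
    using Hom_bangD(3,4)[OF v] by (simp add: lam_wire_def bang_map_def)
  then show ?thesis
    using NAt_lam[OF wX catB gv, of Bs "(Ds, ys, u)"] Bs Ds ys u
    by (simp add: gens_lam)
qed

text \<open>Labels only act on the elements \<open>ys\<close>: the wiring of \<open>par A fs\<close> is the identity.\<close>

lemma NAt_lam_g_par:
  assumes fs: "fs \<in> Hom (pow A n) As As'" and Bs: "Bs \<in> lists (Obj B)"
    and Ds: "Ds \<in> lists (Obj B)" "length Ds = n"
    and ys: "ys \<in> tup_at (map (FO g) As) Ds" and u: "u \<in> Hom (bang X B) Bs Ds"
  shows "NAt (FA lam_g (par A fs)) Bs (cls (pow B n) (lam_bif X B (map (FO g) As) Bs) (Ds, ys, u)) =
    cls (pow B n) (lam_bif X B (map (FO g) As') Bs) (Ds, g_act fs Ds ys, u)"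
proof -
  have len: "length fs = n" "length As = n" "length As' = n" using fs by (simp_all add: Hom_pow_iff)
  have "map ((!) Ds) [0..<n] = Ds" using map_nth[of Ds] Ds(2) by simp
  moreover have "rewire B [0..<n] Ds = Ide (bang X B) Ds" by (rule rewire_upt) (simp add: Ds)
  then have "rewire B [0..<n] Ds \<cdot>\<^bsub>bang X B\<^esub> u = u" by (simp only: BB.Ide_Cmp[OF u])
  moreover have "map (\<lambda>j. NAt (FA g (fs ! j)) (Ds ! ([0..<n] ! j)) (ys ! ([0..<n] ! j))) [0..<n] = g_act fs Ds ys"
    using len by (intro nth_equalityI) (simp_all add: g_act_def)
  ultimately show ?thesis
    using NAt_lam_g[OF par_in[OF wX catA fs] Bs Ds(1) _ ys u] Ds(2) len by simp
qed

text \<open>A generator \<open>(Ds, As, zs, ys, u)\<close> represents \<open>[Ds, [A\<^sub>i, z\<^sub>i, y\<^sub>i]\<^sub>i, u]\<close> on the left side (\<open>ext_src\<close>) and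
\<open>[As, zs, [Ds, ys, u]]\<close> in the reduced right side (\<open>ext_mid\<close>): the two orders of integration.\<close>

definition ext_gens :: "('o, 'a, 'x) presheaf list \<Rightarrow> 'p list
    \<Rightarrow> ('p list \<times> 'o list \<times> 'x list \<times> 'y list \<times> ('p, 'b) barr) set" where
  "ext_gens Zs Bs = {(Ds, As, zs, ys, u). Ds \<in> lists (Obj B) \<and> length Ds = length Zs \<and>
     As \<in> lists (Obj A) \<and> length As = length Zs \<and> zs \<in> tup_at Zs As \<and>
     ys \<in> tup_at (map (FO g) As) Ds \<and> u \<in> Hom (bang X B) Bs Ds}"

definition ext_src :: "('o, 'a, 'x) presheaf list \<Rightarrow> 'p list
    \<Rightarrow> 'p list \<times> 'o list \<times> 'x list \<times> 'y list \<times> ('p, 'b) barr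
    \<Rightarrow> ('p list \<times> ('o \<times> 'x \<times> 'y) set list \<times> ('p, 'b) barr) set" where
  "ext_src Zs Bs = (\<lambda>(Ds, As, zs, ys, u). cls (pow B (length Zs)) (lam_bif X B (map (FO (kan A B g)) Zs) Bs)
     (Ds, kan_tuple A g Zs Ds As zs ys, u))"

definition ext_mid :: "'p list \<Rightarrow> 'p list \<times> 'o list \<times> 'x list \<times> 'y list \<times> ('p, 'b) barr
    \<Rightarrow> 'o list \<times> 'x list \<times> ('p list \<times> 'y list \<times> ('p, 'b) barr) set" where
  "ext_mid Bs = (\<lambda>(Ds, As, zs, ys, u).
     (As, zs, cls (pow B (length As)) (lam_bif X B (map (FO g) As) Bs) (Ds, ys, u)))"

lemma tup_kan:
  fixes Zs :: "('o, 'a, 'x) presheaf list"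
  assumes "Zs \<in> lists {P. is_presheaf A P}" "Bs \<in> lists (Obj B)"
  shows "tup_coend B (map (FO (kan A B g)) Zs) (length Zs) (Hom (bang X B) Bs) (\<lambda>gs u. par B gs \<cdot>\<^bsub>bang X B\<^esub> u)"
  using tup_coend_lam[OF wX catB assms(2) lists_kan[OF assms(1)]] by simp

lemma tup_g:
  assumes "As \<in> lists (Obj A)" "Bs \<in> lists (Obj B)"
  shows "tup_coend B (map (FO g) As) (length As) (Hom (bang X B) Bs) (\<lambda>gs u. par B gs \<cdot>\<^bsub>bang X B\<^esub> u)"
  using tup_coend_lam[OF wX catB assms(2) lists_g[OF assms(1)]] by simp

lemma ext_mid_in:
  assumes "x \<in> ext_gens Zs Bs"
  shows "ext_mid Bs x \<in> gens (pow A (length Zs)) (mid_bif A lam_g Zs Bs)"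
proof -
  obtain Ds As zs ys u where x: "x = (Ds, As, zs, ys, u)" by (cases x)
  with assms show ?thesis
    using lam_cls_in[of Ds B "map (FO g) As" ys u X Bs]
    by (simp add: ext_gens_def ext_mid_def gens_mid FO_lam_g[unfolded fcomp_sel])
qed

text \<open>The interchange from left to right.  It has to be independent of the representatives of all the
inner classes and of the outer class: an inner slide along \<open>A\<^sup>n\<close> becomes an outer slide of the reduced
right side, and an outer slide along \<open>B\<^sup>n\<close> becomes an equality of the inner classes there.\<close>

lemma ext_src_imp_mid:
  fixes Zs :: "('o, 'a, 'x) presheaf list"
  assumes Zs: "Zs \<in> lists {P. is_presheaf A P}" and Bs: "Bs \<in> lists (Obj B)"
    and x: "x \<in> ext_gens Zs Bs" and x': "x' \<in> ext_gens Zs Bs" and eq: "ext_src Zs Bs x = ext_src Zs Bs x'"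
  shows "mid_cls A lam_g Zs Bs (ext_mid Bs x) = mid_cls A lam_g Zs Bs (ext_mid Bs x')"
proof -
  let ?n = "length Zs"
  interpret T: tup_coend B "map (FO (kan A B g)) Zs" ?n "Hom (bang X B) Bs" "\<lambda>gs u. par B gs \<cdot>\<^bsub>bang X B\<^esub> u"
    by (rule tup_kan[OF Zs Bs])
  have Bs': "Bs \<in> Obj (bang X B)" using Bs by simp
  \<comment> \<open>the interchange as a function of representatives \<open>ps\<close> of the inner classes, then of the classes\<close>
  define k where "k Ds u ps = mid_cls A lam_g Zs Bs (ext_mid Bs (Ds, map fst ps, map (\<lambda>p. fst (snd p)) ps, map (\<lambda>p. snd (snd p)) ps, u))"
    for Ds u and ps :: "('o \<times> 'x \<times> 'y) list"
  define h where "h = (\<lambda>(Ds, Ks, u). tlift (\<lambda>_. A) (\<lambda>i. kan_bif g (Zs ! i) (Ds ! i)) (k Ds u) Ks)"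
  have h: "h (Ds, kan_tuple A g Zs Ds As zs ys, u) = mid_cls A lam_g Zs Bs (ext_mid Bs (Ds, As, zs, ys, u))"
    if "(Ds, As, zs, ys, u) \<in> ext_gens Zs Bs" for Ds As zs ys u
  proof -
    from that have Ds: "Ds \<in> lists (Obj B)" "length Ds = ?n" and As: "As \<in> lists (Obj A)" "length As = ?n"
      and zs: "zs \<in> tup_at Zs As" and ys: "ys \<in> tup_at (map (FO g) As) Ds" and u: "u \<in> Hom (bang X B) Bs Ds"
      by (simp_all add: ext_gens_def)
    have Ds_i: "Ds ! i \<in> Obj B" if "i < ?n" for i using lists_nth[OF Ds(1)] Ds(2) that by simp
    have Zs_i: "is_presheaf A (Zs ! i)" if "i < ?n" for i using lists_nth[OF Zs that] by simp
    let ?ps = "map (\<lambda>i. (As ! i, zs ! i, ys ! i)) [0..<?n]"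
    have "tlift (\<lambda>_. A) (\<lambda>i. kan_bif g (Zs ! i) (Ds ! i)) (k Ds u) (map (\<lambda>i. cls A (kan_bif g (Zs ! i) (Ds ! i)) (?ps ! i)) [0..<?n]) = k Ds u ?ps"
    proof (rule tlift_cls)
      show "Ide A c \<in> Hom A c c" if "c \<in> Obj A" for c
        by (rule src.Ide_in[OF that])
      show "BA (kan_bif g (Zs ! i) (Ds ! i)) (Ide A c) (Ide A c) t = t"
        if "i < ?n" "c \<in> Obj A" "t \<in> BO (kan_bif g (Zs ! i) (Ds ! i)) c c" for i c t
        by (rule BA_kan_Ide[OF g Zs_i[OF that(1)] Ds_i[OF that(1)] that(2,3)])
      show "?ps ! i \<in> gens A (kan_bif g (Zs ! i) (Ds ! i))" if "i < ?n" for i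
        using that lists_nth[OF As(1)] As(2) tup_atD(2)[OF zs] tup_atD(2)[OF ys, of i] by simp
    next
      fix fs cs cs' and ts :: "('x \<times> 'y) list"
      assume len: "length fs = ?n" "length cs = ?n" "length cs' = ?n" "length ts = ?n"
        and fs_i: "\<And>i. i < ?n \<Longrightarrow> fs ! i \<in> Hom A (cs ! i) (cs' ! i)"
        and ts_i: "\<And>i. i < ?n \<Longrightarrow> ts ! i \<in> BO (kan_bif g (Zs ! i) (Ds ! i)) (cs' ! i) (cs ! i)"
      have fs: "fs \<in> Hom (pow A ?n) cs cs'" using len fs_i by (simp add: Hom_pow_iff)
      note cs = Hom_pow_lists(1,2)[OF catA fs]
      define zs ys where "zs = map fst ts" and "ys = map snd ts"
      have ts_split: "ts ! i = (zs ! i, ys ! i)" if "i < ?n" for i using that len by (simp add: zs_def ys_def)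
      have len': "length zs = ?n" "length ys = ?n" using len by (simp_all add: zs_def ys_def)
      have zs: "zs \<in> tup_at Zs cs'" and ys: "ys \<in> tup_at (map (FO g) cs) Ds"
        using ts_i ts_split len len' by (simp_all add: tup_at_def)
      have Ide: "NAt (FA g (Ide A (cs ! i))) (Ds ! i) (ys ! i) = ys ! i" "Act (Zs ! i) (Ide A (cs' ! i)) (zs ! i) = zs ! i"
        if "i < ?n" for i
        using psh_functor(3)[OF g _ Ds_i[OF that]] is_presheaf.Act_Ide[OF Zs_i[OF that]] lists_nth[OF cs(1)] lists_nth[OF cs(2)]
          tup_atD(2)[OF zs that] tup_atD(2)[OF ys, of i] len that by simp_all
      let ?L = "map (\<lambda>i. (cs ! i, BA (kan_bif g (Zs ! i) (Ds ! i)) (fs ! i) (Ide A (cs ! i)) (ts ! i))) [0..<?n]"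
      let ?R = "map (\<lambda>i. (cs' ! i, BA (kan_bif g (Zs ! i) (Ds ! i)) (Ide A (cs' ! i)) (fs ! i) (ts ! i))) [0..<?n]"
      have "map fst ?L = cs" "map (\<lambda>p. fst (snd p)) ?L = tup_act Zs fs zs" "map (\<lambda>p. snd (snd p)) ?L = ys"
        using len len' Ide ts_split by (auto intro!: nth_equalityI simp: tup_act_def)
      moreover have "map fst ?R = cs'" "map (\<lambda>p. fst (snd p)) ?R = zs" "map (\<lambda>p. snd (snd p)) ?R = g_act fs Ds ys"
        using len len' Ide ts_split by (auto intro!: nth_equalityI simp: g_act_def)
      moreover have "mid_cls A lam_g Zs Bs (ext_mid Bs (Ds, cs, tup_act Zs fs zs, ys, u)) =
          mid_cls A lam_g Zs Bs (ext_mid Bs (Ds, cs', zs, g_act fs Ds ys, u))"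
        using mid_step[OF Zs Bs' fs zs, of "cls (pow B ?n) (lam_bif X B (map (FO g) cs) Bs) (Ds, ys, u)"]
          lam_cls_in[of Ds B "map (FO g) cs" ys u X Bs] Ds ys u len NAt_lam_g_par[OF fs Bs Ds ys u]
        by (simp add: ext_mid_def FO_lam_g[unfolded fcomp_sel])
      ultimately show "k Ds u ?L = k Ds u ?R" by (simp only: k_def)
    qed simp
    moreover have "map fst ?ps = As" "map (\<lambda>p. fst (snd p)) ?ps = zs" "map (\<lambda>p. snd (snd p)) ?ps = ys"
      using As(2) tup_atD(1)[OF zs] tup_atD(1)[OF ys] by (auto intro!: nth_equalityI)
    moreover have "map (\<lambda>i. cls A (kan_bif g (Zs ! i) (Ds ! i)) (?ps ! i)) [0..<?n] = kan_tuple A g Zs Ds As zs ys"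
      by (intro nth_equalityI) (simp_all add: kan_tuple_def)
    ultimately show ?thesis by (simp only: h_def k_def prod.case)
  qed
  have "cowedge (pow B ?n) (lam_bif X B (map (FO (kan A B g)) Zs) Bs) h"
    unfolding lam_bif_eq
  proof (rule T.cowedgeI)
    fix fs Ds Es Ks u
    assume fs: "fs \<in> Hom (pow B ?n) Ds Es" and Ds: "Ds \<in> lists (Obj B)" "length Ds = ?n"
      and Es: "Es \<in> lists (Obj B)" "length Es = ?n"
      and Ks: "Ks \<in> tup_at (map (FO (kan A B g)) Zs) Es" and u: "u \<in> Hom (bang X B) Bs Ds"
    obtain As zs ys where As: "As \<in> lists (Obj A)" "length As = ?n" and zs: "zs \<in> tup_at Zs As"
      and ys: "ys \<in> tup_at (map (FO g) As) Es" and K: "Ks = kan_tuple A g Zs Es As zs ys"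
      using kan_tupleE[OF Es Ks] .
    interpret L: tup_coend B "map (FO g) As" "length As" "Hom (bang X B) Bs" "\<lambda>gs u. par B gs \<cdot>\<^bsub>bang X B\<^esub> u"
      by (rule tup_g[OF As(1) Bs])
    have fs': "fs \<in> Hom (pow B (length As)) Ds Es" using fs As by simp
    have "(Ds, As, zs, tup_act (map (FO g) As) fs ys, u) \<in> ext_gens Zs Bs"
      using Ds As zs L.act_in[OF fs' ys] u by (simp add: ext_gens_def)
    moreover have "(Es, As, zs, ys, par B fs \<cdot>\<^bsub>bang X B\<^esub> u) \<in> ext_gens Zs Bs"
      using Es As zs ys BB.Cmp_in[OF u par_in[OF wX catB fs]] by (simp add: ext_gens_def)
    moreover have "ext_mid Bs (Ds, As, zs, tup_act (map (FO g) As) fs ys, u) = ext_mid Bs (Es, As, zs, ys, par B fs \<cdot>\<^bsub>bang X B\<^esub> u)"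
      using L.step[OF fs' ys u] by (simp add: ext_mid_def lam_bif_eq)
    ultimately show "h (Ds, tup_act (map (FO (kan A B g)) Zs) fs Ks, u) = h (Es, Ks, par B fs \<cdot>\<^bsub>bang X B\<^esub> u)"
      by (simp only: K kan_tuple_act[OF Zs As fs zs ys] h)
  qed
  note inv = cowedge_eq[OF this]
  obtain Ds As zs ys u where xe: "x = (Ds, As, zs, ys, u)" by (cases x)
  obtain Ds' As' zs' ys' u' where xe': "x' = (Ds', As', zs', ys', u')" by (cases x')
  have "h (Ds, kan_tuple A g Zs Ds As zs ys, u) = h (Ds', kan_tuple A g Zs Ds' As' zs' ys', u')"
    by (rule inv) (use eq in \<open>simp add: ext_src_def xe xe'\<close>)
  then show ?thesis
    using h[OF x[unfolded xe]] h[OF x'[unfolded xe']] by (simp add: xe xe')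
qed

text \<open>The interchange from right to left; the roles of inner and outer slides are exchanged.\<close>

lemma ext_mid_imp_src:
  fixes Zs :: "('o, 'a, 'x) presheaf list"
  assumes Zs: "Zs \<in> lists {P. is_presheaf A P}" and Bs: "Bs \<in> lists (Obj B)"
    and x: "x \<in> ext_gens Zs Bs" and x': "x' \<in> ext_gens Zs Bs"
    and eq: "mid_cls A lam_g Zs Bs (ext_mid Bs x) = mid_cls A lam_g Zs Bs (ext_mid Bs x')"
  shows "ext_src Zs Bs x = ext_src Zs Bs x'"
proof -
  let ?n = "length Zs"
  interpret T: tup_coend B "map (FO (kan A B g)) Zs" ?n "Hom (bang X B) Bs" "\<lambda>gs u. par B gs \<cdot>\<^bsub>bang X B\<^esub> u"
    by (rule tup_kan[OF Zs Bs])
  have Bs': "Bs \<in> Obj (bang X B)" using Bs by simp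
  interpret M: tup_coend A Zs ?n "\<lambda>As. At (FO lam_g As) Bs" "\<lambda>gs. NAt (FA lam_g (par A gs)) Bs"
    by (rule mid_tup[OF Zs Bs'])
  define h where "h = (\<lambda>(As, zs, K). clift (pow B ?n) (lam_bif X B (map (FO g) As) Bs)
    (\<lambda>(Ds, ys, u). ext_src Zs Bs (Ds, As, zs, ys, u)) K)"
  have h: "h (ext_mid Bs y) = ext_src Zs Bs y" if "y \<in> ext_gens Zs Bs" for y
  proof -
    obtain Ds As zs ys u where y: "y = (Ds, As, zs, ys, u)" by (cases y)
    from that have Ds: "Ds \<in> lists (Obj B)" "length Ds = ?n" and As: "As \<in> lists (Obj A)" "length As = ?n"
      and zs: "zs \<in> tup_at Zs As" and ys: "ys \<in> tup_at (map (FO g) As) Ds" and u: "u \<in> Hom (bang X B) Bs Ds"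
      by (simp_all add: ext_gens_def y)
    interpret L: tup_coend B "map (FO g) As" "length As" "Hom (bang X B) Bs" "\<lambda>gs u. par B gs \<cdot>\<^bsub>bang X B\<^esub> u"
      by (rule tup_g[OF As(1) Bs])
    have "cowedge (pow B (length As)) (lam_bif X B (map (FO g) As) Bs) (\<lambda>(Ds, ys, u). ext_src Zs Bs (Ds, As, zs, ys, u))"
      unfolding lam_bif_eq
    proof (rule L.cowedgeI)
      fix fs Ds Es ys u
      assume fs: "fs \<in> Hom (pow B (length As)) Ds Es" and Es: "Es \<in> lists (Obj B)" "length Es = length As"
        and ys: "ys \<in> tup_at (map (FO g) As) Es" and u: "u \<in> Hom (bang X B) Bs Ds"
      have fs': "fs \<in> Hom (pow B ?n) Ds Es" using fs As by simp
      show "(case (Ds, tup_act (map (FO g) As) fs ys, u) of (Ds, ys, u) \<Rightarrow> ext_src Zs Bs (Ds, As, zs, ys, u)) =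
          (case (Es, ys, par B fs \<cdot>\<^bsub>bang X B\<^esub> u) of (Ds, ys, u) \<Rightarrow> ext_src Zs Bs (Ds, As, zs, ys, u))"
        using T.step[OF fs' kan_tuple_in[OF As Es(1) _ zs ys] u] Es(2) As(2) kan_tuple_act[OF Zs As fs' zs ys]
        by (simp add: ext_src_def lam_bif_eq)
    qed
    moreover have "(Ds, ys, u) \<in> gens (pow B (length As)) (lam_bif X B (map (FO g) As) Bs)"
      using Ds As ys u by (simp add: gens_lam)
    ultimately show ?thesis
      using clift_cls As(2) by (fastforce simp: h_def y ext_mid_def)
  qed
  have "cowedge (pow A ?n) (mid_bif A lam_g Zs Bs) h"
    unfolding mid_bif_def
  proof (rule M.cowedgeI)
    fix fs As As' zs K
    assume fs: "fs \<in> Hom (pow A ?n) As As'" and As: "As \<in> lists (Obj A)" "length As = ?n"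
      and As': "As' \<in> lists (Obj A)" "length As' = ?n"
      and zs: "zs \<in> tup_at Zs As'" and "K \<in> At (FO lam_g As) Bs"
    then have K_in: "K \<in> At (lam_ob X B (map (FO g) As)) Bs" by (simp only: FO_lam_g)
    obtain Ds ys u where K: "K = cls (pow B (length As)) (lam_bif X B (map (FO g) As) Bs) (Ds, ys, u)"
      and Ds: "Ds \<in> lists (Obj B)" "length Ds = ?n" and ys: "ys \<in> tup_at (map (FO g) As) Ds"
      and u: "u \<in> Hom (bang X B) Bs Ds"
      using At_lamE[OF Bs K_in] As(2) by (metis length_map)
    have "(Ds, As, tup_act Zs fs zs, ys, u) \<in> ext_gens Zs Bs"
      using Ds As M.act_in[OF fs zs] ys u by (simp add: ext_gens_def)
    moreover have "(Ds, As', zs, g_act fs Ds ys, u) \<in> ext_gens Zs Bs"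
      using Ds As' zs g_act_in[OF fs Ds ys] u by (simp add: ext_gens_def)
    moreover have "(As, tup_act Zs fs zs, K) = ext_mid Bs (Ds, As, tup_act Zs fs zs, ys, u)"
      by (simp add: ext_mid_def K)
    moreover have "(As', zs, NAt (FA lam_g (par A fs)) Bs K) = ext_mid Bs (Ds, As', zs, g_act fs Ds ys, u)"
      using NAt_lam_g_par[OF fs Bs Ds ys u] As As' by (simp add: ext_mid_def K)
    moreover have "ext_src Zs Bs (Ds, As, tup_act Zs fs zs, ys, u) = ext_src Zs Bs (Ds, As', zs, g_act fs Ds ys, u)"
      by (simp add: ext_src_def kan_tuple_step[OF Zs Ds fs zs ys])
    ultimately show "h (As, tup_act Zs fs zs, K) = h (As', zs, NAt (FA lam_g (par A fs)) Bs K)"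
      by (simp only: h)
  qed
  from cowedge_eq[OF this, of "ext_mid Bs x" "ext_mid Bs x'"] eq show ?thesis
    by (simp add: mid_cls_def h[OF x] h[OF x'])
qed

text \<open>Both sides are generated by \<open>ext_gens\<close> and identify the same generators, by the two interchange
lemmas and the co-Yoneda reduction.  Precomposition acts on \<open>u\<close> only, and a wiring \<open>w\<close> acts on
generators by \<open>(Ds \<circ> w, As \<circ> w, zs \<circ> w, ys \<circ> w, w \<circ> u)\<close>, with the labels applied to \<open>zs\<close>.\<close>

lemma ext_psh:
  "\<exists>\<phi>. psh_iso (bang X (psh A)) (bang X B)
      (lam X B \<odot> bang_map (kan A B g :: (('o, 'a, 'x) presheaf, _, _, _) fctr))
      (kan (bang X A) (bang X B) lam_g \<odot> lam X A) \<phi> \<and> canonical_ext_psh X A B g \<phi>"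
proof -
  let ?kan = "kan A B g :: (('o, 'a, 'x) presheaf, _, _, _) fctr"
  have kan: "is_functor (psh A) (psh B) ?kan" by (rule is_functor_kan[OF g catB])
  have bkan: "is_functor (bang X (psh A)) (bang X (psh B)) (bang_map ?kan)"
    by (rule is_functor_bang_map[OF wX kan])
  have FO: "FO (lam X B \<odot> bang_map ?kan) Zs = lam_ob X B (map (FO ?kan) Zs)" for Zs
    by (simp add: FO_lam) (simp add: bang_map_def)
  have FO': "FO (kan (bang X A) (bang X B) lam_g \<odot> lam X A) Zs = FO (kan (bang X A) (bang X B) lam_g) (lam_ob X A Zs)"
    for Zs :: "('o, 'a, 'x) presheaf list" by (simp add: FO_lam)
  let ?r = "\<lambda>Zs Bs x. kan_lam_cls X A lam_g Zs Bs (ext_mid Bs x)"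
  have "\<exists>\<phi>. psh_iso (bang X (psh A)) (bang X B) (lam X B \<odot> bang_map ?kan) (kan (bang X A) (bang X B) lam_g \<odot> lam X A) \<phi> \<and>
    (\<forall>Zs \<in> Obj (bang X (psh A)). \<forall>Bs \<in> Obj (bang X B). \<forall>x \<in> ext_gens Zs Bs. \<phi> Zs Bs (ext_src Zs Bs x) = ?r Zs Bs x)"
  proof (rule psh_isoI_generators[OF is_functor_fcomp[OF bkan is_functor_lam[OF wX catB]]
        is_functor_fcomp[OF is_functor_lam[OF wX catA] is_functor_kan[OF F BB.category_axioms]]])
    fix Zs :: "('o, 'a, 'x) presheaf list" and Bs
    assume "Zs \<in> Obj (bang X (psh A))" and Bs': "Bs \<in> Obj (bang X B)"
    then have Zs: "Zs \<in> lists {P. is_presheaf A P}" and Bs: "Bs \<in> lists (Obj B)" by simp_all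
    show "At (FO (lam X B \<odot> bang_map ?kan) Zs) Bs = ext_src Zs Bs ` ext_gens Zs Bs"
      unfolding FO
    proof (intro equalityI subsetI)
      fix v assume "v \<in> At (lam_ob X B (map (FO ?kan) Zs)) Bs"
      then obtain Ds Ks u where v: "v = cls (pow B (length Zs)) (lam_bif X B (map (FO ?kan) Zs) Bs) (Ds, Ks, u)"
        and Ds: "Ds \<in> lists (Obj B)" "length Ds = length Zs" and Ks: "Ks \<in> tup_at (map (FO ?kan) Zs) Ds"
        and u: "u \<in> Hom (bang X B) Bs Ds"
        using At_lamE[OF Bs] by (metis length_map)
      obtain As zs ys where *: "As \<in> lists (Obj A)" "length As = length Zs" "zs \<in> tup_at Zs As"
        "ys \<in> tup_at (map (FO g) As) Ds" "Ks = kan_tuple A g Zs Ds As zs ys"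
        using kan_tupleE[OF Ds Ks] .
      then have "(Ds, As, zs, ys, u) \<in> ext_gens Zs Bs" "v = ext_src Zs Bs (Ds, As, zs, ys, u)"
        using Ds u by (simp_all add: ext_gens_def ext_src_def v)
      then show "v \<in> ext_src Zs Bs ` ext_gens Zs Bs" by blast
    next
      fix v assume "v \<in> ext_src Zs Bs ` ext_gens Zs Bs"
      then obtain Ds As zs ys u where "(Ds, As, zs, ys, u) \<in> ext_gens Zs Bs" "v = ext_src Zs Bs (Ds, As, zs, ys, u)"
        by auto
      then show "v \<in> At (lam_ob X B (map (FO ?kan) Zs)) Bs"
        using lam_cls_in[of Ds B "map (FO ?kan) Zs" "kan_tuple A g Zs Ds As zs ys" u X Bs]
          kan_tuple_in[of As Zs Ds zs ys] by (simp add: ext_gens_def ext_src_def)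
    qed
    have mid: "gens (pow A (length Zs)) (mid_bif A lam_g Zs Bs) = ext_mid Bs ` ext_gens Zs Bs"
    proof (intro equalityI subsetI)
      fix p assume p: "p \<in> gens (pow A (length Zs)) (mid_bif A lam_g Zs Bs)"
      obtain As zs K where [simp]: "p = (As, zs, K)" by (cases p)
      have As: "As \<in> lists (Obj A)" "length As = length Zs" "zs \<in> tup_at Zs As"
        and K_in: "K \<in> At (lam_ob X B (map (FO g) As)) Bs"
        using p by (simp_all add: gens_mid FO_lam_g[unfolded fcomp_sel])
      obtain Ds ys u where "K = cls (pow B (length As)) (lam_bif X B (map (FO g) As) Bs) (Ds, ys, u)"
        "Ds \<in> lists (Obj B)" "length Ds = length As" "ys \<in> tup_at (map (FO g) As) Ds" "u \<in> Hom (bang X B) Bs Ds"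
        using At_lamE[OF Bs K_in] by (metis length_map)
      then have "(Ds, As, zs, ys, u) \<in> ext_gens Zs Bs" "p = ext_mid Bs (Ds, As, zs, ys, u)"
        using As by (simp_all add: ext_gens_def ext_mid_def)
      then show "p \<in> ext_mid Bs ` ext_gens Zs Bs" by blast
    qed (use ext_mid_in in blast)
    show "At (FO (kan (bang X A) (bang X B) lam_g \<odot> lam X A) Zs) Bs = ?r Zs Bs ` ext_gens Zs Bs"
      unfolding FO' At_kan_lam[OF Zs Bs'] mid by (simp add: image_image)
    show "ext_src Zs Bs x = ext_src Zs Bs x' \<longleftrightarrow> ?r Zs Bs x = ?r Zs Bs x'"
      if "x \<in> ext_gens Zs Bs" "x' \<in> ext_gens Zs Bs" for x x'
      unfolding kan_lam_cls_iff[OF Zs Bs' ext_mid_in[OF that(1)] ext_mid_in[OF that(2)]]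
      using ext_src_imp_mid[OF Zs Bs that] ext_mid_imp_src[OF Zs Bs that] by blast
  next
    fix Zs :: "('o, 'a, 'x) presheaf list" and h Bs Cs x
    assume "Zs \<in> Obj (bang X (psh A))" and h: "h \<in> Hom (bang X B) Bs Cs" and x_in: "x \<in> ext_gens Zs Cs"
    then have Zs: "Zs \<in> lists {P. is_presheaf A P}" by simp
    obtain Ds As zs ys u where x: "x = (Ds, As, zs, ys, u)" by (cases x)
    from x_in have Ds: "Ds \<in> lists (Obj B)" "length Ds = length Zs" and As: "As \<in> lists (Obj A)" "length As = length Zs"
      and zs: "zs \<in> tup_at Zs As" and ys: "ys \<in> tup_at (map (FO g) As) Ds" and u: "u \<in> Hom (bang X B) Cs Ds"
      by (simp_all add: ext_gens_def x)
    let ?x = "(Ds, As, zs, ys, u \<cdot>\<^bsub>bang X B\<^esub> h)"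
    have "?x \<in> ext_gens Zs Bs" using Ds As zs ys BB.Cmp_in[OF h u] by (simp add: ext_gens_def)
    moreover have "Act (lam_ob X B (map (FO ?kan) Zs)) h (ext_src Zs Cs x) = ext_src Zs Bs ?x"
      using Act_lam[OF wX catB _ h, of "map (FO ?kan) Zs" "(Ds, kan_tuple A g Zs Ds As zs ys, u)"] lists_kan[OF Zs]
        kan_tuple_in[OF As Ds zs ys] Ds u
      by (simp add: ext_src_def x gens_lam FO_lam)
    moreover have "Act (FO (kan (bang X A) (bang X B) lam_g) (lam_ob X A Zs)) h (?r Zs Cs x) = ?r Zs Bs ?x"
      using Act_kan_lam[OF Zs h] ext_mid_in[OF x_in] Act_lam_g[OF As(1) h Ds(1) _ ys u] Ds(2) As(2)
      by (simp add: x ext_mid_def FO_lam_g[unfolded fcomp_sel])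
    ultimately show "\<exists>y \<in> ext_gens Zs Bs. Act (FO (lam X B \<odot> bang_map ?kan) Zs) h (ext_src Zs Cs x) = ext_src Zs Bs y \<and>
        Act (FO (kan (bang X A) (bang X B) lam_g \<odot> lam X A) Zs) h (?r Zs Cs x) = ?r Zs Bs y"
      unfolding FO FO' by blast
  next
    fix h and Zs Ws :: "('o, 'a, 'x) presheaf list" and Bs x
    assume h: "h \<in> Hom (bang X (psh A)) Zs Ws" and Bs': "Bs \<in> Obj (bang X B)" and x_in: "x \<in> ext_gens Zs Bs"
    then have Zs: "Zs \<in> lists {P. is_presheaf A P}" and Ws: "Ws \<in> lists {P. is_presheaf A P}"
      and Bs: "Bs \<in> lists (Obj B)" by (simp_all add: Hom_bang_iff)
    note D = Hom_bangD[OF h]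
    obtain Ds As zs ys u where x: "x = (Ds, As, zs, ys, u)" by (cases x)
    from x_in have Ds: "Ds \<in> lists (Obj B)" "length Ds = length Zs" and As: "As \<in> lists (Obj A)" "length As = length Zs"
      and zs: "zs \<in> tup_at Zs As" and ys: "ys \<in> tup_at (map (FO g) As) Ds" and u: "u \<in> Hom (bang X B) Bs Ds"
      by (simp_all add: ext_gens_def x)
    have w: "wiring X (length Zs) (Wir h)" using h by (simp add: Hom_bang_iff)
    have rewA: "rewire A (Wir h) As \<in> Hom (bang X A) As (map ((!) As) (Wir h))"
      using rewire_in[OF catA As(1)] w As(2) by simp
    have rewB: "rewire B (Wir h) Ds \<in> Hom (bang X B) Ds (map ((!) Ds) (Wir h))"
      using rewire_in[OF catB Ds(1)] w Ds(2) by simp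
    let ?zs = "map (\<lambda>j. NAt (Lab h ! j) (As ! (Wir h ! j)) (zs ! (Wir h ! j))) [0..<length (Wir h)]"
    let ?ys = "map ((!) ys) (Wir h)"
    let ?x = "(map ((!) Ds) (Wir h), map ((!) As) (Wir h), ?zs, ?ys, rewire B (Wir h) Ds \<cdot>\<^bsub>bang X B\<^esub> u)"
    have ys': "?ys \<in> tup_at (map (FO g) (map ((!) As) (Wir h))) (map ((!) Ds) (Wir h))"
      using tup_atD(2)[OF ys] D As(2) by (simp add: tup_at_def)
    have zs': "?zs \<in> tup_at Ws (map ((!) As) (Wir h))" by (rule lam_tup_in[OF catA h As zs])
    have lists: "map ((!) Ds) (Wir h) \<in> lists (Obj B)" "map ((!) As) (Wir h) \<in> lists (Obj A)"
      using rewA rewB by (simp_all only: Hom_bang_iff)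
    then have "?x \<in> ext_gens Ws Bs"
      using ys' zs' BB.Cmp_in[OF u rewB] D(3) by (simp add: ext_gens_def del: in_lists_conv_set)
    moreover have "NAt (FA (lam X B) (FA (bang_map ?kan) h)) Bs (ext_src Zs Bs x) = ext_src Ws Bs ?x"
    proof -
      have bh: "FA (bang_map ?kan) h \<in> Hom (bang X (psh B)) (map (FO ?kan) Zs) (map (FO ?kan) Ws)"
        using is_functor.FA_in[OF bkan h] by (simp add: bang_map_def)
      have "map (\<lambda>j. NAt (Lab (FA (bang_map ?kan) h) ! j) (Ds ! (Wir h ! j)) (kan_tuple A g Zs Ds As zs ys ! (Wir h ! j))) [0..<length (Wir h)] =
          kan_tuple A g Ws (map ((!) Ds) (Wir h)) (map ((!) As) (Wir h)) ?zs ?ys"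
      proof (rule nth_equalityI)
        fix j assume "j < length (map (\<lambda>j. NAt (Lab (FA (bang_map ?kan) h) ! j) (Ds ! (Wir h ! j)) (kan_tuple A g Zs Ds As zs ys ! (Wir h ! j))) [0..<length (Wir h)])"
        then have j: "j < length Ws" using D by simp
        note wj = D(5)[OF j]
        have "Ds ! (Wir h ! j) \<in> Obj B" "As ! (Wir h ! j) \<in> Obj A"
          using lists_nth[OF Ds(1)] lists_nth[OF As(1)] wj Ds(2) As(2) by simp_all
        moreover have "ys ! (Wir h ! j) \<in> At (FO g (As ! (Wir h ! j))) (Ds ! (Wir h ! j))"
          using tup_atD(2)[OF ys, of "Wir h ! j"] wj As(2) by simp
        ultimately show "map (\<lambda>j. NAt (Lab (FA (bang_map ?kan) h) ! j) (Ds ! (Wir h ! j)) (kan_tuple A g Zs Ds As zs ys ! (Wir h ! j))) [0..<length (Wir h)] ! j =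
            kan_tuple A g Ws (map ((!) Ds) (Wir h)) (map ((!) As) (Wir h)) ?zs ?ys ! j"
          using NAt_kan[OF g catB D(6)[OF j], of "Ds ! (Wir h ! j)" "(As ! (Wir h ! j), zs ! (Wir h ! j), ys ! (Wir h ! j))"]
            tup_atD(2)[OF zs wj] j wj D(3,4) by (simp add: kan_tuple_def bang_map_def)
      qed (simp add: kan_tuple_def D)
      then have "lam_wire X B (FA (bang_map ?kan) h) (Ds, kan_tuple A g Zs Ds As zs ys, u) =
          (map ((!) Ds) (Wir h), kan_tuple A g Ws (map ((!) Ds) (Wir h)) (map ((!) As) (Wir h)) ?zs ?ys,
           rewire B (Wir h) Ds \<cdot>\<^bsub>bang X B\<^esub> u)"
        by (simp add: lam_wire_def) (simp add: bang_map_def)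
      then show ?thesis
        using NAt_lam[OF wX catB bh Bs', of "(Ds, kan_tuple A g Zs Ds As zs ys, u)"] kan_tuple_in[OF As Ds zs ys] Ds u
        by (simp add: ext_src_def x gens_lam)
    qed
    moreover have "NAt (FA (kan (bang X A) (bang X B) lam_g) (FA (lam X A) h)) Bs (?r Zs Bs x) = ?r Ws Bs ?x"
    proof -
      have "map (\<lambda>j. NAt (FA g (Lab (rewire A (Wir h) As) ! j)) (Ds ! (Wir h ! j)) (ys ! (Wir h ! j))) [0..<length (Wir h)] = ?ys"
      proof (rule nth_equalityI)
        fix j assume "j < length (map (\<lambda>j. NAt (FA g (Lab (rewire A (Wir h) As) ! j)) (Ds ! (Wir h ! j)) (ys ! (Wir h ! j))) [0..<length (Wir h)])"
        then have j: "j < length Ws" using D by simp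
        note wj = D(5)[OF j]
        have "NAt (FA g (Ide A (As ! (Wir h ! j)))) (Ds ! (Wir h ! j)) (ys ! (Wir h ! j)) = ys ! (Wir h ! j)"
          using psh_functor(3)[OF g, of "As ! (Wir h ! j)" "Ds ! (Wir h ! j)"] tup_atD(2)[OF ys, of "Wir h ! j"]
            lists_nth[OF Ds(1)] lists_nth[OF As(1)] wj Ds(2) As(2) by simp
        then show "map (\<lambda>j. NAt (FA g (Lab (rewire A (Wir h) As) ! j)) (Ds ! (Wir h ! j)) (ys ! (Wir h ! j))) [0..<length (Wir h)] ! j = ?ys ! j"
          using j D(3) by simp
      qed simp
      then have "NAt (FA lam_g (rewire A (Wir h) As)) Bs (cls (pow B (length As)) (lam_bif X B (map (FO g) As) Bs) (Ds, ys, u)) =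
          cls (pow B (length (Wir h))) (lam_bif X B (map (FO g) (map ((!) As) (Wir h))) Bs)
            (map ((!) Ds) (Wir h), ?ys, rewire B (Wir h) Ds \<cdot>\<^bsub>bang X B\<^esub> u)"
        using NAt_lam_g[OF rewA Bs Ds(1) _ ys u] Ds(2) As(2) by (simp only: rewire_sel length_map)
      then show ?thesis
        using NAt_kan_lam[OF h Bs'] ext_mid_in[OF x_in] by (simp add: x ext_mid_def)
    qed
    ultimately show "\<exists>y \<in> ext_gens Ws Bs. NAt (FA (lam X B \<odot> bang_map ?kan) h) Bs (ext_src Zs Bs x) = ext_src Ws Bs y \<and>
        NAt (FA (kan (bang X A) (bang X B) lam_g \<odot> lam X A) h) Bs (?r Zs Bs x) = ?r Ws Bs y"
      unfolding fcomp_sel(2) by blast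
  qed
  then obtain \<phi> where iso: "psh_iso (bang X (psh A)) (bang X B) (lam X B \<odot> bang_map ?kan) (kan (bang X A) (bang X B) lam_g \<odot> lam X A) \<phi>"
    and \<phi>: "\<And>Zs Bs x. \<lbrakk>Zs \<in> Obj (bang X (psh A)); Bs \<in> Obj (bang X B); x \<in> ext_gens Zs Bs\<rbrakk> \<Longrightarrow> \<phi> Zs Bs (ext_src Zs Bs x) = ?r Zs Bs x"
    by blast
  have "canonical_ext_psh X A B g \<phi>"
    unfolding canonical_ext_psh_def
  proof (intro allI impI, elim conjE)
    fix Zs :: "('o, 'a, 'x) presheaf list" and Bs Ds As zs ys u
    assume *: "Zs \<in> lists (Obj (psh A))" "Bs \<in> lists (Obj B)" "Ds \<in> lists (Obj B)" "As \<in> lists (Obj A)"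
      "length Ds = length Zs" "length As = length Zs" "length zs = length Zs" "length ys = length Zs"
      "\<forall>i<length Zs. zs ! i \<in> At (Zs ! i) (As ! i) \<and> ys ! i \<in> At (FO g (As ! i)) (Ds ! i)"
      "u \<in> Hom (bang X B) Bs Ds"
    then have "(Ds, As, zs, ys, u) \<in> ext_gens Zs Bs" by (simp add: ext_gens_def tup_at_def)
    from \<phi>[OF _ _ this] * show "\<phi> Zs Bs (cls (pow B (length Zs)) (lam_bif X B (map (FO (kan A B g)) Zs) Bs)
        (Ds, map (\<lambda>i. cls A (kan_bif g (Zs ! i) (Ds ! i)) (As ! i, zs ! i, ys ! i)) [0..<length Zs], u)) =
      cls (bang X A) (kan_bif lam_g (lam_ob X A Zs) Bs)
        (As, cls (pow A (length Zs)) (lam_bif X A Zs As) (As, zs, Ide (bang X A) As),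
         cls (pow B (length Zs)) (lam_bif X B (map (FO g) As) Bs) (Ds, ys, u))"
      by (simp add: ext_src_def ext_mid_def kan_lam_cls_def kan_tuple_def)
  qed
  with iso show ?thesis by blast
qed

end

section \<open>Compatibility with the multiplication of \<open>!\<close>\<close>

text \<open>The inverse of \<open>concat\<close> for lists whose blocks have the given lengths.\<close>

fun chunk :: "nat list \<Rightarrow> 'a list \<Rightarrow> 'a list list" where
  "chunk [] xs = []"
| "chunk (n # ns) xs = take n xs # chunk ns (drop n xs)"

lemma chunk_concat: "map length xss = ns \<Longrightarrow> chunk ns (concat xss) = xss"
  by (induction ns arbitrary: xss) auto

lemma concat_chunk: "length xs = sum_list ns \<Longrightarrow> concat (chunk ns xs) = xs"
  by (induction ns arbitrary: xs) auto

lemma map_length_chunk: "length xs = sum_list ns \<Longrightarrow> map length (chunk ns xs) = ns"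
  by (induction ns arbitrary: xs) auto

text \<open>A statement about all positions of a concatenation splits into statements about the blocks; this
turns facts about tuples over \<open>concat\<close> into facts about the blocks.\<close>

lemma all_positions:
  "(\<forall>J < sum_list ns. P J) \<longleftrightarrow> (\<forall>i < length ns. \<forall>p < ns ! i. P (off ns i + p))"
proof (intro iffI allI impI)
  fix i p assume "\<forall>J < sum_list ns. P J" "i < length ns" "p < ns ! i"
  then show "P (off ns i + p)" using off_less[of i "length ns" ns p] by simp
next
  fix J assume *: "\<forall>i < length ns. \<forall>p < ns ! i. P (off ns i + p)" and J: "J < sum_list ns"
  have "J < off ns (length ns)" using J by simp
  from off_cases[OF this order_refl] obtain i p where "i < length ns" "p < ns ! i" "J = off ns i + p" .
  then show "P J" using * by simp
qed

lemma length_nth_block: "map length xss = ns \<Longrightarrow> i < length ns \<Longrightarrow> length (xss ! i) = ns ! i"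
  by auto

lemma nth_concat_off':
  assumes "map length xss = ns" "i < length ns" "p < ns ! i"
  shows "concat xss ! (off ns i + p) = xss ! i ! p"
  using assms by (intro nth_concat_off) auto

lemma tup_at_concat:
  assumes "map length Fss = ns" "map length Dss = ns" "map length xss = ns"
  shows "concat xss \<in> tup_at (concat Fss) (concat Dss) \<longleftrightarrow> (\<forall>i < length ns. xss ! i \<in> tup_at (Fss ! i) (Dss ! i))"
proof -
  have len: "length (Fss ! i) = ns ! i" "length (xss ! i) = ns ! i" if "i < length ns" for i
    using assms that by (auto intro: length_nth_block)
  show ?thesis
    using assms len
    by (simp add: tup_at_def length_concat all_positions nth_concat_off')
qed

lemma Hom_pow_concat:
  assumes "map length fss = ns" "map length Dss = ns" "map length Ess = ns"
  shows "concat fss \<in> Hom (pow C (sum_list ns)) (concat Dss) (concat Ess) \<longleftrightarrow>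
    (\<forall>i < length ns. fss ! i \<in> Hom (pow C (ns ! i)) (Dss ! i) (Ess ! i))"
proof -
  have len: "length (fss ! i) = ns ! i" "length (Dss ! i) = ns ! i" "length (Ess ! i) = ns ! i" if "i < length ns" for i
    using assms that by (auto intro: length_nth_block)
  show ?thesis
    using assms len
    by (simp add: Hom_pow_iff length_concat all_positions nth_concat_off')
qed

lemma concat_eqI:
  assumes "map length xss = ns" "length ys = sum_list ns"
    and "\<And>i p. i < length ns \<Longrightarrow> p < ns ! i \<Longrightarrow> xss ! i ! p = ys ! (off ns i + p)"
  shows "concat xss = ys"
proof -
  have "\<forall>J < sum_list ns. concat xss ! J = ys ! J"
    unfolding all_positions using assms by (simp add: nth_concat_off')
  then show ?thesis using assms by (intro nth_equalityI) (simp_all add: length_concat)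
qed

lemma tup_act_concat:
  assumes "map length Fss = ns" "map length fss = ns" "map length xss = ns"
  shows "tup_act (concat Fss) (concat fss) (concat xss) =
    concat (map (\<lambda>i. tup_act (Fss ! i) (fss ! i) (xss ! i)) [0..<length ns])"
proof (rule concat_eqI[symmetric, where ns = ns])
  have len: "length (Fss ! i) = ns ! i" if "i < length ns" for i using that assms by auto
  then show "map length (map (\<lambda>i. tup_act (Fss ! i) (fss ! i) (xss ! i)) [0..<length ns]) = ns"
    by (intro nth_equalityI) (simp_all add: tup_act_def)
  show "length (tup_act (concat Fss) (concat fss) (concat xss)) = sum_list ns"
    using assms by (simp add: tup_act_def length_concat)
  fix i p assume ip: "i < length ns" "p < ns ! i"
  have "off ns i + p < length (concat Fss)"
    using off_less[of i "length ns" ns p] ip assms by (simp add: length_concat)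
  then show "map (\<lambda>i. tup_act (Fss ! i) (fss ! i) (xss ! i)) [0..<length ns] ! i ! p =
      tup_act (concat Fss) (concat fss) (concat xss) ! (off ns i + p)"
    using ip assms len by (simp add: tup_act_def nth_concat_off')
qed

lemma mu_bang_par_par:
  assumes X: "wirable X" and C: "category C" and len: "map length fss = ns" "map length Dss = ns" "map length Ess = ns"
    and fss: "\<And>i. i < length ns \<Longrightarrow> fss ! i \<in> Hom (pow C (ns ! i)) (Dss ! i) (Ess ! i)"
  shows "map (par C) fss \<in> Hom (pow (bang X C) (length ns)) Dss Ess"
    and "FA mu_bang (par (bang X C) (map (par C) fss)) = par C (concat fss)"
proof -
  have lns: "length fss = length ns" "length Dss = length ns" "length Ess = length ns"
    using len by (metis length_map)+
  show 1: "map (par C) fss \<in> Hom (pow (bang X C) (length ns)) Dss Ess"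
    using par_in[OF X C fss] lns by (simp add: Hom_pow_iff)
  have B: "category (bang X C)" by (rule category_bang[OF X C])
  note P = par_in[OF X B 1]
  have "concat fss \<in> Hom (pow C (sum_list ns)) (concat Dss) (concat Ess)"
    using Hom_pow_concat[OF len] fss by blast
  note Q = par_in[OF X C this]
  show "FA mu_bang (par (bang X C) (map (par C) fss)) = par C (concat fss)"
  proof (rule bang_hom_eqI[OF mu_bang_in[OF P] Q])
    fix J assume "J < length (concat Ess)"
    then obtain i p where ip: "i < length Ess" "p < length (Ess ! i)" and J: "J = off (map length Ess) i + p"
      by (rule concat_position[OF _ refl])
    have i: "i < length ns" using ip(1) lns by simp
    then have p: "p < ns ! i" using ip(2) length_nth_block[OF len(3) i] by simp
    have "length (fss ! i) = ns ! i" by (rule length_nth_block[OF len(1) i])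
    moreover have "off ns i + p < length (concat fss)"
      using off_less[of i "length ns" ns p] i p len(1) by (simp add: length_concat)
    ultimately show "Wir (FA mu_bang (par (bang X C) (map (par C) fss))) ! J = Wir (par C (concat fss)) ! J"
      "Lab (FA mu_bang (par (bang X C) (map (par C) fss))) ! J = Lab (par C (concat fss)) ! J"
      using mu_bang_nth[OF P ip] i p lns by (simp_all add: J len nth_concat_off'[OF len(1)])
  qed
qed

text \<open>The wiring of a flattened morphism \<open>k\<close>, applied to objects \<open>Dss\<close>, first moves whole blocks as \<open>Wir k\<close>
does and then rewires inside each block as the labels of \<open>k\<close> do.  Here \<open>k\<close> may live over any category; in its use below its labels are transformations of presheaves
while \<open>Dss\<close> consists of objects of \<open>C\<close>.\<close>

lemma mu_bang_rewire:
  assumes X: "wirable X" and C: "category C" and k: "k \<in> Hom (bang X (bang X P)) Fss Gss"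
    and Dss: "Dss \<in> lists (lists (Obj C))" "map length Dss = map length Fss"
  defines "vs \<equiv> map (\<lambda>j. rewire C (Wir (Lab k ! j)) (Dss ! (Wir k ! j))) [0..<length Gss]"
    and "Dss' \<equiv> map (\<lambda>j. map ((!) (Dss ! (Wir k ! j))) (Wir (Lab k ! j))) [0..<length Gss]"
  shows "vs \<in> Hom (pow (bang X C) (length Gss)) (map ((!) Dss) (Wir k)) Dss'"
    and "map length Dss' = map length Gss"
    and "concat Dss' = map ((!) (concat Dss)) (Wir (FA mu_bang k))"
    and "FA mu_bang (par (bang X C) vs \<cdot>\<^bsub>bang X (bang X C)\<^esub> rewire (bang X C) (Wir k) Dss) =
      rewire C (Wir (FA mu_bang k)) (concat Dss)"
proof -
  note D = Hom_bangD[OF k]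
  have lDss: "length Dss = length Fss" using Dss(2) by (metis length_map)
  have lDss_i: "length (Dss ! i) = length (Fss ! i)" if "i < length Fss" for i
    using Dss(2) that lDss by (metis nth_map)
  have Dss_i: "Dss ! (Wir k ! j) \<in> lists (Obj C)" if "j < length Gss" for j
    using D(5)[OF that] lDss by (intro lists_nth[OF Dss(1)]) simp
  have w: "wiring X (length (Dss ! (Wir k ! j))) (Wir (Lab k ! j))" if "j < length Gss" for j
    using D(5,6)[OF that] by (simp add: lDss_i Hom_bang_iff)
  have lw: "length (Wir (Lab k ! j)) = length (Gss ! j)" if "j < length Gss" for j
    using Hom_bangD(3)[OF D(6)[OF that]] .
  have v: "rewire C (Wir (Lab k ! j)) (Dss ! (Wir k ! j)) \<in> Hom (bang X C) (Dss ! (Wir k ! j)) (Dss' ! j)"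
    if "j < length Gss" for j
    using rewire_in[OF C Dss_i[OF that] w[OF that]] that by (simp add: Dss'_def)
  show vs: "vs \<in> Hom (pow (bang X C) (length Gss)) (map ((!) Dss) (Wir k)) Dss'"
    using v D(3) by (simp add: Hom_pow_iff vs_def) (simp add: Dss'_def)
  show lDss': "map length Dss' = map length Gss"
    using lw by (intro nth_equalityI) (simp_all add: Dss'_def)
  have B: "category (bang X C)" by (rule category_bang[OF X C])
  interpret B: category "bang X C" by (rule B)
  interpret BB: category "bang X (bang X C)" by (rule category_bang[OF X B])
  have wk: "wiring X (length Dss) (Wir k)" using k lDss by (simp add: Hom_bang_iff)
  have Dss_lists: "Dss \<in> lists (Obj (bang X C))" using Dss(1) by (simp only: bang_sel)
  note rew = rewire_in[OF B Dss_lists wk]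
  let ?R = "par (bang X C) vs \<cdot>\<^bsub>bang X (bang X C)\<^esub> rewire (bang X C) (Wir k) Dss"
  have R: "?R \<in> Hom (bang X (bang X C)) Dss Dss'"
    by (rule BB.Cmp_in[OF rew par_in[OF X B vs]])
  have lGss: "length Dss' = length Gss" by (simp add: Dss'_def)
  have R_sel: "Wir ?R ! j = Wir k ! j" "Lab ?R ! j = rewire C (Wir (Lab k ! j)) (Dss ! (Wir k ! j))" if "j < length Gss" for j
    using that D(3) B.Cmp_Ide[OF v[OF that]] by (simp_all add: vs_def)
  have len_mu: "length (Wir (FA mu_bang k)) = sum_list (map length Gss)"
    using Hom_bangD(3)[OF mu_bang_in[OF k]] by (simp add: length_concat)
  have pos: "concat Dss ! (off (map length Fss) (Wir k ! j) + Wir (Lab k ! j) ! p) = Dss ! (Wir k ! j) ! (Wir (Lab k ! j) ! p)"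
    if "j < length Gss" "p < length (Gss ! j)" for j p
    using nth_concat_off'[OF Dss(2), of "Wir k ! j" "Wir (Lab k ! j) ! p"] D(5)[OF that(1)]
      Hom_bangD(5)[OF D(6)[OF that(1)] that(2)] by simp
  show concat: "concat Dss' = map ((!) (concat Dss)) (Wir (FA mu_bang k))"
  proof (rule concat_eqI[OF lDss'])
    fix j p assume "j < length (map length Gss)" "p < map length Gss ! j"
    then have j: "j < length Gss" "p < length (Gss ! j)" by simp_all
    have "off (map length Gss) j + p < length (Wir (FA mu_bang k))"
      using off_less[of j "length Gss" "map length Gss" p] j off_simps(3)[of "map length Gss"] by (simp add: len_mu)
    then show "Dss' ! j ! p = map ((!) (concat Dss)) (Wir (FA mu_bang k)) ! (off (map length Gss) j + p)"
      using j lw pos[OF j] mu_bang_nth(1)[OF k j] by (simp add: Dss'_def)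
  qed (simp add: len_mu)
  have wmu: "wiring X (length (concat Dss)) (Wir (FA mu_bang k))"
    using mu_bang_in[OF k] Dss(2) by (simp add: Hom_bang_iff length_concat)
  have "rewire C (Wir (FA mu_bang k)) (concat Dss) \<in> Hom (bang X C) (concat Dss) (concat Dss')"
    unfolding concat by (rule rewire_in[OF C concat_lists[OF Dss(1)] wmu])
  then show "FA mu_bang ?R = rewire C (Wir (FA mu_bang k)) (concat Dss)"
  proof (rule bang_hom_eqI[OF mu_bang_in[OF R]])
    fix J assume "J < length (concat Dss')"
    then obtain j p where jp: "j < length Dss'" "p < length (Dss' ! j)" and J: "J = off (map length Dss') j + p"
      by (rule concat_position[OF _ refl])
    have j: "j < length Gss" "p < length (Gss ! j)" using jp lDss' lGss by (auto simp: Dss'_def lw)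
    have lJ: "off (map length Gss) j + p < length (Wir (FA mu_bang k))"
      using off_less[of j "length Gss" "map length Gss" p] j off_simps(3)[of "map length Gss"] by (simp add: len_mu)
    show "Wir (FA mu_bang ?R) ! J = Wir (rewire C (Wir (FA mu_bang k)) (concat Dss)) ! J"
      using mu_bang_nth(1)[OF R jp] mu_bang_nth(1)[OF k j] R_sel[OF j(1)] by (simp add: J lDss' Dss(2))
    show "Lab (FA mu_bang ?R) ! J = Lab (rewire C (Wir (FA mu_bang k)) (concat Dss)) ! J"
      using mu_bang_nth(2)[OF R jp] mu_bang_nth(1)[OF k j] R_sel[OF j(1)] pos[OF j] lJ j lw
      by (simp add: J lDss' Dss(2))
  qed
qed

text \<open>The representatives \<open>(concat Dss, concat xss, u)\<close> of \<open>\<lambda>(concat Fss)\<close>, cut into the blocks given by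
\<open>Fss\<close>.\<close>

definition blocks_at :: "('o, 'a) cat \<Rightarrow> ('o, 'a, 'x) presheaf list list \<Rightarrow> 'o list list \<Rightarrow> 'x list list \<Rightarrow> bool" where
  "blocks_at C Fss Dss xss \<longleftrightarrow> Dss \<in> lists (lists (Obj C)) \<and> map length Dss = map length Fss \<and>
     map length xss = map length Fss \<and> (\<forall>i < length Fss. xss ! i \<in> tup_at (Fss ! i) (Dss ! i))"

text \<open>The tuple \<open>[Ds\<^sub>1, xs\<^sub>1, v\<^sub>1], \<dots>, [Ds\<^sub>n, xs\<^sub>n, v\<^sub>n]\<close> with \<open>[Ds\<^sub>i, xs\<^sub>i, v\<^sub>i]\<close> in \<open>\<lambda>(Fs\<^sub>i)(Es\<^sub>i)\<close>.\<close>

definition lam_tuple :: "combinator set \<Rightarrow> ('o, 'a) cat \<Rightarrow> ('o, 'a, 'x) presheaf list list \<Rightarrow> 'o list list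
    \<Rightarrow> 'o list list \<Rightarrow> 'x list list \<Rightarrow> ('o, 'a) barr list \<Rightarrow> ('o list \<times> 'x list \<times> ('o, 'a) barr) set list" where
  "lam_tuple X C Fss Ess Dss xss vs =
    map (\<lambda>i. cls (pow C (length (Fss ! i))) (lam_bif X C (Fss ! i) (Ess ! i)) (Dss ! i, xss ! i, vs ! i)) [0..<length Fss]"

lemma blocks_atD:
  assumes "blocks_at C Fss Dss xss"
  shows "Dss \<in> lists (lists (Obj C))" "length Dss = length Fss" "length xss = length Fss"
    "map length Dss = map length Fss" "map length xss = map length Fss"
    "i < length Fss \<Longrightarrow> Dss ! i \<in> lists (Obj C)" "i < length Fss \<Longrightarrow> length (Dss ! i) = length (Fss ! i)"
    "i < length Fss \<Longrightarrow> xss ! i \<in> tup_at (Fss ! i) (Dss ! i)"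
proof -
  show *: "Dss \<in> lists (lists (Obj C))" "map length Dss = map length Fss" "map length xss = map length Fss"
    "i < length Fss \<Longrightarrow> xss ! i \<in> tup_at (Fss ! i) (Dss ! i)"
    using assms by (simp_all only: blocks_at_def)
  show l: "length Dss = length Fss" "length xss = length Fss"
    using arg_cong[OF *(2), of length] arg_cong[OF *(3), of length] by simp_all
  show "i < length Fss \<Longrightarrow> Dss ! i \<in> lists (Obj C)" using lists_nth[OF *(1)] l by simp
  show "i < length Fss \<Longrightarrow> length (Dss ! i) = length (Fss ! i)"
    using length_nth_block[OF *(2), of i] by simp
qed

lemma blocks_atI:
  assumes "\<And>i. i < length Fss \<Longrightarrow> Dss ! i \<in> lists (Obj C)" "\<And>i. i < length Fss \<Longrightarrow> length (Dss ! i) = length (Fss ! i)"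
    and "\<And>i. i < length Fss \<Longrightarrow> xss ! i \<in> tup_at (Fss ! i) (Dss ! i)"
    and "length Dss = length Fss" "length xss = length Fss"
  shows "blocks_at C Fss Dss xss"
  unfolding blocks_at_def
proof (intro conjI allI impI)
  show "Dss \<in> lists (lists (Obj C))"
    using assms(1,4) by (metis in_listsI in_set_conv_nth)
  show "map length Dss = map length Fss" "map length xss = map length Fss"
    using assms tup_atD(1)[OF assms(3)] by (auto intro!: nth_equalityI)
qed (rule assms(3))

lemma FO_mu_bang [simp]: "FO mu_bang Dss = concat Dss"
  by (simp add: mu_bang_def)

locale bang_cat = cat: category C for C :: "('o, 'a) cat" +
  fixes X :: "combinator set"
  assumes wX: "wirable X"
begin

lemma catC: "category C" by (rule cat.category_axioms)

lemma catB: "category (bang X C)" by (rule category_bang[OF wX catC])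

lemma is_functor_yo_mu: "is_functor (bang X (bang X C)) (psh (bang X C)) (yoneda (bang X C) \<odot> mu_bang)"
  by (rule is_functor_fcomp[OF is_functor_mu_bang[OF wX catC] is_functor_yoneda[OF catB]])

sublocale kan_lam "bang X C" "bang X C" X "yoneda (bang X C) \<odot> mu_bang"
  by (intro kan_lam.intro catB kan_lam_axioms.intro wX is_functor_yo_mu)

abbreviation "yo_mu \<equiv> yoneda (bang X C) \<odot> mu_bang"

lemma At_yo_mu: "At (FO (yoneda (bang X C)) (FO mu_bang Dss)) Cs = Hom (bang X C) Cs (concat Dss)"
  by (simp add: mu_bang_def)

lemma NAt_yo_mu:
  assumes "h \<in> Hom (bang X (bang X C)) Ess Dss" "u \<in> Hom (bang X C) Cs (concat Ess)"
  shows "NAt (FA (yoneda (bang X C)) (FA mu_bang h)) Cs u = FA mu_bang h \<cdot>\<^bsub>bang X C\<^esub> u"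
  using NAt_yoneda[OF mu_bang_in[OF assms(1)] Hom_Obj(1)[OF catB assms(2)] assms(2)] .

lemma lists_lam:
  assumes "Fss \<in> lists (lists {P. is_presheaf C P})"
  shows "map (lam_ob X C) Fss \<in> lists {P. is_presheaf (bang X C) P}"
  unfolding in_lists_conv_set
proof
  fix P assume "P \<in> set (map (lam_ob X C) Fss)"
  then obtain Fs where Fs: "Fs \<in> set Fss" "P = lam_ob X C Fs" by auto
  then have "Fs \<in> lists {P. is_presheaf C P}" using in_listsD[OF assms] by blast
  from presheaf_lam[OF wX catC this] show "P \<in> {P. is_presheaf (bang X C) P}" by (simp add: Fs)
qed

lemma presheaves_block: "Fss \<in> lists (lists {P. is_presheaf C P}) \<Longrightarrow> i < length Fss \<Longrightarrow> Fss ! i \<in> lists {P. is_presheaf C P}"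
  by (rule lists_nth)

lemma tup_block:
  assumes "Fss \<in> lists (lists {P. is_presheaf C P})" "i < length Fss" "Cs \<in> lists (Obj C)"
  shows "tup_coend C (Fss ! i) (length (Fss ! i)) (Hom (bang X C) Cs) (\<lambda>gs u. par C gs \<cdot>\<^bsub>bang X C\<^esub> u)"
  by (rule tup_coend_lam[OF wX catC assms(3) presheaves_block[OF assms(1,2)]])

lemma Hom_pow_nth: "vs \<in> Hom (pow D n) Ess Dss \<Longrightarrow> i < n \<Longrightarrow> vs ! i \<in> Hom D (Ess ! i) (Dss ! i)"
  by (simp add: Hom_pow_iff)

lemma lam_tuple_in:
  assumes b: "blocks_at C Fss Dss xss" and vs: "vs \<in> Hom (pow (bang X C) (length Fss)) Ess Dss"
  shows "lam_tuple X C Fss Ess Dss xss vs \<in> tup_at (map (lam_ob X C) Fss) Ess"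
  using lam_cls_in[OF blocks_atD(6,7,8)[OF b] Hom_pow_nth[OF vs]]
  by (simp add: tup_at_def[of "map _ _"] lam_tuple_def)

lemma lam_tupleE:
  assumes Ess: "Ess \<in> lists (lists (Obj C))" "length Ess = length Fss"
    and Ks: "Ks \<in> tup_at (map (lam_ob X C) Fss) Ess"
  obtains Dss xss vs where "blocks_at C Fss Dss xss" "vs \<in> Hom (pow (bang X C) (length Fss)) Ess Dss"
    "Ks = lam_tuple X C Fss Ess Dss xss vs"
proof -
  have "\<exists>Ds xs v. Ks ! i = cls (pow C (length (Fss ! i))) (lam_bif X C (Fss ! i) (Ess ! i)) (Ds, xs, v) \<and>
      Ds \<in> lists (Obj C) \<and> length Ds = length (Fss ! i) \<and> xs \<in> tup_at (Fss ! i) Ds \<and> v \<in> Hom (bang X C) (Ess ! i) Ds"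
    if i: "i < length Fss" for i
  proof -
    have "Ess ! i \<in> lists (Obj C)" using lists_nth[OF Ess(1)] Ess(2) i by simp
    moreover have "Ks ! i \<in> At (lam_ob X C (Fss ! i)) (Ess ! i)" using tup_atD(2)[OF Ks, of i] i by simp
    ultimately show ?thesis by (rule At_lamE) blast
  qed
  then obtain D x v where *: "Ks ! i = cls (pow C (length (Fss ! i))) (lam_bif X C (Fss ! i) (Ess ! i)) (D i, x i, v i)"
      "D i \<in> lists (Obj C)" "length (D i) = length (Fss ! i)" "x i \<in> tup_at (Fss ! i) (D i)"
      "v i \<in> Hom (bang X C) (Ess ! i) (D i)" if "i < length Fss" for i
    by metis
  show ?thesis
  proof
    show "blocks_at C Fss (map D [0..<length Fss]) (map x [0..<length Fss])"
      by (rule blocks_atI) (simp_all add: * del: in_lists_conv_set)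
    show "map v [0..<length Fss] \<in> Hom (pow (bang X C) (length Fss)) Ess (map D [0..<length Fss])"
      using Ess(2) * by (simp add: Hom_pow_iff)
    show "Ks = lam_tuple X C Fss Ess (map D [0..<length Fss]) (map x [0..<length Fss]) (map v [0..<length Fss])"
      using tup_atD(1)[OF Ks] by (intro nth_equalityI) (simp_all add: lam_tuple_def *)
  qed
qed

lemma lam_tuple_act:
  assumes Fss: "Fss \<in> lists (lists {P. is_presheaf C P})" and b: "blocks_at C Fss Dss xss"
    and vs: "vs \<in> Hom (pow (bang X C) (length Fss)) Ess Dss" and ws: "ws \<in> Hom (pow (bang X C) (length Fss)) Ess' Ess"
  shows "tup_act (map (lam_ob X C) Fss) ws (lam_tuple X C Fss Ess Dss xss vs) =
    lam_tuple X C Fss Ess' Dss xss (map (\<lambda>i. vs ! i \<cdot>\<^bsub>bang X C\<^esub> ws ! i) [0..<length Fss])"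
proof (rule nth_equalityI)
  fix i assume "i < length (tup_act (map (lam_ob X C) Fss) ws (lam_tuple X C Fss Ess Dss xss vs))"
  then have i: "i < length Fss" by (simp add: tup_act_def)
  have "Fss ! i \<in> Obj (bang X (psh C))" using presheaves_block[OF Fss i] by simp
  from Act_lam[OF wX catC this Hom_pow_nth[OF ws i], of "(Dss ! i, xss ! i, vs ! i)"]
  show "tup_act (map (lam_ob X C) Fss) ws (lam_tuple X C Fss Ess Dss xss vs) ! i =
      lam_tuple X C Fss Ess' Dss xss (map (\<lambda>i. vs ! i \<cdot>\<^bsub>bang X C\<^esub> ws ! i) [0..<length Fss]) ! i"
    using i blocks_atD(6-8)[OF b i] Hom_pow_nth[OF vs i] by (simp add: tup_act_def lam_tuple_def gens_lam FO_lam)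
qed (simp add: tup_act_def lam_tuple_def)

definition mult_gens :: "('o, 'a, 'x) presheaf list list \<Rightarrow> 'o list \<Rightarrow> ('o list list \<times> 'x list list \<times> ('o, 'a) barr) set" where
  "mult_gens Fss Cs = {(Dss, xss, u). blocks_at C Fss Dss xss \<and> u \<in> Hom (bang X C) Cs (concat Dss)}"

definition mult_src :: "('o, 'a, 'x) presheaf list list \<Rightarrow> 'o list \<Rightarrow> 'o list list \<times> 'x list list \<times> ('o, 'a) barr
    \<Rightarrow> ('o list \<times> 'x list \<times> ('o, 'a) barr) set" where
  "mult_src Fss Cs = (\<lambda>(Dss, xss, u). cls (pow C (length (concat Fss))) (lam_bif X C (concat Fss) Cs)
     (concat Dss, concat xss, u))"

definition mult_mid :: "('o, 'a, 'x) presheaf list list \<Rightarrow> 'o list list \<times> 'x list list \<times> ('o, 'a) barr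
    \<Rightarrow> 'o list list \<times> ('o list \<times> 'x list \<times> ('o, 'a) barr) set list \<times> ('o, 'a) barr" where
  "mult_mid Fss = (\<lambda>(Dss, xss, u). (Dss, lam_tuple X C Fss Dss Dss xss (map (Ide (bang X C)) Dss), u))"

lemma Ide_tuple:
  assumes "blocks_at C Fss Dss xss"
  shows "map (Ide (bang X C)) Dss \<in> Hom (pow (bang X C) (length Fss)) Dss Dss"
proof -
  have "Dss \<in> lists (Obj (bang X C))" using blocks_atD(1)[OF assms] by (simp only: bang_sel)
  from map_Ide_in[OF catB this] show ?thesis using blocks_atD(2)[OF assms] by simp
qed

lemma mid_in:
  assumes b: "blocks_at C Fss Dss xss" and vs: "vs \<in> Hom (pow (bang X C) (length Fss)) Ess Dss"
    and u: "u \<in> Hom (bang X C) Cs (concat Ess)"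
  shows "(Ess, lam_tuple X C Fss Ess Dss xss vs, u) \<in>
    gens (pow (bang X C) (length (map (lam_ob X C) Fss))) (mid_bif (bang X C) yo_mu (map (lam_ob X C) Fss) Cs)"
  using lam_tuple_in[OF b vs] Hom_pow_lists[OF catB vs] u by (simp add: gens_mid At_yo_mu)

lemma mult_mid_in:
  assumes "x \<in> mult_gens Fss Cs"
  shows "mult_mid Fss x \<in> gens (pow (bang X C) (length (map (lam_ob X C) Fss))) (mid_bif (bang X C) yo_mu (map (lam_ob X C) Fss) Cs)"
  using assms mid_in[OF _ Ide_tuple] by (auto simp: mult_gens_def mult_mid_def)

text \<open>The second co-Yoneda step: the morphisms \<open>v\<^sub>i\<close> inside the classes are slid, through the
multiplication, onto \<open>u\<close>.\<close>

lemma mid_normal: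
  assumes Fss: "Fss \<in> lists (lists {P. is_presheaf C P})" and b: "blocks_at C Fss Dss xss"
    and vs: "vs \<in> Hom (pow (bang X C) (length Fss)) Ess Dss" and u: "u \<in> Hom (bang X C) Cs (concat Ess)"
  shows "mid_cls (bang X C) yo_mu (map (lam_ob X C) Fss) Cs (Ess, lam_tuple X C Fss Ess Dss xss vs, u) =
    mid_cls (bang X C) yo_mu (map (lam_ob X C) Fss) Cs (mult_mid Fss (Dss, xss, FA mu_bang (par (bang X C) vs) \<cdot>\<^bsub>bang X C\<^esub> u))"
proof -
  have Cs: "Cs \<in> Obj (bang X C)" by (rule Hom_Obj(1)[OF catB u])
  have "map (\<lambda>i. map (Ide (bang X C)) Dss ! i \<cdot>\<^bsub>bang X C\<^esub> vs ! i) [0..<length Fss] = vs"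
    using Hom_pow_lists[OF catB vs] A.Ide_Cmp[OF Hom_pow_nth[OF vs]] by (intro nth_equalityI) simp_all
  then have "tup_act (map (lam_ob X C) Fss) vs (lam_tuple X C Fss Dss Dss xss (map (Ide (bang X C)) Dss)) =
      lam_tuple X C Fss Ess Dss xss vs"
    using lam_tuple_act[OF Fss b Ide_tuple[OF b] vs] by simp
  then show ?thesis
    using mid_step[OF lists_lam[OF Fss] Cs, of vs Ess Dss "lam_tuple X C Fss Dss Dss xss (map (Ide (bang X C)) Dss)" u]
      vs u lam_tuple_in[OF b Ide_tuple[OF b]] NAt_yo_mu[OF par_in[OF wX catB vs] u]
    by (simp add: At_yo_mu mult_mid_def)
qed

lemma tup_concat:
  assumes "Fss \<in> lists (lists {P. is_presheaf C P})" "Cs \<in> lists (Obj C)"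
  shows "tup_coend C (concat Fss) (length (concat Fss)) (Hom (bang X C) Cs) (\<lambda>gs u. par C gs \<cdot>\<^bsub>bang X C\<^esub> u)"
  by (rule tup_coend_lam[OF wX catC assms(2) concat_lists[OF assms(1)]])

text \<open>A representative over \<open>concat Fss\<close> is cut into blocks.  A slide along \<open>fs\<close> then becomes a slide along
\<open>par C\<close> of each block inside the classes of the tuple, which \<open>mid_normal\<close> moves to \<open>u\<close> as \<open>par C fs\<close>.\<close>

lemma mult_src_imp_mid:
  fixes Fss :: "('o, 'a, 'x) presheaf list list"
  assumes Fss: "Fss \<in> lists (lists {P. is_presheaf C P})" and Cs: "Cs \<in> lists (Obj C)"
    and x: "x \<in> mult_gens Fss Cs" and x': "x' \<in> mult_gens Fss Cs" and eq: "mult_src Fss Cs x = mult_src Fss Cs x'"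
  shows "mid_cls (bang X C) yo_mu (map (lam_ob X C) Fss) Cs (mult_mid Fss x) =
    mid_cls (bang X C) yo_mu (map (lam_ob X C) Fss) Cs (mult_mid Fss x')"
proof -
  let ?ns = "map length Fss" and ?N = "length (concat Fss)" and ?n = "length Fss"
  let ?mid = "mid_cls (bang X C) yo_mu (map (lam_ob X C) Fss) Cs"
  interpret T: tup_coend C "concat Fss" ?N "Hom (bang X C) Cs" "\<lambda>gs u. par C gs \<cdot>\<^bsub>bang X C\<^esub> u"
    by (rule tup_concat[OF Fss Cs])
  \<comment> \<open>from the left side to the reduced right side, on representatives\<close>
  define h where "h = (\<lambda>(Ds, xs, u). ?mid (mult_mid Fss (chunk ?ns Ds, chunk ?ns xs, u)))"
  have h: "h (concat Dss, concat xss, u) = ?mid (mult_mid Fss (Dss, xss, u))" if "blocks_at C Fss Dss xss" for Dss xss u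
    using chunk_concat[OF blocks_atD(4)[OF that]] chunk_concat[OF blocks_atD(5)[OF that]] by (simp add: h_def)
  have "cowedge (pow C ?N) (lam_bif X C (concat Fss) Cs) h"
    unfolding lam_bif_eq
  proof (rule T.cowedgeI)
    fix fs Ds Es xs u
    assume fs: "fs \<in> Hom (pow C ?N) Ds Es" and Ds: "Ds \<in> lists (Obj C)" "length Ds = ?N"
      and Es: "Es \<in> lists (Obj C)" "length Es = ?N" and xs: "xs \<in> tup_at (concat Fss) Es" and u: "u \<in> Hom (bang X C) Cs Ds"
    have N: "?N = sum_list ?ns" by (simp add: length_concat)
    have lens: "length Ds = sum_list ?ns" "length Es = sum_list ?ns" "length fs = sum_list ?ns" "length xs = sum_list ?ns"
      using Ds Es fs tup_atD(1)[OF xs] by (simp_all only: N Hom_pow_iff)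
    define Dss Ess fss xss where "Dss = chunk ?ns Ds" and "Ess = chunk ?ns Es" and "fss = chunk ?ns fs" and "xss = chunk ?ns xs"
    have c: "concat Dss = Ds" "concat Ess = Es" "concat fss = fs" "concat xss = xs"
      using concat_chunk[OF lens(1)] concat_chunk[OF lens(2)] concat_chunk[OF lens(3)] concat_chunk[OF lens(4)]
      by (simp_all only: Dss_def Ess_def fss_def xss_def)
    have ml: "map length Dss = ?ns" "map length Ess = ?ns" "map length fss = ?ns" "map length xss = ?ns"
      using map_length_chunk[OF lens(1)] map_length_chunk[OF lens(2)] map_length_chunk[OF lens(3)] map_length_chunk[OF lens(4)]
      by (simp_all only: Dss_def Ess_def fss_def xss_def)
    have l: "length Dss = ?n" "length Ess = ?n" "length fss = ?n" "length xss = ?n"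
      using arg_cong[OF ml(1), of length] arg_cong[OF ml(2), of length] arg_cong[OF ml(3), of length] arg_cong[OF ml(4), of length]
      by simp_all
    have fss: "fss ! i \<in> Hom (pow C (length (Fss ! i))) (Dss ! i) (Ess ! i)" if "i < ?n" for i
      using Hom_pow_concat[OF ml(3,1,2), of C] fs[folded c, unfolded N] that by simp
    have xss: "xss ! i \<in> tup_at (Fss ! i) (Ess ! i)" if "i < ?n" for i
      using tup_at_concat[OF refl ml(2,4)] xs[folded c] that by simp
    have bE: "blocks_at C Fss Ess xss"
      using Hom_pow_lists[OF catC fss] xss l by (intro blocks_atI) (simp_all del: in_lists_conv_set)
    let ?xss = "map (\<lambda>i. tup_act (Fss ! i) (fss ! i) (xss ! i)) [0..<?n]"
    have Fp: "is_presheaf C (Fss ! i ! j)" if "i < ?n" "j < length (Fss ! i)" for i j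
      using lists_nth[OF presheaves_block[OF Fss that(1)] that(2)] by simp
    have bD: "blocks_at C Fss Dss ?xss"
      using Hom_pow_lists[OF catC fss] tup_act_in[OF Fp fss xss] l by (intro blocks_atI) (simp_all del: in_lists_conv_set)
    have act: "tup_act (concat Fss) fs xs = concat ?xss"
      using tup_act_concat[OF refl ml(3,4)] by (simp add: c)
    note mm = mu_bang_par_par[OF wX catC ml(3,1,2), unfolded length_map]
    have pv: "map (par C) fss \<in> Hom (pow (bang X C) ?n) Dss Ess"
      and mu: "FA mu_bang (par (bang X C) (map (par C) fss)) = par C fs"
      using mm fss by (simp_all add: c)
    have "lam_tuple X C Fss Dss Dss ?xss (map (Ide (bang X C)) Dss) = lam_tuple X C Fss Dss Ess xss (map (par C) fss)"
    proof (rule nth_equalityI)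
      fix i assume "i < length (lam_tuple X C Fss Dss Dss ?xss (map (Ide (bang X C)) Dss))"
      then have i: "i < ?n" by (simp add: lam_tuple_def)
      have D_i: "Dss ! i \<in> lists (Obj C)" by (rule blocks_atD(6)[OF bD i])
      interpret L: tup_coend C "Fss ! i" "length (Fss ! i)" "Hom (bang X C) (Dss ! i)" "\<lambda>gs u. par C gs \<cdot>\<^bsub>bang X C\<^esub> u"
        by (rule tup_block[OF Fss i D_i])
      have "Ide (bang X C) (Dss ! i) \<in> Hom (bang X C) (Dss ! i) (Dss ! i)"
        using A.Ide_in[of "Dss ! i"] D_i by simp
      from L.step[OF fss[OF i] xss[OF i] this] A.Cmp_Ide[OF par_in[OF wX catC fss[OF i]]]
      show "lam_tuple X C Fss Dss Dss ?xss (map (Ide (bang X C)) Dss) ! i = lam_tuple X C Fss Dss Ess xss (map (par C) fss) ! i"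
        using i l by (simp add: lam_tuple_def lam_bif_eq)
    qed (simp add: lam_tuple_def)
    then have "?mid (mult_mid Fss (Dss, ?xss, u)) = ?mid (Dss, lam_tuple X C Fss Dss Ess xss (map (par C) fss), u)"
      by (simp add: mult_mid_def)
    also have "\<dots> = ?mid (mult_mid Fss (Ess, xss, par C fs \<cdot>\<^bsub>bang X C\<^esub> u))"
      using mid_normal[OF Fss bE pv] u by (simp add: c mu)
    finally show "h (Ds, tup_act (concat Fss) fs xs, u) = h (Es, xs, par C fs \<cdot>\<^bsub>bang X C\<^esub> u)"
      using h[OF bD, of u] h[OF bE, of "par C fs \<cdot>\<^bsub>bang X C\<^esub> u"] by (simp only: c act)
  qed
  note inv = cowedge_eq[OF this]
  obtain Dss xss u where xe: "x = (Dss, xss, u)" by (cases x)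
  obtain Dss' xss' u' where xe': "x' = (Dss', xss', u')" by (cases x')
  have "h (concat Dss, concat xss, u) = h (concat Dss', concat xss', u')"
    by (rule inv) (use eq in \<open>simp add: mult_src_def xe xe'\<close>)
  then show ?thesis
    using x x' h[of Dss xss u] h[of Dss' xss' u'] by (simp add: xe xe' mult_gens_def)
qed

text \<open>The inverse sends \<open>[Ess, [Ds\<^sub>i, xs\<^sub>i, v\<^sub>i]\<^sub>i, u]\<close> to \<open>[concat Dss, concat xss, \<mu>(v\<^sub>1, \<dots>, v\<^sub>n) \<circ> u]\<close>.
Functoriality of \<open>\<mu>\<close> makes it independent of representatives: an inner slide multiplies \<open>\<mu>(vs)\<close> on the
left by \<open>par C (concat fss)\<close>, and an outer one multiplies it on the right by \<open>\<mu>(ws)\<close>.\<close>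

lemma mult_mid_imp_src:
  fixes Fss :: "('o, 'a, 'x) presheaf list list"
  assumes Fss: "Fss \<in> lists (lists {P. is_presheaf C P})" and Cs: "Cs \<in> lists (Obj C)"
    and x: "x \<in> mult_gens Fss Cs" and x': "x' \<in> mult_gens Fss Cs"
    and eq: "mid_cls (bang X C) yo_mu (map (lam_ob X C) Fss) Cs (mult_mid Fss x) =
      mid_cls (bang X C) yo_mu (map (lam_ob X C) Fss) Cs (mult_mid Fss x')"
  shows "mult_src Fss Cs x = mult_src Fss Cs x'"
proof -
  let ?N = "length (concat Fss)" and ?n = "length Fss" and ?ns = "map length Fss"
  let ?mu = "\<lambda>vs. FA mu_bang (par (bang X C) vs)"
  have mu_Cmp: "FA mu_bang (k \<cdot>\<^bsub>bang X (bang X C)\<^esub> l) = FA mu_bang k \<cdot>\<^bsub>bang X C\<^esub> FA mu_bang l"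
    if "l \<in> Hom (bang X (bang X C)) Ass Bss" "k \<in> Hom (bang X (bang X C)) Bss Dss" for k l Ass Bss Dss
    by (rule is_functor.FA_Cmp[OF is_functor_mu_bang[OF wX catC] that])
  have mu_vs: "?mu vs \<in> Hom (bang X C) (concat Ess) (concat Dss)" if "vs \<in> Hom (pow (bang X C) ?n) Ess Dss" for vs Ess Dss
    by (rule mu_bang_in[OF par_in[OF wX catB that]])
  interpret T: tup_coend C "concat Fss" ?N "Hom (bang X C) Cs" "\<lambda>gs u. par C gs \<cdot>\<^bsub>bang X C\<^esub> u"
    by (rule tup_concat[OF Fss Cs])
  have Cs': "Cs \<in> Obj (bang X C)" using Cs by simp
  interpret M: tup_coend "bang X C" "map (lam_ob X C) Fss" ?n "\<lambda>As. At (FO yo_mu As) Cs" "\<lambda>gs. NAt (FA yo_mu (par (bang X C) gs)) Cs"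
    using mid_tup[OF lists_lam[OF Fss] Cs'] by simp
  \<comment> \<open>the inverse as a function of representatives \<open>ps\<close> of the inner classes, then of the classes\<close>
  define k where "k u ps = mult_src Fss Cs (map fst ps, map (\<lambda>p. fst (snd p)) ps, ?mu (map (\<lambda>p. snd (snd p)) ps) \<cdot>\<^bsub>bang X C\<^esub> u)"
    for u and ps :: "('o list \<times> 'x list \<times> ('o, 'a) barr) list"
  define h where "h = (\<lambda>(Ess, Ks, u). tlift (\<lambda>i. pow C (length (Fss ! i))) (\<lambda>i. lam_bif X C (Fss ! i) (Ess ! i)) (k u) Ks)"
  have h: "h (Ess, lam_tuple X C Fss Ess Dss xss vs, u) = mult_src Fss Cs (Dss, xss, ?mu vs \<cdot>\<^bsub>bang X C\<^esub> u)"
    if b: "blocks_at C Fss Dss xss" and vs: "vs \<in> Hom (pow (bang X C) ?n) Ess Dss" and u: "u \<in> Hom (bang X C) Cs (concat Ess)"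
    for Ess Dss xss vs u
  proof -
    have Ess_i: "Ess ! i \<in> lists (Obj C)" if "i < ?n" for i
      using Hom_pow_nth[OF vs that] by (simp only: Hom_bang_iff)
    let ?ps = "map (\<lambda>i. (Dss ! i, xss ! i, vs ! i)) [0..<?n]"
    have "tlift (\<lambda>i. pow C (length (Fss ! i))) (\<lambda>i. lam_bif X C (Fss ! i) (Ess ! i)) (k u)
        (map (\<lambda>i. cls (pow C (length (Fss ! i))) (lam_bif X C (Fss ! i) (Ess ! i)) (?ps ! i)) [0..<?n]) = k u ?ps"
    proof (rule tlift_cls)
      show "Ide (pow C (length (Fss ! i))) Ds \<in> Hom (pow C (length (Fss ! i))) Ds Ds"
        if "Ds \<in> Obj (pow C (length (Fss ! i)))" for i Ds
        using map_Ide_in[OF catC, of Ds] that by (simp add: in_lists_conv_set subset_eq)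
      show "BA (lam_bif X C (Fss ! i) (Ess ! i)) (Ide (pow C (length (Fss ! i))) Ds) (Ide (pow C (length (Fss ! i))) Ds) t = t"
        if "i < ?n" "Ds \<in> Obj (pow C (length (Fss ! i)))" "t \<in> BO (lam_bif X C (Fss ! i) (Ess ! i)) Ds Ds" for i Ds t
        using tup_coend.BA_Ide[OF tup_block[OF Fss that(1) Ess_i[OF that(1)]] that(2)] that(3)
        unfolding lam_bif_eq .
      show "?ps ! i \<in> gens (pow C (length (Fss ! i))) (lam_bif X C (Fss ! i) (Ess ! i))" if "i < ?n" for i
        using that blocks_atD(6-8)[OF b that] Hom_pow_nth[OF vs that] by (simp add: gens_lam)
    next
      fix fss Ass Dss and ts :: "('x list \<times> ('o, 'a) barr) list"
      assume len: "length fss = ?n" "length Ass = ?n" "length Dss = ?n" "length ts = ?n"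
        and fss: "\<And>i. i < ?n \<Longrightarrow> fss ! i \<in> Hom (pow C (length (Fss ! i))) (Ass ! i) (Dss ! i)"
        and ts: "\<And>i. i < ?n \<Longrightarrow> ts ! i \<in> BO (lam_bif X C (Fss ! i) (Ess ! i)) (Dss ! i) (Ass ! i)"
      define xss vs where "xss = map fst ts" and "vs = map snd ts"
      have len': "length xss = ?n" "length vs = ?n" using len by (simp_all add: xss_def vs_def)
      have t: "ts ! i = (xss ! i, vs ! i)" if "i < ?n" for i using that len by (simp add: xss_def vs_def)
      have xss: "xss ! i \<in> tup_at (Fss ! i) (Dss ! i)" and vs_i: "vs ! i \<in> Hom (bang X C) (Ess ! i) (Ass ! i)" if "i < ?n" for i
        using ts[OF that] t[OF that] by (simp_all add: lam_bif_eq tup_bif_def)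
      note H = Hom_pow_lists[OF catC fss]
      have lenE: "length Ess = ?n" using Hom_pow_lists(4)[OF catB vs] .
      have vs: "vs \<in> Hom (pow (bang X C) ?n) Ess Ass" using vs_i len len' lenE by (simp add: Hom_pow_iff)
      have bD: "blocks_at C Fss Dss xss" using H xss len len' by (intro blocks_atI) (simp_all del: in_lists_conv_set)
      have ml: "map length fss = ?ns" "map length Ass = ?ns" "map length Dss = ?ns"
        using H len by (auto intro!: nth_equalityI)
      have N: "sum_list ?ns = ?N" by (simp add: length_concat)
      have fs: "concat fss \<in> Hom (pow C ?N) (concat Ass) (concat Dss)"
        using Hom_pow_concat[OF ml, of C] fss by (simp add: N)
      have pv: "map (par C) fss \<in> Hom (pow (bang X C) ?n) Ass Dss" and mu: "?mu (map (par C) fss) = par C (concat fss)"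
        using mu_bang_par_par[OF wX catC ml] fss by simp_all
      let ?xss = "map (\<lambda>i. tup_act (Fss ! i) (fss ! i) (xss ! i)) [0..<?n]"
      let ?vs = "map (\<lambda>i. map (par C) fss ! i \<cdot>\<^bsub>bang X C\<^esub> vs ! i) [0..<?n]"
      let ?L = "map (\<lambda>i. (Ass ! i, BA (lam_bif X C (Fss ! i) (Ess ! i)) (fss ! i) (Ide (pow C (length (Fss ! i))) (Ass ! i)) (ts ! i))) [0..<?n]"
      let ?R = "map (\<lambda>i. (Dss ! i, BA (lam_bif X C (Fss ! i) (Ess ! i)) (Ide (pow C (length (Fss ! i))) (Dss ! i)) (fss ! i) (ts ! i))) [0..<?n]"
      have I: "par C (map (Ide C) (Ass ! i)) \<cdot>\<^bsub>bang X C\<^esub> vs ! i = vs ! i"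
        "tup_act (Fss ! i) (map (Ide C) (Dss ! i)) (xss ! i) = xss ! i" if i: "i < ?n" for i
      proof -
        interpret L: tup_coend C "Fss ! i" "length (Fss ! i)" "Hom (bang X C) (Ess ! i)" "\<lambda>gs u. par C gs \<cdot>\<^bsub>bang X C\<^esub> u"
          by (rule tup_block[OF Fss i Ess_i[OF i]])
        show "par C (map (Ide C) (Ass ! i)) \<cdot>\<^bsub>bang X C\<^esub> vs ! i = vs ! i"
          by (rule L.G_Ide[OF H(1)[OF i] H(4)[OF i] vs_i[OF i]])
        show "tup_act (Fss ! i) (map (Ide C) (Dss ! i)) (xss ! i) = xss ! i"
          by (rule L.act_Ide[OF H(2)[OF i] H(5)[OF i] xss[OF i]])
      qed
      have L: "map fst ?L = Ass" "map (\<lambda>p. fst (snd p)) ?L = ?xss" "map (\<lambda>p. snd (snd p)) ?L = vs"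
        using len len' t I by (auto intro!: nth_equalityI simp: lam_bif_eq tup_bif_def)
      have R: "map fst ?R = Dss" "map (\<lambda>p. fst (snd p)) ?R = xss" "map (\<lambda>p. snd (snd p)) ?R = ?vs"
        using len len' t I by (auto intro!: nth_equalityI simp: lam_bif_eq tup_bif_def)
      have "?mu ?vs \<cdot>\<^bsub>bang X C\<^esub> u = par C (concat fss) \<cdot>\<^bsub>bang X C\<^esub> (?mu vs \<cdot>\<^bsub>bang X C\<^esub> u)"
        using par_Cmp[OF catB vs pv, of X] mu_Cmp[OF par_in[OF wX catB vs] par_in[OF wX catB pv]] mu
          A.Cmp_assoc[OF u mu_vs[OF vs] par_in[OF wX catC fs]] by simp
      moreover have "concat xss \<in> tup_at (concat Fss) (concat Dss)"
        using tup_at_concat[OF refl blocks_atD(4,5)[OF bD]] xss by simp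
      moreover have "tup_act (concat Fss) (concat fss) (concat xss) = concat ?xss"
        using tup_act_concat[OF refl ml(1) blocks_atD(5)[OF bD]] by simp
      moreover note T.step[OF fs, of "concat xss" "?mu vs \<cdot>\<^bsub>bang X C\<^esub> u"] A.Cmp_in[OF u mu_vs[OF vs]]
      ultimately have "mult_src Fss Cs (Ass, ?xss, ?mu vs \<cdot>\<^bsub>bang X C\<^esub> u) = mult_src Fss Cs (Dss, xss, ?mu ?vs \<cdot>\<^bsub>bang X C\<^esub> u)"
        by (simp only: mult_src_def lam_bif_eq prod.case)
      then show "k u ?L = k u ?R" by (simp only: k_def L R)
    qed simp
    moreover have "map fst ?ps = Dss" "map (\<lambda>p. fst (snd p)) ?ps = xss" "map (\<lambda>p. snd (snd p)) ?ps = vs"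
      using blocks_atD(2,3)[OF b] Hom_pow_lists(3)[OF catB vs] by (auto intro!: nth_equalityI)
    moreover have "map (\<lambda>i. cls (pow C (length (Fss ! i))) (lam_bif X C (Fss ! i) (Ess ! i)) (?ps ! i)) [0..<?n] =
        lam_tuple X C Fss Ess Dss xss vs"
      by (intro nth_equalityI) (simp_all add: lam_tuple_def)
    ultimately show ?thesis by (simp only: h_def k_def prod.case)
  qed
  have "cowedge (pow (bang X C) ?n) (mid_bif (bang X C) yo_mu (map (lam_ob X C) Fss) Cs) h"
    unfolding mid_bif_def
  proof (rule M.cowedgeI)
    fix ws Ess Ess' Ks u
    assume ws: "ws \<in> Hom (pow (bang X C) ?n) Ess Ess'" and Ess': "Ess' \<in> lists (Obj (bang X C))" "length Ess' = ?n"
      and Ks: "Ks \<in> tup_at (map (lam_ob X C) Fss) Ess'" and "u \<in> At (FO yo_mu Ess) Cs"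
    then have u: "u \<in> Hom (bang X C) Cs (concat Ess)" by (simp only: fcomp_sel At_yo_mu)
    obtain Dss xss vs where b: "blocks_at C Fss Dss xss" and vs: "vs \<in> Hom (pow (bang X C) ?n) Ess' Dss"
      and K: "Ks = lam_tuple X C Fss Ess' Dss xss vs"
      using lam_tupleE[OF Ess'[unfolded bang_sel] Ks] .
    let ?vw = "map (\<lambda>i. vs ! i \<cdot>\<^bsub>bang X C\<^esub> ws ! i) [0..<?n]"
    have vw: "?vw \<in> Hom (pow (bang X C) ?n) Ess Dss"
      using A.Cmp_in[OF Hom_pow_nth[OF ws] Hom_pow_nth[OF vs]] ws vs by (simp add: Hom_pow_iff)
    have "?mu ?vw \<cdot>\<^bsub>bang X C\<^esub> u = ?mu vs \<cdot>\<^bsub>bang X C\<^esub> (?mu ws \<cdot>\<^bsub>bang X C\<^esub> u)"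
      using par_Cmp[OF catB ws vs, of X] mu_Cmp[OF par_in[OF wX catB ws] par_in[OF wX catB vs]]
        A.Cmp_assoc[OF u mu_vs[OF ws] mu_vs[OF vs]] by simp
    then show "h (Ess, tup_act (map (lam_ob X C) Fss) ws Ks, u) = h (Ess', Ks, NAt (FA yo_mu (par (bang X C) ws)) Cs u)"
      using h[OF b vw u] h[OF b vs A.Cmp_in[OF u mu_vs[OF ws]]] NAt_yo_mu[OF par_in[OF wX catB ws] u]
      by (simp only: K lam_tuple_act[OF Fss b vs ws] fcomp_sel)
  qed
  note inv = cowedge_eq[OF this]
  have h_mid: "h (mult_mid Fss y) = mult_src Fss Cs y" if "y \<in> mult_gens Fss Cs" for y
  proof -
    obtain Dss xss u where y: "y = (Dss, xss, u)" by (cases y)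
    with that have b: "blocks_at C Fss Dss xss" and u: "u \<in> Hom (bang X C) Cs (concat Dss)"
      by (simp_all add: mult_gens_def)
    have Dss: "Dss \<in> lists (Obj (bang X C))" using blocks_atD(1)[OF b] by (simp only: bang_sel)
    have "?mu (map (Ide (bang X C)) Dss) = Ide (bang X C) (concat Dss)"
      using is_functor.FA_Ide[OF is_functor_mu_bang[OF wX catC], of Dss] par_Ide[OF catB Dss, of X] Dss
      by (simp add: mu_bang_def)
    then show ?thesis
      using h[OF b Ide_tuple[OF b] u] A.Ide_Cmp[OF u] by (simp add: y mult_mid_def)
  qed
  have "h (mult_mid Fss x) = h (mult_mid Fss x')"
    by (rule inv) (use eq in \<open>simp add: mid_cls_def\<close>)
  then show ?thesis by (simp only: h_mid[OF x] h_mid[OF x'])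
qed

text \<open>Both sides are generated by block-decomposed representatives.  For naturality in \<open>Fss\<close>, applying \<open>\<lambda>\<close> of
each label of \<open>k\<close> leaves a rewiring inside every class of the tuple; \<open>mid_normal\<close> and \<open>mu_bang_rewire\<close>
collect these rewirings, together with that of the blocks, into the wiring of the flattened \<open>k\<close>.\<close>

lemma mult_bang:
  "\<exists>\<phi>. psh_iso (bang X (bang X (psh C))) (bang X C)
      (lam X C \<odot> (mu_bang :: (('o, 'a, 'x) presheaf list list, _, _, _) fctr))
      (psh_map (bang X (bang X C)) (bang X C) mu_bang \<odot> lam X (bang X C) \<odot> bang_map (lam X C)) \<phi> \<and>
    canonical_mult_bang X C \<phi>"
proof -
  let ?mu = "mu_bang :: (('o, 'a, 'x) presheaf list list, (('o, 'a, 'x) presheaf list, (('o, 'a, 'x) presheaf, ('o, 'a, 'x) ptrans) barr) barr, _, _) fctr"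
  let ?lam = "lam X C :: (('o, 'a, 'x) presheaf list, _, _, _) fctr"
  let ?kan = "kan (bang X (bang X C)) (bang X C) yo_mu"
  let ?L = "map (lam_ob X C)"
  have P: "category (psh C :: (('o, 'a, 'x) presheaf, _) cat)" by (rule category_psh[OF catC])
  have mu: "is_functor (bang X (bang X (psh C))) (bang X (psh C)) ?mu" by (rule is_functor_mu_bang[OF wX P])
  have lam: "is_functor (bang X (psh C)) (psh (bang X C)) ?lam" by (rule is_functor_lam[OF wX catC])
  note blam = is_functor_bang_map[OF wX lam]
  have FO: "FO (lam X C \<odot> ?mu) Fss = lam_ob X C (concat Fss)" for Fss by (simp add: FO_lam)
  have FO': "FO (?kan \<odot> lam X (bang X C) \<odot> bang_map ?lam) Fss = FO ?kan (lam_ob X (bang X C) (?L Fss))" for Fss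
    by (simp add: FO_lam) (simp add: bang_map_def FO_lam)
  let ?r = "\<lambda>Fss Cs x. kan_lam_cls X (bang X C) yo_mu (?L Fss) Cs (mult_mid Fss x)"
  have "\<exists>\<phi>. psh_iso (bang X (bang X (psh C))) (bang X C) (lam X C \<odot> ?mu) (?kan \<odot> lam X (bang X C) \<odot> bang_map ?lam) \<phi> \<and>
    (\<forall>Fss \<in> Obj (bang X (bang X (psh C))). \<forall>Cs \<in> Obj (bang X C). \<forall>x \<in> mult_gens Fss Cs. \<phi> Fss Cs (mult_src Fss Cs x) = ?r Fss Cs x)"
  proof (rule psh_isoI_generators[OF is_functor_fcomp[OF mu lam]
        is_functor_fcomp[OF blam is_functor_fcomp[OF is_functor_lam[OF wX catB] is_functor_kan[OF F catB]]]])
    fix Fss :: "('o, 'a, 'x) presheaf list list" and Cs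
        assume "Fss \<in> Obj (bang X (bang X (psh C)))" and Cs': "Cs \<in> Obj (bang X C)"
    then have Fss: "Fss \<in> lists (lists {P. is_presheaf C P})" and Cs: "Cs \<in> lists (Obj C)" by (simp_all only: bang_sel psh_sel)
    let ?ns = "map length Fss"
    show "At (FO (lam X C \<odot> ?mu) Fss) Cs = mult_src Fss Cs ` mult_gens Fss Cs"
      unfolding FO
    proof (intro equalityI subsetI)
      fix v assume v_in: "v \<in> At (lam_ob X C (concat Fss)) Cs"
      obtain Ds xs u where v: "v = cls (pow C (length (concat Fss))) (lam_bif X C (concat Fss) Cs) (Ds, xs, u)"
        and Ds: "Ds \<in> lists (Obj C)" "length Ds = length (concat Fss)" and xs: "xs \<in> tup_at (concat Fss) Ds"
        and u: "u \<in> Hom (bang X C) Cs Ds"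
        using At_lamE[OF Cs v_in] .
      have lens: "length Ds = sum_list ?ns" "length xs = sum_list ?ns"
        using Ds(2) tup_atD(1)[OF xs] by (simp_all only: length_concat)
      define Dss xss where "Dss = chunk ?ns Ds" and "xss = chunk ?ns xs"
      have c: "concat Dss = Ds" "concat xss = xs"
        using concat_chunk[OF lens(1)] concat_chunk[OF lens(2)] by (simp_all only: Dss_def xss_def)
      have ml: "map length Dss = ?ns" "map length xss = ?ns"
        using map_length_chunk[OF lens(1)] map_length_chunk[OF lens(2)] by (simp_all only: Dss_def xss_def)
      have "set Dss \<subseteq> lists (Obj C)"
        using Ds(1)[folded c(1)] by (auto simp: in_lists_conv_set)
      then have "Dss \<in> lists (lists (Obj C))" by (auto simp: in_lists_conv_set)
      moreover have "\<forall>i<length Fss. xss ! i \<in> tup_at (Fss ! i) (Dss ! i)"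
        using tup_at_concat[OF refl ml] xs[folded c] by simp
      ultimately have "blocks_at C Fss Dss xss" using ml by (simp only: blocks_at_def simp_thms)
      then have "(Dss, xss, u) \<in> mult_gens Fss Cs" "v = mult_src Fss Cs (Dss, xss, u)"
        using u by (simp_all add: mult_gens_def mult_src_def v c)
      then show "v \<in> mult_src Fss Cs ` mult_gens Fss Cs" by blast
    next
      fix v assume "v \<in> mult_src Fss Cs ` mult_gens Fss Cs"
      then obtain Dss xss u where v: "v = mult_src Fss Cs (Dss, xss, u)" and b: "blocks_at C Fss Dss xss"
        and u: "u \<in> Hom (bang X C) Cs (concat Dss)"
        by (auto simp: mult_gens_def)
      have "concat xss \<in> tup_at (concat Fss) (concat Dss)"
        using tup_at_concat[OF refl blocks_atD(4,5)[OF b]] blocks_atD(8)[OF b] by simp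
      from lam_cls_in[OF concat_lists[OF blocks_atD(1)[OF b]] _ this u] show "v \<in> At (lam_ob X C (concat Fss)) Cs"
        using blocks_atD(4)[OF b] by (simp add: v mult_src_def length_concat)
    qed
    show "At (FO (?kan \<odot> lam X (bang X C) \<odot> bang_map ?lam) Fss) Cs = ?r Fss Cs ` mult_gens Fss Cs"
      unfolding FO' At_kan_lam[OF lists_lam[OF Fss] Cs']
    proof (intro equalityI subsetI)
      fix v assume "v \<in> kan_lam_cls X (bang X C) yo_mu (?L Fss) Cs ` gens (pow (bang X C) (length (?L Fss))) (mid_bif (bang X C) yo_mu (?L Fss) Cs)"
      then obtain Ess Ks u where v: "v = kan_lam_cls X (bang X C) yo_mu (?L Fss) Cs (Ess, Ks, u)"
        and p: "(Ess, Ks, u) \<in> gens (pow (bang X C) (length (?L Fss))) (mid_bif (bang X C) yo_mu (?L Fss) Cs)"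
        by auto
      have Ess: "Ess \<in> lists (lists (Obj C))" "length Ess = length Fss" and Ks: "Ks \<in> tup_at (?L Fss) Ess"
        and u: "u \<in> Hom (bang X C) Cs (concat Ess)"
        using p by (simp_all only: gens_mid bang_sel length_map fcomp_sel At_yo_mu)
      obtain Dss xss vs where b: "blocks_at C Fss Dss xss" and vs: "vs \<in> Hom (pow (bang X C) (length Fss)) Ess Dss"
        and K: "Ks = lam_tuple X C Fss Ess Dss xss vs"
        using lam_tupleE[OF Ess Ks] .
      let ?x = "(Dss, xss, FA mu_bang (par (bang X C) vs) \<cdot>\<^bsub>bang X C\<^esub> u)"
      have x: "?x \<in> mult_gens Fss Cs"
        using b A.Cmp_in[OF u mu_bang_in[OF par_in[OF wX catB vs]]] by (simp add: mult_gens_def)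
      have "v = ?r Fss Cs ?x"
        using kan_lam_cls_iff[OF lists_lam[OF Fss] Cs' p mult_mid_in[OF x]] mid_normal[OF Fss b vs u] by (simp add: v K)
      with x show "v \<in> ?r Fss Cs ` mult_gens Fss Cs" by blast
    next
      fix v assume "v \<in> ?r Fss Cs ` mult_gens Fss Cs"
      then show "v \<in> kan_lam_cls X (bang X C) yo_mu (?L Fss) Cs ` gens (pow (bang X C) (length (?L Fss))) (mid_bif (bang X C) yo_mu (?L Fss) Cs)"
        using mult_mid_in by blast
    qed
    show "mult_src Fss Cs x = mult_src Fss Cs x' \<longleftrightarrow> ?r Fss Cs x = ?r Fss Cs x'"
      if "x \<in> mult_gens Fss Cs" "x' \<in> mult_gens Fss Cs" for x x'
      unfolding kan_lam_cls_iff[OF lists_lam[OF Fss] Cs' mult_mid_in[OF that(1)] mult_mid_in[OF that(2)]]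
      using mult_src_imp_mid[OF Fss Cs that] mult_mid_imp_src[OF Fss Cs that] by blast
  next
    fix Fss :: "('o, 'a, 'x) presheaf list list" and h Bs Cs x
    assume "Fss \<in> Obj (bang X (bang X (psh C)))" and h: "h \<in> Hom (bang X C) Bs Cs" and x_in: "x \<in> mult_gens Fss Cs"
    then have Fss: "Fss \<in> lists (lists {P. is_presheaf C P})" by (simp only: bang_sel psh_sel)
    obtain Dss xss u where x: "x = (Dss, xss, u)" by (cases x)
    with x_in have b: "blocks_at C Fss Dss xss" and u: "u \<in> Hom (bang X C) Cs (concat Dss)"
      by (simp_all add: mult_gens_def)
    let ?x = "(Dss, xss, u \<cdot>\<^bsub>bang X C\<^esub> h)"
    have x': "?x \<in> mult_gens Fss Bs" using b A.Cmp_in[OF h u] by (simp add: mult_gens_def)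
    have tup: "concat xss \<in> tup_at (concat Fss) (concat Dss)"
      using tup_at_concat[OF refl blocks_atD(4,5)[OF b]] blocks_atD(8)[OF b] by simp
    have len: "length (concat Dss) = length (concat Fss)" using blocks_atD(4)[OF b] by (simp add: length_concat)
    have g: "(concat Dss, concat xss, u) \<in> gens (pow C (length (concat Fss))) (lam_bif X C (concat Fss) Cs)"
      unfolding gens_lam using concat_lists[OF blocks_atD(1)[OF b]] tup len u by blast
    have "concat Fss \<in> Obj (bang X (psh C))" using concat_lists[OF Fss] by (simp only: bang_sel psh_sel)
    from Act_lam[OF wX catC this h g]
    have 1: "Act (lam_ob X C (concat Fss)) h (mult_src Fss Cs x) = mult_src Fss Bs ?x"
      by (simp only: FO_lam mult_src_def x prod.case)
    have 2: "Act (FO ?kan (lam_ob X (bang X C) (?L Fss))) h (?r Fss Cs x) = ?r Fss Bs ?x"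
      using Act_kan_lam[OF lists_lam[OF Fss] h, of Dss _ u] mult_mid_in[OF x_in] Act_yoneda[OF h u]
      by (simp add: x mult_mid_def)
    show "\<exists>y \<in> mult_gens Fss Bs. Act (FO (lam X C \<odot> ?mu) Fss) h (mult_src Fss Cs x) = mult_src Fss Bs y \<and>
        Act (FO (?kan \<odot> lam X (bang X C) \<odot> bang_map ?lam) Fss) h (?r Fss Cs x) = ?r Fss Bs y"
      unfolding FO FO' using x' 1 2 by blast
  next
    fix k and Fss Gss :: "('o, 'a, 'x) presheaf list list" and Cs x
    assume k: "k \<in> Hom (bang X (bang X (psh C))) Fss Gss" and Cs': "Cs \<in> Obj (bang X C)" and x_in: "x \<in> mult_gens Fss Cs"
    then have Fss: "Fss \<in> lists (lists {P. is_presheaf C P})" and Gss: "Gss \<in> lists (lists {P. is_presheaf C P})"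
      by (simp_all only: Hom_bang_iff bang_sel psh_sel)
    note D = Hom_bangD[OF k]
    obtain Dss xss u where x: "x = (Dss, xss, u)" by (cases x)
    with x_in have b: "blocks_at C Fss Dss xss" and u: "u \<in> Hom (bang X C) Cs (concat Dss)"
      by (simp_all add: mult_gens_def)
    let ?m = "length Gss"
    let ?vs = "map (\<lambda>j. rewire C (Wir (Lab k ! j)) (Dss ! (Wir k ! j))) [0..<?m]"
    let ?Dss = "map (\<lambda>j. map ((!) (Dss ! (Wir k ! j))) (Wir (Lab k ! j))) [0..<?m]"
    let ?xss = "map (\<lambda>j. map (\<lambda>i. NAt (Lab (Lab k ! j) ! i) (Dss ! (Wir k ! j) ! (Wir (Lab k ! j) ! i))
      (xss ! (Wir k ! j) ! (Wir (Lab k ! j) ! i))) [0..<length (Wir (Lab k ! j))]) [0..<?m]"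
    note mr = mu_bang_rewire[OF wX catC k blocks_atD(1,4)[OF b]]
    have lw: "length (Wir (Lab k ! j)) = length (Gss ! j)" if "j < ?m" for j
      using Hom_bangD(3)[OF D(6)[OF that]] .
    have xs_j: "?xss ! j \<in> tup_at (Gss ! j) (?Dss ! j)" if j: "j < ?m" for j
      using lam_tup_in[OF catC D(6)[OF j] blocks_atD(6-8)[OF b D(5)[OF j]]] j by simp
    have b': "blocks_at C Gss ?Dss ?xss"
    proof (rule blocks_atI)
      fix j assume j: "j < ?m"
      show "?Dss ! j \<in> lists (Obj C)"
        by (rule lists_nth[OF Hom_pow_lists(2)[OF catB mr(1), unfolded bang_sel]]) (use j in simp)
      show "length (?Dss ! j) = length (Gss ! j)" using lw[OF j] j by simp
      show "?xss ! j \<in> tup_at (Gss ! j) (?Dss ! j)" by (rule xs_j[OF j])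
    qed simp_all
    have Dss: "Dss \<in> lists (Obj (bang X C))" using blocks_atD(1)[OF b] by (simp only: bang_sel)
    have w: "wiring X (length Dss) (Wir k)" using k blocks_atD(2)[OF b] by (simp add: Hom_bang_iff)
    note rew = rewire_in[OF catB Dss w]
    note mu_rew = mu_bang_in[OF rew] and mu_vs = mu_bang_in[OF par_in[OF wX catB mr(1)]]
    let ?u = "rewire C (Wir (FA mu_bang k)) (concat Dss) \<cdot>\<^bsub>bang X C\<^esub> u"
    have u_eq: "FA mu_bang (par (bang X C) ?vs) \<cdot>\<^bsub>bang X C\<^esub> (FA mu_bang (rewire (bang X C) (Wir k) Dss) \<cdot>\<^bsub>bang X C\<^esub> u) = ?u"
      using A.Cmp_assoc[OF u mu_rew mu_vs] is_functor.FA_Cmp[OF is_functor_mu_bang[OF wX catC] rew par_in[OF wX catB mr(1)]]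
        mr(4) by simp
    have u': "?u \<in> Hom (bang X C) Cs (concat ?Dss)"
      using A.Cmp_in[OF A.Cmp_in[OF u mu_rew] mu_vs] by (simp only: u_eq)
    let ?x = "(?Dss, ?xss, ?u)"
    have x': "?x \<in> mult_gens Gss Cs" using b' u' by (simp add: mult_gens_def)
    have tup: "concat xss \<in> tup_at (concat Fss) (concat Dss)"
      using tup_at_concat[OF refl blocks_atD(4,5)[OF b]] blocks_atD(8)[OF b] by simp
    have len: "length (concat Dss) = length (concat Fss)" using blocks_atD(4)[OF b] by (simp add: length_concat)
    have g: "(concat Dss, concat xss, u) \<in> gens (pow C (length (concat Fss))) (lam_bif X C (concat Fss) Cs)"
      unfolding gens_lam using concat_lists[OF blocks_atD(1)[OF b]] tup len u by blast
    have "concat ?xss = map (\<lambda>J. NAt (Lab (FA mu_bang k) ! J) (concat Dss ! (Wir (FA mu_bang k) ! J))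
        (concat xss ! (Wir (FA mu_bang k) ! J))) [0..<length (Wir (FA mu_bang k))]"
    proof (rule concat_eqI)
      show "map length ?xss = map length Gss" by (rule blocks_atD(5)[OF b'])
      have lmu: "length (Wir (FA mu_bang k)) = sum_list (map length Gss)"
        using Hom_bangD(3)[OF mu_bang_in[OF k]] by (simp add: length_concat)
      then show "length (map (\<lambda>J. NAt (Lab (FA mu_bang k) ! J) (concat Dss ! (Wir (FA mu_bang k) ! J))
        (concat xss ! (Wir (FA mu_bang k) ! J))) [0..<length (Wir (FA mu_bang k))]) = sum_list (map length Gss)" by simp
      fix j p assume "j < length (map length Gss)" "p < map length Gss ! j"
      then have j: "j < ?m" "p < length (Gss ! j)" by simp_all
      have wj: "Wir k ! j < length (map length Fss)" "Wir (Lab k ! j) ! p < map length Fss ! (Wir k ! j)"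
        using D(5)[OF j(1)] Hom_bangD(5)[OF D(6)[OF j(1)] j(2)] by simp_all
      have "off (map length Gss) j + p < length (Wir (FA mu_bang k))"
        using off_less[of j ?m "map length Gss" p] j off_simps(3)[of "map length Gss"] by (simp add: lmu)
      then show "?xss ! j ! p = map (\<lambda>J. NAt (Lab (FA mu_bang k) ! J) (concat Dss ! (Wir (FA mu_bang k) ! J))
        (concat xss ! (Wir (FA mu_bang k) ! J))) [0..<length (Wir (FA mu_bang k))] ! (off (map length Gss) j + p)"
        using j lw[OF j(1)] mu_bang_nth[OF k j] nth_concat_off'[OF blocks_atD(4)[OF b] wj] nth_concat_off'[OF blocks_atD(5)[OF b] wj]
        by simp
    qed
    then have wire: "lam_wire X C (FA mu_bang k) (concat Dss, concat xss, u) = (concat ?Dss, concat ?xss, ?u)"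
      using mr(3) by (simp only: lam_wire_def prod.case)
    have 1: "NAt (FA ?lam (FA ?mu k)) Cs (mult_src Fss Cs x) = mult_src Gss Cs ?x"
      using NAt_lam[OF wX catC mu_bang_in[OF k] Cs' g] by (simp only: mult_src_def x prod.case wire)
    let ?k = "FA (bang_map ?lam) k"
    have bk: "?k \<in> Hom (bang X (psh (bang X C))) (?L Fss) (?L Gss)"
      using is_functor.FA_in[OF blam k] by (simp add: bang_map_def FO_lam)
    have k_sel: "Wir ?k = Wir k" "Lab ?k = map (FA ?lam) (Lab k)" by (simp_all add: bang_map_def)
    let ?ids = "lam_tuple X C Fss Dss Dss xss (map (Ide (bang X C)) Dss)"
    let ?w = "map ((!) Dss) (Wir k)"
    have tuple: "map (\<lambda>j. NAt (Lab ?k ! j) (Dss ! (Wir ?k ! j)) (?ids ! (Wir ?k ! j))) [0..<length (Wir ?k)] =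
        lam_tuple X C Gss ?w ?Dss ?xss ?vs"
    proof (rule nth_equalityI)
      fix j assume "j < length (map (\<lambda>j. NAt (Lab ?k ! j) (Dss ! (Wir ?k ! j)) (?ids ! (Wir ?k ! j))) [0..<length (Wir ?k)])"
      then have j: "j < ?m" by (simp add: k_sel D)
      note wj = D(5)[OF j]
      have Dw: "Dss ! (Wir k ! j) \<in> Obj (bang X C)" using blocks_atD(6)[OF b wj] by simp
      note I = A.Ide_in[OF Dw]
      have gj: "(Dss ! (Wir k ! j), xss ! (Wir k ! j), Ide (bang X C) (Dss ! (Wir k ! j))) \<in>
          gens (pow C (length (Fss ! (Wir k ! j)))) (lam_bif X C (Fss ! (Wir k ! j)) (Dss ! (Wir k ! j)))"
        unfolding gens_lam using blocks_atD(6-8)[OF b wj] I by blast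
      have "wiring X (length (Dss ! (Wir k ! j))) (Wir (Lab k ! j))"
        using D(6)[OF j] blocks_atD(7)[OF b wj] by (simp add: Hom_bang_iff)
      from rewire_in[OF catC blocks_atD(6)[OF b wj] this]
      have "rewire C (Wir (Lab k ! j)) (Dss ! (Wir k ! j)) \<cdot>\<^bsub>bang X C\<^esub> Ide (bang X C) (Dss ! (Wir k ! j)) =
          rewire C (Wir (Lab k ! j)) (Dss ! (Wir k ! j))"
        by (rule A.Cmp_Ide)
      then have "lam_wire X C (Lab k ! j) (Dss ! (Wir k ! j), xss ! (Wir k ! j), Ide (bang X C) (Dss ! (Wir k ! j))) =
          (?Dss ! j, ?xss ! j, ?vs ! j)"
        using j by (simp add: lam_wire_def)
      then show "map (\<lambda>j. NAt (Lab ?k ! j) (Dss ! (Wir ?k ! j)) (?ids ! (Wir ?k ! j))) [0..<length (Wir ?k)] ! j =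
          lam_tuple X C Gss ?w ?Dss ?xss ?vs ! j"
        using NAt_lam[OF wX catC D(6)[OF j] Dw gj] j wj D(3,4) blocks_atD(2)[OF b] by (simp add: lam_tuple_def k_sel)
    qed (simp add: k_sel D lam_tuple_def)
    have "NAt (FA ?kan (FA (lam X (bang X C)) ?k)) Cs (?r Fss Cs x) =
        kan_lam_cls X (bang X C) yo_mu (?L Gss) Cs (?w, lam_tuple X C Gss ?w ?Dss ?xss ?vs,
          FA mu_bang (rewire (bang X C) (Wir k) Dss) \<cdot>\<^bsub>bang X C\<^esub> u)"
      using NAt_kan_lam[OF bk Cs', of Dss ?ids u] mult_mid_in[OF x_in] NAt_yo_mu[OF rew u]
      unfolding tuple by (simp only: x mult_mid_def prod.case k_sel fcomp_sel)
    also have "\<dots> = ?r Gss Cs ?x"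
      using kan_lam_cls_iff[OF lists_lam[OF Gss] Cs' mid_in[OF b' mr(1) A.Cmp_in[OF u mu_rew]] mult_mid_in[OF x']]
        mid_normal[OF Gss b' mr(1) A.Cmp_in[OF u mu_rew]] by (simp only: u_eq)
    finally show "\<exists>y \<in> mult_gens Gss Cs. NAt (FA (lam X C \<odot> ?mu) k) Cs (mult_src Fss Cs x) = mult_src Gss Cs y \<and>
        NAt (FA (?kan \<odot> lam X (bang X C) \<odot> bang_map ?lam) k) Cs (?r Fss Cs x) = ?r Gss Cs y"
      unfolding fcomp_sel(2) using x' 1 by blast
  qed
  then obtain \<phi> where iso: "psh_iso (bang X (bang X (psh C))) (bang X C) (lam X C \<odot> ?mu) (?kan \<odot> lam X (bang X C) \<odot> bang_map ?lam) \<phi>"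
    and \<phi>: "\<And>Fss Cs x. \<lbrakk>Fss \<in> Obj (bang X (bang X (psh C))); Cs \<in> Obj (bang X C); x \<in> mult_gens Fss Cs\<rbrakk> \<Longrightarrow>
      \<phi> Fss Cs (mult_src Fss Cs x) = ?r Fss Cs x"
    by blast
  have "canonical_mult_bang X C \<phi>"
    unfolding canonical_mult_bang_def
  proof (intro allI impI, elim conjE)
    fix Fss :: "('o, 'a, 'x) presheaf list list" and Cs Dss xss u
    assume Fss: "Fss \<in> lists (lists (Obj (psh C)))" and Cs: "Cs \<in> lists (Obj C)" and Dss: "Dss \<in> lists (lists (Obj C))"
      and len: "length Dss = length Fss" "length xss = length Fss"
      and i: "\<forall>i<length Fss. length (Dss ! i) = length (Fss ! i) \<and> length (xss ! i) = length (Fss ! i) \<and>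
        (\<forall>j<length (Fss ! i). xss ! i ! j \<in> At (Fss ! i ! j) (Dss ! i ! j))"
      and u: "u \<in> Hom (bang X C) Cs (concat Dss)"
    have "blocks_at C Fss Dss xss"
      using lists_nth[OF Dss] len i by (intro blocks_atI) (simp_all add: tup_at_def del: in_lists_conv_set)
    then have "(Dss, xss, u) \<in> mult_gens Fss Cs" using u by (simp add: mult_gens_def)
    moreover have "Fss \<in> Obj (bang X (bang X (psh C)))" "Cs \<in> Obj (bang X C)" using Fss Cs by (simp_all only: bang_sel)
    moreover have "lam_tuple X C Fss Dss Dss xss (map (Ide (bang X C)) Dss) =
        map (\<lambda>i. cls (pow C (length (Fss ! i))) (lam_bif X C (Fss ! i) (Dss ! i)) (Dss ! i, xss ! i, Ide (bang X C) (Dss ! i))) [0..<length Fss]"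
      using len by (simp add: lam_tuple_def)
    ultimately show "\<phi> Fss Cs (cls (pow C (length (concat Fss))) (lam_bif X C (concat Fss) Cs) (concat Dss, concat xss, u)) =
        cls (bang X (bang X C)) (kan_bif yo_mu (lam_ob X (bang X C) (map (lam_ob X C) Fss)) Cs)
          (Dss, cls (pow (bang X C) (length Fss)) (lam_bif X (bang X C) (map (lam_ob X C) Fss) Dss)
             (Dss, map (\<lambda>i. cls (pow C (length (Fss ! i))) (lam_bif X C (Fss ! i) (Dss ! i)) (Dss ! i, xss ! i, Ide (bang X C) (Dss ! i))) [0..<length Fss],
              Ide (bang X (bang X C)) Dss), u)"
      using \<phi>[of Fss Cs "(Dss, xss, u)"] by (simp only: mult_src_def mult_mid_def kan_lam_cls_def prod.case length_map)
  qed
  with iso show ?thesis unfolding psh_map_def by blast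
qed

end

section \<open>Naturality\<close>

text \<open>As \<open>Psh H\<close> is the Kleisli extension of the Yoneda embedding after \<open>H\<close>, the clause for Kleisli
extensions gives \<open>\<lambda> \<circ> !(Psh H) \<cong> (\<lambda> \<circ> !yoneda \<circ> !H)\<^sup># \<circ> \<lambda>\<close>, and the unit clause for \<open>Psh\<close> replaces
\<open>\<lambda> \<circ> !yoneda\<close> by the Yoneda embedding of \<open>!B\<close>.  On representatives the composite is
\<open>[Es, [C\<^sub>i, z\<^sub>i, f\<^sub>i]\<^sub>i, u] \<mapsto> [Cs, [Cs, zs, id], [Es, fs, u]] \<mapsto> [Cs, [Cs, zs, id], par B fs \<circ> u]\<close>.\<close>

lemma naturality:
  fixes A :: "('o, 'a) cat" and B :: "('p, 'b) cat"
  assumes X: "wirable X" and H: "is_functor A B H"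
  shows "\<exists>\<phi>. psh_iso (bang X (psh A)) (bang X B)
      (lam X B \<odot> bang_map (psh_map A B H :: (('o, 'a, 'x) presheaf, _, _, _) fctr))
      (psh_map (bang X A) (bang X B) (bang_map H) \<odot> lam X A) \<phi> \<and> canonical_naturality X A B H \<phi>"
proof -
  interpret H: is_functor A B H by (rule H)
  have A: "category A" and B: "category B" by unfold_locales
  have BB: "category (bang X B)" by (rule category_bang[OF X B])
  have bH: "is_functor (bang X A) (bang X B) (bang_map H)" by (rule is_functor_bang_map[OF X H])
  let ?g = "yoneda B \<odot> H"
  let ?F = "lam X B \<odot> bang_map ?g" and ?Y = "yoneda (bang X B) \<odot> bang_map H"
  have g: "is_functor A (psh B) ?g" by (rule is_functor_fcomp[OF H is_functor_yoneda[OF B]])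
  interpret E: kleisli_ext A B X ?g
    by (intro kleisli_ext.intro A B kleisli_ext_axioms.intro X g)
  obtain \<phi> where \<phi>: "psh_iso (bang X (psh A)) (bang X B)
        (lam X B \<odot> bang_map (kan A B ?g :: (('o, 'a, 'x) presheaf, _, _, _) fctr))
        (kan (bang X A) (bang X B) ?F \<odot> lam X A) \<phi>"
    and \<phi>_eq: "canonical_ext_psh X A B ?g \<phi>"
    using E.ext_psh by blast
  obtain \<psi> where \<psi>: "psh_iso (bang X B) (bang X B) (lam X B \<odot> bang_map (yoneda B)) (yoneda (bang X B)) \<psi>"
    and \<psi>_eq: "canonical_unit_psh X B \<psi>"
    using unit_psh[OF X B] by blast
  have "psh_iso (bang X A) (bang X B) ?F ?Y (\<lambda>As. \<psi> (FO (bang_map H) As))"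
    using psh_iso_whisker[OF \<psi> bH] by (simp only: fcomp_assoc bang_map_fcomp)
  then have "\<exists>\<chi>. psh_iso (psh (bang X A)) (bang X B)
        (kan (bang X A) (bang X B) ?F :: (('o list, ('o, 'a) barr, ('o list \<times> 'x list \<times> ('o, 'a) barr) set) presheaf, _, _, _) fctr)
        (kan (bang X A) (bang X B) ?Y) \<chi> \<and>
      (\<forall>Z \<in> Obj (psh (bang X A)). \<forall>Ds \<in> Obj (bang X B). \<forall>(Cs, z, y) \<in> gens (bang X A) (kan_bif ?F Z Ds).
        \<chi> Z Ds (cls (bang X A) (kan_bif ?F Z Ds) (Cs, z, y)) =
        cls (bang X A) (kan_bif ?Y Z Ds) (Cs, z, \<psi> (FO (bang_map H) Cs) Ds y))"
    using BB by (rule psh_iso_kan)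
  then obtain \<chi> where
    \<chi>: "psh_iso (psh (bang X A)) (bang X B)
        (kan (bang X A) (bang X B) ?F :: (('o list, ('o, 'a) barr, ('o list \<times> 'x list \<times> ('o, 'a) barr) set) presheaf, _, _, _) fctr)
        (kan (bang X A) (bang X B) ?Y) \<chi>"
    and \<chi>_all: "\<forall>Z \<in> Obj (psh (bang X A)). \<forall>Ds \<in> Obj (bang X B). \<forall>(Cs, z, y) \<in> gens (bang X A) (kan_bif ?F Z Ds).
        \<chi> Z Ds (cls (bang X A) (kan_bif ?F Z Ds) (Cs, z, y)) =
        cls (bang X A) (kan_bif ?Y Z Ds) (Cs, z, \<psi> (FO (bang_map H) Cs) Ds y)"
    by (elim exE conjE)
  have \<chi>_eq: "\<chi> Z Ds (cls (bang X A) (kan_bif ?F Z Ds) (Cs, z, y)) =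
      cls (bang X A) (kan_bif ?Y Z Ds) (Cs, z, \<psi> (FO (bang_map H) Cs) Ds y)"
    if "is_presheaf (bang X A) Z" "Ds \<in> Obj (bang X B)" "(Cs, z, y) \<in> gens (bang X A) (kan_bif ?F Z Ds)" for Z Ds Cs z y
    using bspec[OF bspec[OF bspec[OF \<chi>_all, of Z] that(2)] that(3)] that(1) by simp
  let ?\<omega> = "\<lambda>Zs Ds x. \<chi> (FO (lam X A) Zs) Ds (\<phi> Zs Ds x)"
  have "psh_iso (bang X (psh A)) (bang X B)
      (lam X B \<odot> bang_map (psh_map A B H :: (('o, 'a, 'x) presheaf, _, _, _) fctr))
      (psh_map (bang X A) (bang X B) (bang_map H) \<odot> lam X A) ?\<omega>"
    unfolding psh_map_def
    by (rule psh_iso_trans[OF \<phi> psh_iso_whisker[OF \<chi> is_functor_lam[OF X A]]])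
  moreover have "canonical_naturality X A B H ?\<omega>"
    unfolding canonical_naturality_def
  proof (intro allI impI, elim conjE)
    fix Zs :: "('o, 'a, 'x) presheaf list" and Ds Es Cs zs fs u
    assume Zs: "Zs \<in> lists (Obj (psh A))" and Ds: "Ds \<in> lists (Obj B)" and Es: "Es \<in> lists (Obj B)"
      and Cs: "Cs \<in> lists (Obj A)"
      and len: "length Es = length Zs" "length Cs = length Zs" "length zs = length Zs" "length fs = length Zs"
      and i: "\<forall>i<length Zs. zs ! i \<in> At (Zs ! i) (Cs ! i) \<and> fs ! i \<in> Hom B (Es ! i) (FO H (Cs ! i))"
      and u: "u \<in> Hom (bang X B) Ds Es"
    let ?HC = "map (FO H) Cs"
    have HC: "?HC \<in> lists (Obj B)" using Cs H.FO_in by auto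
    have Cs': "Cs \<in> Obj (bang X A)" and Ds': "Ds \<in> Obj (bang X B)" using Cs Ds by simp_all
    let ?z = "cls (pow A (length Zs)) (lam_bif X A Zs Cs) (Cs, zs, Ide (bang X A) Cs)"
    let ?y = "cls (pow B (length Zs)) (lam_bif X B (map (FO ?g) Cs) Ds) (Es, fs, u)"
    have g_HC: "map (FO ?g) Cs = map (FO (yoneda B)) ?HC" by simp
    have "zs \<in> tup_at Zs Cs" using i len by (simp add: tup_at_def)
    then have z: "?z \<in> At (lam_ob X A Zs) Cs"
      using category.Ide_in[OF category_bang[OF X A] Cs'] by (intro lam_cls_in[OF Cs len(2)])
    have "fs \<in> tup_at (map (FO ?g) Cs) Es" using i len by (simp add: tup_at_def)
    then have "?y \<in> At (lam_ob X B (map (FO ?g) Cs)) Ds"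
      using lam_cls_in[OF Es, of "map (FO ?g) Cs" fs u X Ds] u len by simp
    then have y: "?y \<in> At (FO ?F Cs) Ds" by (simp only: E.FO_lam_g)
    have "\<phi> Zs Ds
          (cls (pow B (length Zs)) (lam_bif X B (map (FO (kan A B ?g)) Zs) Ds)
            (Es, map (\<lambda>i. cls A (kan_bif ?g (Zs ! i) (Es ! i)) (Cs ! i, zs ! i, fs ! i)) [0..<length Zs], u)) =
        cls (bang X A) (kan_bif ?F (lam_ob X A Zs) Ds) (Cs, ?z, ?y)"
      using \<phi>_eq[unfolded canonical_ext_psh_def, rule_format, of Zs Ds Es Cs zs fs u] Zs Ds Es Cs len i u by simp
    moreover have "\<chi> (lam_ob X A Zs) Ds (cls (bang X A) (kan_bif ?F (lam_ob X A Zs) Ds) (Cs, ?z, ?y)) =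
        cls (bang X A) (kan_bif ?Y (lam_ob X A Zs) Ds) (Cs, ?z, \<psi> (FO (bang_map H) Cs) Ds ?y)"
      using presheaf_lam[OF X A, of Zs] Zs z y Cs' by (intro \<chi>_eq Ds') (simp_all only: gens_kan psh_sel simp_thms)
    moreover have "\<psi> ?HC Ds ?y = par B fs \<cdot>\<^bsub>bang X B\<^esub> u"
      using \<psi>_eq[unfolded canonical_unit_psh_def, rule_format, of ?HC Ds Es fs u] HC Ds Es len i u
      by (simp only: g_HC length_map) simp
    moreover have "FO (bang_map H) Cs = ?HC" by (simp add: bang_map_def)
    ultimately show "?\<omega> Zs Ds
          (cls (pow B (length Zs)) (lam_bif X B (map (FO (psh_map A B H)) Zs) Ds)
            (Es, map (\<lambda>i. cls A (kan_bif ?g (Zs ! i) (Es ! i)) (Cs ! i, zs ! i, fs ! i)) [0..<length Zs], u)) =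
        cls (bang X A) (kan_bif ?Y (lam_ob X A Zs) Ds) (Cs, ?z, par B fs \<cdot>\<^bsub>bang X B\<^esub> u)"
      by (simp only: psh_map_def FO_lam)
  qed
  ultimately show ?thesis by blast
qed

section \<open>The distributive law\<close>

theorem proposition9p1:
  fixes X :: "combinator set"
    and A :: "('oa, 'aa) cat" and B :: "('ob, 'ab) cat" and C :: "('oc, 'ac) cat"
    and H :: "('oa, 'aa, 'ob, 'ab) fctr"
    and g :: "('oa, 'aa, ('ob, 'ab, 'y) presheaf, ('ob, 'ab, 'y) ptrans) fctr"
  assumes X: "X \<in> {{}, {Epsilon_c}, {Sigma_c}, {Sigma_c, Delta_c}, {Sigma_c, Epsilon_c},
                    {Sigma_c, Delta_c, Epsilon_c}}"
    and A: "category A" and B: "category B" and C: "category C"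
    and H: "is_functor A B H"
    and g: "is_functor A (psh B) g"
  shows
    \<comment> \<open>small categories are stable under \<open>!\<close>\<close>
    "category (bang X C) \<and>
    \<comment> \<open>the components of \<open>\<lambda>\<close> are functors\<close>
     is_functor (bang X (psh C)) (psh (bang X C))
       (lam X C :: (('oc, 'ac, 'x) presheaf list, _, _, _) fctr) \<and>
    \<comment> \<open>naturality\<close>
     (\<exists>\<phi>. psh_iso (bang X (psh A)) (bang X B)
            (lam X B \<odot> bang_map (psh_map A B H ::
               (('oa, 'aa, 'x) presheaf, _, _, _) fctr))
            (psh_map (bang X A) (bang X B) (bang_map H) \<odot> lam X A) \<phi> \<and>
          canonical_naturality X A B H \<phi>) \<and>
    \<comment> \<open>unit of \<open>!\<close>\<close>
     (\<exists>\<phi>. psh_iso (psh C) (bang X C)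
            (lam X C \<odot> eta_bang (psh C :: (('oc, 'ac, 'x) presheaf, _) cat))
            (psh_map C (bang X C) (eta_bang C)) \<phi> \<and>
          canonical_unit_bang X C \<phi>) \<and>
    \<comment> \<open>multiplication of \<open>!\<close>\<close>
     (\<exists>\<phi>. psh_iso (bang X (bang X (psh C))) (bang X C)
            (lam X C \<odot> (mu_bang :: (('oc, 'ac, 'x) presheaf list list, _, _, _) fctr))
            (psh_map (bang X (bang X C)) (bang X C) mu_bang \<odot> lam X (bang X C) \<odot> bang_map (lam X C)) \<phi> \<and>
          canonical_mult_bang X C \<phi>) \<and>
    \<comment> \<open>unit of \<open>Psh\<close>\<close>
     (\<exists>\<phi>. psh_iso (bang X C) (bang X C)
            (lam X C \<odot> bang_map (yoneda C))
            (yoneda (bang X C)) \<phi> \<and>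
          canonical_unit_psh X C \<phi>) \<and>
    \<comment> \<open>Kleisli extension of \<open>Psh\<close>\<close>
     (\<exists>\<phi>. psh_iso (bang X (psh A)) (bang X B)
            (lam X B \<odot> bang_map (kan A B g ::
               (('oa, 'aa, 'x) presheaf, _, _, _) fctr))
            (kan (bang X A) (bang X B) (lam X B \<odot> bang_map g) \<odot> lam X A) \<phi> \<and>
          canonical_ext_psh X A B g \<phi>)"
proof -
  have W: "wirable X" using X by (simp only: wirable_def)
  have M: "bang_cat C X" by (intro bang_cat.intro C bang_cat_axioms.intro W)
  have E: "kleisli_ext A B X g" by (intro kleisli_ext.intro A B kleisli_ext_axioms.intro W g)
  show ?thesis
    by (intro conjI category_bang[OF W C] is_functor_lam[OF W C] naturality[OF W H] unit_bang[OF W C]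
        bang_cat.mult_bang[OF M] unit_psh[OF W C] kleisli_ext.ext_psh[OF E])
qed

end
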